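(* Let $(\Sigma,\sigma)$ be a two-sided countable Markov shift of finite topological entropy, and let $\mathcal{E}_\sigma$ be the set of ergodic $\sigma$-invariant Borel probability measures on $\Sigma$, endowed with the weak$^*$ topology. Then the entropy map $\mathcal{E}_\sigma\to\mathbb{R}$, $\mu\mapsto h_\mu(\sigma)$, is upper semi-continuous; that is, if $(\mu_n)_n$ is a sequence in $\mathcal{E}_\sigma$ converging in the weak$^*$ topology to $\mu\in\mathcal{E}_\sigma$, then $$\limsup_{n\to\infty} h_{\mu_n}(\sigma)\le h_\mu(\sigma).$$
   Context: Two-sided countable Markov shift: let $\mathcal{A}$ be a countable alphabet and $S=(s_{ij})_{\mathcal{A}\times\mathcal{A}}$ a matrix of zeros and ones. Set $\Sigma=\{x\in\mathcal{A}^{\mathbb{Z}}: s_{x_ix_{i+1}}=1\text{ for every } i\in\mathbb{Z}\}$ with the shift map $(\sigma(x))_i=x_{i+1}$. The space $\Sigma$ carries the topology generated by the cylinder sets $[r_1,\dots,r_n]_l=\{x\in\Sigma: x_l=r_1,\dots,x_{l+n-1}=r_n\}$, $l\in\mathbb{Z}$. The shift is not assumed to be transitive. $h_\mu(\sigma)$ denotes the measure-theoretic (Kolmogorov–Sinai) entropy of an invariant probability measure $\mu$. The topological entropy is $h_{top}(\sigma)=\sup\{h_\mu(\sigma):\mu\in\mathcal{E}_\sigma\}$ (in the transitive case this coincides with the Gurevich entropy, the exponential growth rate of the number of periodic points in a fixed cylinder $[a]_0$). Weak$^*$ convergence $\mu_n\to\mu$ means $\int\phi\,d\mu_n\to\int\phi\,d\mu$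 for every bounded continuous $\phi:\Sigma\to\mathbb{R}$. *)

theory Defs
  imports "HOL-Probability.Probability" "HOL-Library.Disjoint_Sets"
begin

section \<open>Ergodic measures and entropy\<close>

definition measure_preserving :: "'x measure \<Rightarrow> ('x \<Rightarrow> 'x) \<Rightarrow> bool" where
  "measure_preserving M T \<longleftrightarrow> T \<in> M \<rightarrow>\<^sub>M M \<and> distr M M T = M"

definition ergodic :: "'x measure \<Rightarrow> ('x \<Rightarrow> 'x) \<Rightarrow> bool" where
  "ergodic M T \<longleftrightarrow> prob_space M \<and> measure_preserving M T \<and>
     (\<forall>B\<in>sets M. T -` B \<inter> space M = B \<longrightarrow> measure M B = 0 \<or> measure M B = 1)"

definition finite_measurable_partition :: "'x measure \<Rightarrow> 'x set set \<Rightarrow> bool" where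
  "finite_measurable_partition M P \<longleftrightarrow> finite P \<and> P \<subseteq> sets M \<and> partition_on (space M) P"

text \<open>Since \<open>ln 0 = 0\<close>, the convention \<open>0 log 0 = 0\<close> is built in. Logarithms are natural.\<close>

definition partition_entropy :: "'x measure \<Rightarrow> 'x set set \<Rightarrow> real" where
  "partition_entropy M P = (\<Sum>p\<in>P. - measure M p * ln (measure M p))"

definition pullback_partition :: "'x measure \<Rightarrow> ('x \<Rightarrow> 'x) \<Rightarrow> 'x set set \<Rightarrow> 'x set set" where
  "pullback_partition M T P = (\<lambda>p. T -` p \<inter> space M) ` P - {{}}"

text \<open>The join of \<open>T\<^sup>-\<^sup>i P\<close> for \<open>0 \<le> i < n\<close>. It is only meaningful for \<open>n \<ge> 1\<close>;
  the value at \<open>n = 0\<close> plays no role in the limit below.\<close>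

definition iterated_join :: "'x measure \<Rightarrow> ('x \<Rightarrow> 'x) \<Rightarrow> 'x set set \<Rightarrow> nat \<Rightarrow> 'x set set" where
  "iterated_join M T P n = common_refinement ((\<lambda>i. pullback_partition M (T ^^ i) P) ` {..<n})"

text \<open>For measure-preserving \<open>T\<close> the limit exists by subadditivity.\<close>

definition entropy_wrt_partition :: "'x measure \<Rightarrow> ('x \<Rightarrow> 'x) \<Rightarrow> 'x set set \<Rightarrow> real" where
  "entropy_wrt_partition M T P = lim (\<lambda>n. partition_entropy M (iterated_join M T P n) / real n)"

definition KS_entropy :: "'x measure \<Rightarrow> ('x \<Rightarrow> 'x) \<Rightarrow> ereal" where
  "KS_entropy M T = (SUP P\<in>{P. finite_measurable_partition M P}. ereal (entropy_wrt_partition M T P))"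


section \<open>Borel sets and weak-star convergence on an abstract topology\<close>

definition borel_of_topology :: "'x topology \<Rightarrow> 'x measure" where
  "borel_of_topology X = sigma (topspace X) {U. openin X U}"

definition weak_star_convergent ::
  "'x topology \<Rightarrow> (nat \<Rightarrow> 'x measure) \<Rightarrow> 'x measure \<Rightarrow> bool" where
  "weak_star_convergent X \<mu> \<nu> \<longleftrightarrow>
     (\<forall>\<phi>. continuous_map X euclideanreal \<phi> \<and> bounded (\<phi> ` topspace X) \<longrightarrow>
        (\<lambda>n. integral\<^sup>L (\<mu> n) \<phi>) \<longlonglongrightarrow> integral\<^sup>L \<nu> \<phi>)"


section \<open>Two-sided countable Markov shifts\<close>

definition zero_one_matrix :: "'a set \<Rightarrow> ('a \<Rightarrow> 'a \<Rightarrow> nat) \<Rightarrow> bool" where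
  "zero_one_matrix A S \<longleftrightarrow> (\<forall>i\<in>A. \<forall>j\<in>A. S i j \<in> {0, 1})"

definition shift_space :: "'a set \<Rightarrow> ('a \<Rightarrow> 'a \<Rightarrow> nat) \<Rightarrow> (int \<Rightarrow> 'a) set" where
  "shift_space A S = {x. (\<forall>i. x i \<in> A) \<and> (\<forall>i. S (x i) (x (i + 1)) = 1)}"

definition left_shift :: "(int \<Rightarrow> 'a) \<Rightarrow> (int \<Rightarrow> 'a)" where
  "left_shift x = (\<lambda>i. x (i + 1))"

definition cylinder :: "'a set \<Rightarrow> ('a \<Rightarrow> 'a \<Rightarrow> nat) \<Rightarrow> 'a list \<Rightarrow> int \<Rightarrow> (int \<Rightarrow> 'a) set" where
  "cylinder A S r l = {x \<in> shift_space A S. \<forall>k<length r. x (l + int k) = r ! k}"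

definition shift_topology :: "'a set \<Rightarrow> ('a \<Rightarrow> 'a \<Rightarrow> nat) \<Rightarrow> (int \<Rightarrow> 'a) topology" where
  "shift_topology A S = topology_generated_by {cylinder A S r l |r l. r \<noteq> [] \<and> set r \<subseteq> A}"

lemma topspace_shift_topology [simp]: "topspace (shift_topology A S) = shift_space A S"
proof -
  have "x \<in> cylinder A S [x 0] 0 \<and> x 0 \<in> A" if "x \<in> shift_space A S" for x
    using that by (auto simp: cylinder_def shift_space_def)
  then have "shift_space A S \<subseteq> \<Union> {cylinder A S r l |r l. r \<noteq> [] \<and> set r \<subseteq> A}"
    by (intro subsetI, rule_tac X = "cylinder A S [x 0] 0" in UnionI) fastforce+
  then show ?thesis
    by (auto simp: shift_topology_def cylinder_def)
qed

definition ergodic_measures :: "'a set \<Rightarrow> ('a \<Rightarrow> 'a \<Rightarrow> nat) \<Rightarrow> (int \<Rightarrow> 'a) measure set" where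
  "ergodic_measures A S =
     {\<mu>. sets \<mu> = sets (borel_of_topology (shift_topology A S)) \<and> ergodic \<mu> left_shift}"

text \<open>If there is no ergodic measure, the supremum in the extended reals is \<open>-\<infinity>\<close>.\<close>

definition top_entropy :: "'a set \<Rightarrow> ('a \<Rightarrow> 'a \<Rightarrow> nat) \<Rightarrow> ereal" where
  "top_entropy A S = (SUP \<mu>\<in>ergodic_measures A S. KS_entropy \<mu> left_shift)"

end

theory Submission
  imports Defs
begin

text \<open>
  Fix a symbol \<open>a\<close> charged by the limit measure. Concatenating independent uniformly chosen
  loops of length \<open>m\<close> at \<open>a\<close> gives an ergodic measure whose entropy is at least
  \<open>1/m\<close> times the logarithm of their number, so there are at most \<open>exp (h m)\<close> such loops, where
  \<open>h\<close> is the topological entropy. In particular the loops at \<open>a\<close> of length at most \<open>L\<close> use only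
  a finite set \<open>C\<close> of symbols. The coding of an orbit that records the symbols of \<open>C\<close> determines every
  excursion from \<open>a\<close> of length at most \<open>L\<close>, and leaves at most \<open>exp (h l)\<close> possibilities for the long
  excursions, \<open>l\<close> being the time spent in them. Hence the entropy of an ergodic measure charging
  \<open>a\<close> exceeds that of this finite coding by at most \<open>h\<close> times the measure of the set of points lying in
  a long excursion. That set is clopen, so its measure is controlled by the limit measure, for which it tends
  to 0 as \<open>L\<close> grows by recurrence; and the entropy of the fixed finite clopen partition is upper
  semi-continuous as an infimum of continuous functions.
\<close>

section \<open>Entropy of simple functions\<close>

text \<open>The shift space need not be compact, and a convergent sequence of measures may carry
  entropy on symbols that leave every finite set. A fixed finite clopen partition behaves well in
  the limit, but what it misses has to be bounded uniformly along the sequence, and independently of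
  how finely the symbols outside \<open>C\<close> are recorded. Two features make this possible. The
  bound on loops has no prefactor, and all long excursions of a path segment, glued together, form a
  single loop; their number and places cost nothing, since the visits to \<open>a\<close> are
  visible in the coarse code. The incomplete excursions at the two ends of a segment are not loops,
  so there only the crude bound by the size of the fine code is available; but by recurrence these
  ends have expected length o(n), so this contribution vanishes in the entropy rate for each fixed
  fine code, before the fine code is enlarged. The counting enters through the Gibbs inequality,
  with weights that spread the mass of a coarse itinerary over its possible refinements.\<close>

definition law :: "'x measure \<Rightarrow> ('x \<Rightarrow> 'b) \<Rightarrow> 'b \<Rightarrow> real" where
  "law M X v = measure M (X -` {v} \<inter> space M)"

text \<open>Entropy of the partition into fibres of \<open>X\<close>. With functions instead of
  partitions a join is a tuple and a coarsening is a composition, which keeps the inequalities below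
  short.\<close>

definition ent :: "'x measure \<Rightarrow> ('x \<Rightarrow> 'b) \<Rightarrow> real" where
  "ent M X = (\<Sum>v\<in>X ` space M. - law M X v * ln (law M X v))"

lemma law_nonneg [simp]: "0 \<le> law M X v"
  by (simp add: law_def)

lemma law_outside: "v \<notin> X ` space M \<Longrightarrow> law M X v = 0"
  unfolding law_def by (subgoal_tac "X -` {v} \<inter> space M = {}") auto

text \<open>Values that are not taken have law 0 and contribute nothing, so one value set can serve
  several functions or several measures at once.\<close>

lemma ent_eq_sum:
  assumes "finite V" "X ` space M \<subseteq> V"
  shows "ent M X = (\<Sum>v\<in>V. - law M X v * ln (law M X v))"
  unfolding ent_def using assms by (intro sum.mono_neutral_left) (auto simp: law_outside)

lemma simple_function_fun:
  assumes "finite I" "\<And>i. i \<in> I \<Longrightarrow> simple_function M (X i)"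
  shows "simple_function M (\<lambda>x. \<lambda>i\<in>I. X i x)"
  unfolding simple_function_def
proof (intro conjI ballI)
  have "(\<lambda>x. \<lambda>i\<in>I. X i x) ` space M \<subseteq> PiE I (\<lambda>i. X i ` space M)"
    by auto
  then show "finite ((\<lambda>x. \<lambda>i\<in>I. X i x) ` space M)"
    by (rule finite_subset) (use assms in \<open>auto intro!: finite_PiE dest: simple_functionD(1)\<close>)
next
  fix v assume v: "v \<in> (\<lambda>x. \<lambda>i\<in>I. X i x) ` space M"
  have "(\<lambda>x. \<lambda>i\<in>I. X i x) -` {v} \<inter> space M = {x \<in> space M. \<forall>i\<in>I. x \<in> X i -` {v i} \<inter> space M}"
    using v by (auto simp: fun_eq_iff restrict_def) metis+
  also have "\<dots> \<in> sets M"
    using assms by (intro sets.sets_Collect_finite_All) (auto simp: simple_functionD(2)[unfolded vimage_def])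
  finally show "(\<lambda>x. \<lambda>i\<in>I. X i x) -` {v} \<inter> space M \<in> sets M" .
qed

context prob_space
begin

lemma law_le_1 [simp]: "law M X v \<le> 1"
  by (simp add: law_def)

lemma ent_nonneg: "0 \<le> ent M X"
  unfolding ent_def
proof (rule sum_nonneg)
  fix v
  show "0 \<le> - law M X v * ln (law M X v)"
  proof (cases "law M X v = 0")
    case False
    then have "0 < law M X v" using law_nonneg[of M X v] by linarith
    then have "ln (law M X v) \<le> 0" by simp
    then show ?thesis by (simp add: mult_nonneg_nonpos)
  qed simp
qed

lemma simple_expectation:
  fixes g :: "'b \<Rightarrow> real"
  assumes "simple_function M X"
  shows "integrable M (\<lambda>x. g (X x))" and "expectation (\<lambda>x. g (X x)) = (\<Sum>v\<in>X ` space M. law M X v * g v)"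
proof -
  let ?s = "\<lambda>x. \<Sum>v\<in>X ` space M. g v * indicator (X -` {v} \<inter> space M) x"
  have eq: "g (X x) = ?s x" if "x \<in> space M" for x
  proof -
    have "?s x = (\<Sum>v\<in>X ` space M. if v = X x then g v else 0)"
      using that by (intro sum.cong) (auto simp: indicator_def)
    also have "\<dots> = g (X x)"
      using that simple_functionD(1)[OF assms] by simp
    finally show ?thesis by simp
  qed
  have int: "integrable M ?s"
    by (intro Bochner_Integration.integrable_sum integrable_mult_right)
       (auto intro!: integrable_real_indicator simple_functionD(2)[OF assms] simp: emeasure_eq_measure)
  show "integrable M (\<lambda>x. g (X x))"
    using int by (subst Bochner_Integration.integrable_cong[OF refl eq]) auto
  have "expectation (\<lambda>x. g (X x)) = expectation ?s"
    by (rule Bochner_Integration.integral_cong[OF refl eq])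
  also have "\<dots> = (\<Sum>v\<in>X ` space M. g v * law M X v)"
    by (subst Bochner_Integration.integral_sum)
       (auto intro!: integrable_real_indicator integrable_mult_right simple_functionD(2)[OF assms]
          simp: emeasure_eq_measure law_def)
  finally show "expectation (\<lambda>x. g (X x)) = (\<Sum>v\<in>X ` space M. law M X v * g v)"
    by (simp add: mult.commute)
qed

lemma ent_expectation:
  assumes "simple_function M X"
  shows "ent M X = expectation (\<lambda>x. - ln (law M X (X x)))"
  using simple_expectation(2)[OF assms, of "\<lambda>v. - ln (law M X v)"] by (simp add: ent_def)

lemma sum_law:
  assumes "simple_function M X" shows "(\<Sum>v\<in>X ` space M. law M X v) = 1"
  using simple_expectation(2)[OF assms, of "\<lambda>_. 1"] by (simp add: prob_space)

lemma law_mono: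
  assumes "simple_function M Y" "\<And>x. x \<in> space M \<Longrightarrow> X x = v \<Longrightarrow> Y x = w"
  shows "law M X v \<le> law M Y w"
  unfolding law_def using assms by (intro finite_measure_mono simple_functionD(2)) auto

text \<open>Gibbs inequality, from \<open>ln t \<le> t - 1\<close>, with weights of total mass at
  most 1. The condition \<open>pos\<close> guards against \<open>ln 0 = 0\<close>: a vanishing
  weight would count as cost 0 instead of infinite cost. Strong subadditivity, the Fano-type bound
  and the counting of refinements are three choices of \<open>q\<close>.\<close>

lemma gibbs:
  assumes X: "simple_function M X" and q0: "\<And>v. v \<in> X ` space M \<Longrightarrow> 0 \<le> q v"
    and q1: "(\<Sum>v\<in>X ` space M. q v) \<le> 1"
    and pos: "\<And>v. v \<in> X ` space M \<Longrightarrow> 0 < law M X v \<Longrightarrow> 0 < q v"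
  shows "ent M X \<le> expectation (\<lambda>x. - ln (q (X x)))"
proof -
  let ?p = "law M X"
  have "ent M X - expectation (\<lambda>x. - ln (q (X x))) = (\<Sum>v\<in>X ` space M. ?p v * ln (q v) - ?p v * ln (?p v))"
    unfolding simple_expectation(2)[OF X, of "\<lambda>v. - ln (q v)"] ent_def
    by (simp add: sum_subtractf sum_negf)
  also have "\<dots> \<le> (\<Sum>v\<in>X ` space M. q v - ?p v)"
  proof (rule sum_mono)
    fix v assume v: "v \<in> X ` space M"
    show "?p v * ln (q v) - ?p v * ln (?p v) \<le> q v - ?p v"
    proof (cases "?p v = 0")
      case False
      then have p: "?p v > 0" using law_nonneg[of M X v] by linarith
      then have q: "q v > 0" using pos v by auto
      have "ln (q v / ?p v) \<le> q v / ?p v - 1"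
        using p q by (intro ln_le_minus_one) auto
      then have "?p v * ln (q v / ?p v) \<le> ?p v * (q v / ?p v - 1)"
        using p by (intro mult_left_mono) auto
      then show ?thesis using p q by (simp add: ln_div algebra_simps)
    qed (use q0 v in auto)
  qed
  also have "\<dots> \<le> 0"
    using q1 sum_law[OF X] by (simp add: sum_subtractf)
  finally show ?thesis by simp
qed

text \<open>The fibre of \<open>X\<close> over \<open>v\<close> is contained in the fibre of
  \<open>Y\<close> over \<open>f v\<close>, so pointwise \<open>Y\<close> carries the smaller
  information.\<close>

lemma ent_mono:
  assumes X: "simple_function M X" and Y: "simple_function M Y"
    and f: "\<And>x. x \<in> space M \<Longrightarrow> Y x = f (X x)"
  shows "ent M Y \<le> ent M X"
proof -
  have "ent M Y = expectation (\<lambda>x. - ln (law M Y (f (X x))))"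
    unfolding ent_expectation[OF Y] by (rule Bochner_Integration.integral_cong) (auto simp: f)
  also have "\<dots> = (\<Sum>v\<in>X ` space M. law M X v * - ln (law M Y (f v)))"
    by (rule simple_expectation[OF X])
  also have "\<dots> \<le> ent M X"
    unfolding ent_def
  proof (rule sum_mono)
    fix v
    show "law M X v * - ln (law M Y (f v)) \<le> - law M X v * ln (law M X v)"
    proof (cases "law M X v = 0")
      case False
      then have "0 < law M X v" using law_nonneg[of M X v] by linarith
      moreover have "law M X v \<le> law M Y (f v)"
        using f by (intro law_mono Y) auto
      ultimately show ?thesis by simp
    qed simp
  qed
  finally show ?thesis .
qed

lemma ent_const: "ent M (\<lambda>_. c) = 0"
proof -
  have "law M (\<lambda>_. c) c = 1" by (simp add: law_def prob_space)
  then show ?thesis by (auto simp: ent_def image_constant_conv)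
qed

lemma sum_law_Pair:
  assumes X: "simple_function M X" and Z: "simple_function M Z"
  shows "(\<Sum>x\<in>X ` space M. law M (\<lambda>\<omega>. (X \<omega>, Z \<omega>)) (x, z)) = law M Z z"
proof -
  have "law M Z z = measure M (\<Union>x\<in>X ` space M. (\<lambda>\<omega>. (X \<omega>, Z \<omega>)) -` {(x, z)} \<inter> space M)"
    unfolding law_def by (rule arg_cong[where f = "measure M"]) auto
  also have "\<dots> = (\<Sum>x\<in>X ` space M. law M (\<lambda>\<omega>. (X \<omega>, Z \<omega>)) (x, z))"
    unfolding law_def using simple_functionD(2)[OF simple_function_Pair[OF X Z]]
    by (intro finite_measure_finite_Union simple_functionD(1)[OF X]) (auto simp: disjoint_family_on_def)
  finally show ?thesis ..
qed

text \<open>In conditional form: H(X,Y | Z) is at most H(X | Z) + H(Y | Z). It is the Gibbs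
  inequality against the law that keeps the laws of \<open>(X, Z)\<close> and \<open>(Y, Z)\<close>
  but makes \<open>X\<close> and \<open>Y\<close> independent given \<open>Z\<close>.\<close>

lemma ent_strong_subadditive:
  assumes X: "simple_function M X" and Y: "simple_function M Y" and Z: "simple_function M Z"
  shows "ent M (\<lambda>\<omega>. (X \<omega>, Y \<omega>, Z \<omega>)) + ent M Z \<le> ent M (\<lambda>\<omega>. (X \<omega>, Z \<omega>)) + ent M (\<lambda>\<omega>. (Y \<omega>, Z \<omega>))"
proof -
  let ?XZ = "\<lambda>\<omega>. (X \<omega>, Z \<omega>)" and ?YZ = "\<lambda>\<omega>. (Y \<omega>, Z \<omega>)" and ?W = "\<lambda>\<omega>. (X \<omega>, Y \<omega>, Z \<omega>)"
  note sf = simple_function_Pair[OF X Z] simple_function_Pair[OF Y Z]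
    simple_function_Pair[OF X simple_function_Pair[OF Y Z]]
  define q where "q = (\<lambda>(x, y, z). law M ?XZ (x, z) * law M ?YZ (y, z) / law M Z z)"
  have pos: "0 < law M ?XZ (x, z)" "0 < law M ?YZ (y, z)" "0 < law M Z z"
    if "0 < law M ?W (x, y, z)" for x y z
    using that law_mono[OF sf(1), of ?W "(x, y, z)" "(x, z)"]
      law_mono[OF sf(2), of ?W "(x, y, z)" "(y, z)"] law_mono[OF Z, of ?W "(x, y, z)" z] by auto
  have fin: "finite (X ` space M)" "finite (Y ` space M)" "finite (Z ` space M)"
    using X Y Z by (auto dest: simple_functionD)
  have "(\<Sum>v\<in>?W ` space M. q v) \<le> (\<Sum>v\<in>X ` space M \<times> Y ` space M \<times> Z ` space M. q v)"
    using fin by (intro sum_mono2) (auto simp: q_def)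
  also have "\<dots> = (\<Sum>x\<in>X ` space M. \<Sum>y\<in>Y ` space M. \<Sum>z\<in>Z ` space M. q (x, y, z))"
    by (simp add: sum.cartesian_product)
  also have "\<dots> = (\<Sum>z\<in>Z ` space M. \<Sum>x\<in>X ` space M. \<Sum>y\<in>Y ` space M. q (x, y, z))"
    by (subst sum.swap, subst sum.swap) (intro sum.cong refl sum.swap)
  also have "\<dots> = (\<Sum>z\<in>Z ` space M. (\<Sum>x\<in>X ` space M. law M ?XZ (x, z)) * (\<Sum>y\<in>Y ` space M. law M ?YZ (y, z)) / law M Z z)"
    by (simp add: q_def sum_product sum_divide_distrib)
  also have "\<dots> = (\<Sum>z\<in>Z ` space M. law M Z z)"
    by (simp add: sum_law_Pair X Y Z)
  also have "\<dots> = 1" by (rule sum_law[OF Z])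
  finally have "ent M ?W \<le> expectation (\<lambda>\<omega>. - ln (q (?W \<omega>)))"
    by (intro gibbs sf(3)) (auto simp: q_def pos)
  also have "\<dots> = (\<Sum>v\<in>?W ` space M. law M ?W v * - ln (q v))"
    by (rule simple_expectation[OF sf(3)])
  also have "\<dots> = (\<Sum>v\<in>?W ` space M. law M ?W v *
      (case v of (x, y, z) \<Rightarrow> - ln (law M ?XZ (x, z)) - ln (law M ?YZ (y, z)) + ln (law M Z z)))"
  proof (intro sum.cong refl)
    fix v :: "'b \<times> 'c \<times> 'd"
    obtain x y z where v: "v = (x, y, z)" by (cases v)
    show "law M ?W v * - ln (q v) = law M ?W v *
      (case v of (x, y, z) \<Rightarrow> - ln (law M ?XZ (x, z)) - ln (law M ?YZ (y, z)) + ln (law M Z z))"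
    \<comment> \<open>The logarithm of \<open>q\<close> splits only where all its factors are
      positive; elsewhere the prefactor is 0.\<close>
    proof (cases "law M ?W (x, y, z) = 0")
      case False
      then have "0 < law M ?W (x, y, z)" using law_nonneg[of M ?W "(x,y,z)"] by linarith
      from pos[OF this] show ?thesis by (simp add: v q_def ln_div ln_mult)
    qed (simp add: v)
  qed
  also have "\<dots> = expectation (\<lambda>\<omega>. - ln (law M ?XZ (?XZ \<omega>)) - ln (law M ?YZ (?YZ \<omega>)) + ln (law M Z (Z \<omega>)))"
    by (subst simple_expectation(2)[OF sf(3), symmetric]) simp
  also have "\<dots> = expectation (\<lambda>\<omega>. - ln (law M ?XZ (?XZ \<omega>))) + expectation (\<lambda>\<omega>. - ln (law M ?YZ (?YZ \<omega>)))
      - expectation (\<lambda>\<omega>. - ln (law M Z (Z \<omega>)))"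
    using simple_expectation(1)[OF sf(1), of "\<lambda>v. ln (law M ?XZ v)"]
      simple_expectation(1)[OF sf(2), of "\<lambda>v. ln (law M ?YZ v)"]
      simple_expectation(1)[OF Z, of "\<lambda>v. ln (law M Z v)"] by simp
  also have "\<dots> = ent M ?XZ + ent M ?YZ - ent M Z"
    by (simp only: ent_expectation[OF sf(1)] ent_expectation[OF sf(2)] ent_expectation[OF Z])
  finally show ?thesis by simp
qed

text \<open>Strong subadditivity with a constant \<open>Z\<close>, whose entropy is 0; the outer
  steps only add and remove the dummy component \<open>()\<close>.\<close>

lemma ent_subadditive:
  assumes X: "simple_function M X" and Y: "simple_function M Y"
  shows "ent M (\<lambda>\<omega>. (X \<omega>, Y \<omega>)) \<le> ent M X + ent M Y"
proof -
  have "ent M (\<lambda>\<omega>. (X \<omega>, Y \<omega>)) \<le> ent M (\<lambda>\<omega>. (X \<omega>, Y \<omega>, ()))"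
    by (rule ent_mono[where f = "\<lambda>(x, y, z). (x, y)"]) (auto simp: X Y)
  also have "\<dots> \<le> ent M (\<lambda>\<omega>. (X \<omega>, ())) + ent M (\<lambda>\<omega>. (Y \<omega>, ()))"
    using ent_strong_subadditive[OF X Y, of "\<lambda>_. ()"] by (simp add: ent_const)
  also have "ent M (\<lambda>\<omega>. (X \<omega>, ())) \<le> ent M X"
    by (rule ent_mono[where f = "\<lambda>x. (x, ())"]) (auto simp: X)
  also have "ent M (\<lambda>\<omega>. (Y \<omega>, ())) \<le> ent M Y"
    by (rule ent_mono[where f = "\<lambda>x. (x, ())"]) (auto simp: Y)
  finally show ?thesis by simp
qed

end

text \<open>Fekete's lemma. Besides convergence it matters that the limit is an infimum: every
  single \<open>n\<close> then gives an upper bound for the entropy rate.\<close>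

lemma fekete:
  fixes a :: "nat \<Rightarrow> real"
  assumes sub: "\<And>m n. a (m + n) \<le> a m + a n" and nonneg: "\<And>n. 0 \<le> a n"
  shows "(\<lambda>n. a n / n) \<longlonglongrightarrow> (INF n\<in>{1..}. a n / n)"
proof -
  let ?I = "INF n\<in>{1::nat..}. a n / n"
  have bdd: "bdd_below ((\<lambda>n. a n / real n) ` {1..})"
    by (rule bdd_belowI[of _ 0]) (auto simp: nonneg)
  have lower: "?I \<le> a n / n" if "n \<ge> 1" for n
    using that by (intro cINF_lower[OF bdd]) auto
  \<comment> \<open>The summand \<open>a 0\<close> covers \<open>q = 0\<close>, since subadditivity
    does not force \<open>a 0\<close> to vanish.\<close>
  have mult: "a (q * k) \<le> q * a k + a 0" for q k
  proof (induction q)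
    case (Suc q)
    have "a (Suc q * k) \<le> a k + a (q * k)" using sub[of k "q * k"] by simp
    then show ?case using Suc by (simp add: algebra_simps)
  qed simp
  show ?thesis
  proof (rule LIMSEQ_I)
    fix e :: real assume e: "e > 0"
    have "\<exists>k\<ge>1. a k / k < ?I + e/2"
      using cINF_less_iff[OF _ bdd, of "?I + e/2"] e by auto
    then obtain k where k: "k \<ge> 1" "a k / k < ?I + e/2" by auto
    \<comment> \<open>Absorbs \<open>a 0\<close> and whatever the remainder \<open>n mod k\<close>
      contributes, uniformly in \<open>n\<close>.\<close>
    define C where "C = a 0 + (\<Sum>r<k. a r)"
    have C: "C \<ge> 0" by (simp add: C_def nonneg sum_nonneg)
    obtain N where N: "real N > 2 * C / e" using reals_Archimedean2 by blast
    show "\<exists>no. \<forall>n\<ge>no. norm (a n / n - ?I) < e"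
    proof (intro exI allI impI)
      fix n assume n: "n \<ge> max 1 N"
      have "a n = a ((n div k) * k + n mod k)" by simp
      also have "\<dots> \<le> (n div k) * a k + a 0 + a (n mod k)"
        using sub[of "(n div k) * k" "n mod k"] mult[of "n div k" k] by linarith
      also have "a (n mod k) \<le> (\<Sum>r<k. a r)"
        using k by (intro member_le_sum) (auto simp: nonneg)
      also have "(n div k) * a k \<le> n / k * a k"
        by (intro mult_right_mono nonneg) (simp add: of_nat_div_le_of_nat)
      finally have "a n \<le> n * (a k / k) + C" by (simp add: C_def)
      then have "a n / n \<le> a k / k + C / n" using n by (simp add: field_simps)
      moreover have "C / n < e / 2"
      proof -
        have "2 * C / e < n" using N n by linarith
        then show ?thesis using e n by (simp add: field_simps)
      qed
      ultimately have "a n / n < ?I + e" using k(2) by linarith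
      then show "norm (a n / n - ?I) < e" using lower[of n] n by simp
    qed
  qed
qed

section \<open>Measure-preserving systems\<close>

definition fibres :: "'x measure \<Rightarrow> ('x \<Rightarrow> 'b) \<Rightarrow> 'x set set" where
  "fibres M X = (\<lambda>v. X -` {v} \<inter> space M) ` X ` space M"

lemma partition_on_fibres: "partition_on (space M) (fibres M X)"
  unfolding fibres_def by (rule partition_onI) (auto simp: disjnt_def)

text \<open>Saves the reverse inclusion whenever a partition is identified with a family of fibres
  below.\<close>

lemma partition_on_subset_eq:
  assumes "partition_on A P" "partition_on A Q" "P \<subseteq> Q" shows "P = Q"
proof -
  have "q \<in> P" if q: "q \<in> Q" for q
  proof -
    obtain x where x: "x \<in> q" using q assms(2) by (metis partition_onD3 ex_in_conv)
    then have "x \<in> A" using q assms(2) by (auto simp: partition_on_def)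
    then obtain p where p: "p \<in> P" "x \<in> p" using assms(1) by (auto simp: partition_on_def)
    then have "p = q" using q x assms(2,3) by (auto simp: partition_on_def disjoint_def)
    then show ?thesis using p by simp
  qed
  then show ?thesis using assms(3) by auto
qed

text \<open>Each point is labelled by the cell that contains it.\<close>

lemma partition_eq_fibres:
  assumes "partition_on (space M) P"
  shows "P = fibres M (\<lambda>x. THE p. p \<in> P \<and> x \<in> p)"
proof -
  have eq: "(THE p. p \<in> P \<and> x \<in> p) = p" if "p \<in> P" "x \<in> p" for p x
    using that assms by (intro the_equality) (auto simp: partition_on_def disjoint_def)
  have "P \<subseteq> fibres M (\<lambda>x. THE p. p \<in> P \<and> x \<in> p)"
  proof
    fix p assume p: "p \<in> P"
    obtain x where x: "x \<in> p" using p assms by (metis partition_onD3 ex_in_conv)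
    have sub: "p \<subseteq> space M" using p assms by (auto simp: partition_on_def)
    have "p = (\<lambda>x. THE p. p \<in> P \<and> x \<in> p) -` {THE p. p \<in> P \<and> x \<in> p} \<inter> space M" (is "p = ?F")
    proof
      show "p \<subseteq> ?F" using sub eq[OF p] eq[OF p x] by auto
      show "?F \<subseteq> p"
      proof
        fix y assume y: "y \<in> ?F"
        then obtain r where r: "r \<in> P" "y \<in> r" using assms by (auto simp: partition_on_def)
        then show "y \<in> p" using y eq[OF r] eq[OF p x] by auto
      qed
    qed
    then show "p \<in> fibres M (\<lambda>x. THE p. p \<in> P \<and> x \<in> p)"
      unfolding fibres_def using x sub by blast
  qed
  then show ?thesis using partition_on_subset_eq[OF assms partition_on_fibres] by blast
qed

lemma finite_measurable_partition_fibres_iff: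
  "finite_measurable_partition M (fibres M X) \<longleftrightarrow> simple_function M X"
proof -
  have "inj_on (\<lambda>v. X -` {v} \<inter> space M) (X ` space M)"
    by (rule inj_onI) auto
  then show ?thesis
    using partition_on_fibres[of M X] unfolding finite_measurable_partition_def simple_function_def fibres_def
    by (auto simp: finite_image_iff)
qed

lemma partition_entropy_fibres: "partition_entropy M (fibres M X) = ent M X"
proof -
  have "inj_on (\<lambda>v. X -` {v} \<inter> space M) (X ` space M)"
    by (rule inj_onI) auto
  then show ?thesis
    by (simp add: partition_entropy_def fibres_def sum.reindex ent_def law_def)
qed

section \<open>Itineraries and entropy rates\<close>

locale measure_preserving_system = prob_space M for M :: "'x measure" +
  fixes T :: "'x \<Rightarrow> 'x"
  assumes measure_preserving: "measure_preserving M T"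
begin

lemma measurable_T: "T \<in> M \<rightarrow>\<^sub>M M" and distr_T: "distr M M T = M"
  using measure_preserving by (auto simp: measure_preserving_def)

lemma measurable_funpow: "T ^^ i \<in> M \<rightarrow>\<^sub>M M"
  by (induction i) (auto intro: measurable_compose[OF _ measurable_T])

lemma distr_funpow: "distr M M (T ^^ i) = M"
proof (induction i)
  case (Suc i)
  have "distr M M (T ^^ Suc i) = distr (distr M M (T ^^ i)) M T"
    using distr_distr[OF measurable_T measurable_funpow[of i]] by (simp add: o_def)
  then show ?case by (simp only: Suc.IH distr_T)
qed (simp add: distr_id2 id_def)

lemma funpow_in_space: "x \<in> space M \<Longrightarrow> (T ^^ i) x \<in> space M"
  using measurable_space[OF measurable_funpow] by blast

lemma measure_vimage_funpow:
  assumes "A \<in> sets M" shows "measure M ((T ^^ i) -` A \<inter> space M) = measure M A"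
  using measure_distr[OF measurable_funpow[of i] assms] by (simp add: distr_funpow)

text \<open>The coded orbit segment of length \<open>n\<close>; for \<open>n \<ge> 1\<close> its
  fibres are the cells of the iterated join. It depends on the map only, so the same itinerary
  function serves all invariant measures of that map.\<close>

definition itin :: "('x \<Rightarrow> 'b) \<Rightarrow> nat \<Rightarrow> 'x \<Rightarrow> nat \<Rightarrow> 'b" where
  "itin X n x = (\<lambda>i\<in>{..<n}. X ((T ^^ i) x))"

definition entropy_rate :: "('x \<Rightarrow> 'b) \<Rightarrow> real" where
  "entropy_rate X = lim (\<lambda>n. ent M (itin X n) / n)"

lemma simple_funpow: "simple_function M X \<Longrightarrow> simple_function M (\<lambda>x. X ((T ^^ i) x))"
  by (rule simple_function_comp[OF measurable_funpow])

lemma simple_itin: "simple_function M X \<Longrightarrow> simple_function M (itin X n)"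
  unfolding itin_def by (intro simple_function_fun simple_funpow) auto

lemma law_funpow:
  assumes "simple_function M X" shows "law M (\<lambda>x. X ((T ^^ i) x)) v = law M X v"
proof -
  have "(\<lambda>x. X ((T ^^ i) x)) -` {v} \<inter> space M = (T ^^ i) -` (X -` {v} \<inter> space M) \<inter> space M"
    using funpow_in_space by auto
  then show ?thesis
    using measure_vimage_funpow[OF simple_functionD(2)[OF assms, of "{v}"], of i] by (simp add: law_def)
qed

lemma ent_funpow:
  assumes "simple_function M X" shows "ent M (\<lambda>x. X ((T ^^ i) x)) = ent M X"
proof -
  \<comment> \<open>\<open>T ^^ i\<close> need not be onto, so the shifted function may take fewer
    values; both entropies are summed over the values of \<open>X\<close>.\<close>
  have "ent M (\<lambda>x. X ((T ^^ i) x)) = (\<Sum>v\<in>X ` space M. - law M (\<lambda>x. X ((T ^^ i) x)) v * ln (law M (\<lambda>x. X ((T ^^ i) x)) v))"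
    using funpow_in_space by (intro ent_eq_sum simple_functionD(1)[OF assms]) auto
  then show ?thesis using law_funpow[OF assms] by (simp add: ent_def)
qed

lemma ent_itin_subadditive:
  assumes X: "simple_function M X"
  shows "ent M (itin X (m + n)) \<le> ent M (itin X m) + ent M (itin X n)"
proof -
  have "ent M (itin X (m + n)) \<le> ent M (\<lambda>x. (itin X m x, itin X n ((T ^^ m) x)))"
  proof (rule ent_mono[where f = "\<lambda>(u, v). \<lambda>i\<in>{..<m+n}. if i < m then u i else v (i - m)"])
    fix x
    show "itin X (m + n) x = (case (itin X m x, itin X n ((T ^^ m) x)) of
        (u, v) \<Rightarrow> \<lambda>i\<in>{..<m+n}. if i < m then u i else v (i - m))"
      by (auto simp: itin_def fun_eq_iff restrict_def funpow_add[symmetric, THEN fun_cong, unfolded o_def])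
  qed (intro simple_function_Pair simple_itin simple_funpow X)+
  also have "\<dots> \<le> ent M (itin X m) + ent M (\<lambda>x. itin X n ((T ^^ m) x))"
    by (intro ent_subadditive simple_itin simple_funpow X)
  finally show ?thesis using ent_funpow[OF simple_itin[OF X]] by simp
qed

lemma ent_itin_0: "ent M (itin X 0) = 0"
  unfolding itin_def using ent_const[of "\<lambda>_. undefined"] by (simp add: restrict_def)

lemma entropy_rate_limit_INF:
  assumes "simple_function M X"
  shows "(\<lambda>n. ent M (itin X n) / n) \<longlonglongrightarrow> (INF n\<in>{1..}. ent M (itin X n) / n)"
  by (rule fekete) (auto simp: ent_itin_subadditive assms ent_nonneg)

lemma entropy_rate_limit:
  assumes "simple_function M X" shows "(\<lambda>n. ent M (itin X n) / n) \<longlonglongrightarrow> entropy_rate X"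
  using entropy_rate_limit_INF[OF assms] limI unfolding entropy_rate_def by metis

text \<open>The source of upper semi-continuity: the rate is an infimum of entropies of finite
  windows, and for a finite clopen code each of these is continuous in the measure.\<close>

lemma entropy_rate_le:
  assumes "simple_function M X" "n \<ge> 1" shows "entropy_rate X \<le> ent M (itin X n) / n"
proof -
  have "entropy_rate X = (INF n\<in>{1..}. ent M (itin X n) / n)"
    unfolding entropy_rate_def by (rule limI[OF entropy_rate_limit_INF[OF assms(1)]])
  then show ?thesis
    using assms(2) by (auto intro!: cINF_lower bdd_belowI[of _ 0] simp: ent_nonneg)
qed

text \<open>An additive constant disappears after division by \<open>n\<close>; an error growing
  like \<open>n * d\<close> survives as \<open>d\<close>.\<close>

lemma entropy_rate_mono:
  assumes X: "simple_function M X" and Y: "simple_function M Y"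
    and le: "\<And>n. ent M (itin X n) \<le> ent M (itin Y n) + n * (d :: real) + C"
  shows "entropy_rate X \<le> entropy_rate Y + (d :: real)"
proof (rule LIMSEQ_le)
  show "(\<lambda>n. ent M (itin X n) / n) \<longlonglongrightarrow> entropy_rate X" by (rule entropy_rate_limit[OF X])
  have "(\<lambda>n. ent M (itin Y n) / n + d + C * (1 / n)) \<longlonglongrightarrow> entropy_rate Y + d + C * 0"
    by (intro tendsto_intros entropy_rate_limit[OF Y] lim_1_over_n)
  then show "(\<lambda>n. ent M (itin Y n) / n + d + C * (1 / n)) \<longlonglongrightarrow> entropy_rate Y + d" by simp
  show "\<exists>N. \<forall>n\<ge>N. ent M (itin X n) / real n \<le> ent M (itin Y n) / n + d + C * (1 / n)"
  proof (intro exI allI impI)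
    fix n :: nat assume "n \<ge> 1"
    then show "ent M (itin X n) / real n \<le> ent M (itin Y n) / n + d + C * (1 / n)"
      using le[of n] by (simp add: field_simps)
  qed
qed

text \<open>Conditional entropy is written as a difference: given the \<open>Y\<close>-itinerary,
  the \<open>X\<close>-itinerary costs at most H(X | Y) per letter. The induction is on the joint
  entropy of both itineraries; dropping the \<open>Y\<close>-part at the end only lowers the left
  side.\<close>

lemma ent_itin_conditional:
  assumes X: "simple_function M X" and Y: "simple_function M Y"
  shows "ent M (itin X n) \<le> ent M (itin Y n) + n * (ent M (\<lambda>x. (X x, Y x)) - ent M Y)"
proof -
  have "ent M (\<lambda>x. (itin X n x, itin Y n x)) \<le> ent M (itin Y n) + n * (ent M (\<lambda>x. (X x, Y x)) - ent M Y)"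
  proof (induction n)
    case 0
    have "ent M (\<lambda>x. (itin X 0 x, itin Y 0 x)) \<le> ent M (itin X 0) + ent M (itin Y 0)"
      by (intro ent_subadditive simple_itin X Y)
    then show ?case by (simp add: ent_itin_0)
  next
    case (Suc n)
    let ?Xn = "\<lambda>x. X ((T ^^ n) x)" and ?Yn = "\<lambda>x. Y ((T ^^ n) x)"
    let ?A = "itin X n" and ?B = "itin Y n"
    note sf = simple_itin[OF X, of n] simple_itin[OF Y, of n] simple_funpow[OF X, of n] simple_funpow[OF Y, of n]
    have split: "itin Z (Suc n) x = (itin Z n x)(n := Z ((T ^^ n) x))" for Z :: "'x \<Rightarrow> 'z" and x
      by (auto simp: itin_def fun_eq_iff restrict_def less_Suc_eq)
    have "ent M (\<lambda>x. (itin X (Suc n) x, itin Y (Suc n) x)) \<le> ent M (\<lambda>x. (?A x, ?Xn x, ?B x, ?Yn x))"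
      by (rule ent_mono[where f = "\<lambda>(a, x, b, y). (a(n := x), b(n := y))"],
          intro sf simple_function_Pair, intro simple_function_Pair simple_itin X Y) (simp add: split)
    \<comment> \<open>Three uses of strong subadditivity. This one separates \<open>?A\<close> from
      the new letter \<open>?Xn\<close>, given \<open>?B\<close> and \<open>?Yn\<close>; the next
      removes the new \<open>?Yn\<close> from the condition on \<open>?A\<close>; the last removes
      the past \<open>?B\<close> from the condition on \<open>?Xn\<close>.\<close>
    also have "\<dots> \<le> ent M (\<lambda>x. (?A x, ?B x, ?Yn x)) + ent M (\<lambda>x. (?Xn x, ?B x, ?Yn x)) - ent M (\<lambda>x. (?B x, ?Yn x))"
      using ent_strong_subadditive[OF sf(1,3) simple_function_Pair[OF sf(2,4)]] by simp
    also have "ent M (\<lambda>x. (?A x, ?B x, ?Yn x)) \<le> ent M (\<lambda>x. (?A x, ?B x)) + ent M (\<lambda>x. (?B x, ?Yn x)) - ent M ?B"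
    proof -
      have "ent M (\<lambda>x. (?A x, ?B x, ?Yn x)) \<le> ent M (\<lambda>x. (?A x, ?Yn x, ?B x))"
        by (rule ent_mono[where f = "\<lambda>(a, y, b). (a, b, y)"]) (auto intro!: sf simple_function_Pair)
      also have "\<dots> \<le> ent M (\<lambda>x. (?A x, ?B x)) + ent M (\<lambda>x. (?Yn x, ?B x)) - ent M ?B"
        using ent_strong_subadditive[OF sf(1,4,2)] by simp
      also have "ent M (\<lambda>x. (?Yn x, ?B x)) \<le> ent M (\<lambda>x. (?B x, ?Yn x))"
        by (rule ent_mono[where f = prod.swap]) (auto intro!: sf simple_function_Pair)
      finally show ?thesis by simp
    qed
    also have "ent M (\<lambda>x. (?Xn x, ?B x, ?Yn x)) \<le> ent M (\<lambda>x. (?Xn x, ?Yn x)) + ent M (\<lambda>x. (?B x, ?Yn x)) - ent M ?Yn"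
      using ent_strong_subadditive[OF sf(3,2,4)] by simp
    also have "ent M (\<lambda>x. (?Xn x, ?Yn x)) = ent M (\<lambda>x. (X x, Y x))"
      using ent_funpow[OF simple_function_Pair[OF X Y], of n] by simp
    also have "ent M ?Yn = ent M Y" by (rule ent_funpow[OF Y])
    also have "ent M (\<lambda>x. (?B x, ?Yn x)) \<le> ent M (itin Y (Suc n))"
      by (rule ent_mono[where f = "\<lambda>y. (\<lambda>i\<in>{..<n}. y i, y n)"], intro simple_itin Y,
          intro sf simple_function_Pair) (auto simp: itin_def restrict_def fun_eq_iff)
    finally show ?case using Suc by (simp add: algebra_simps)
  qed
  moreover have "ent M (itin X n) \<le> ent M (\<lambda>x. (itin X n x, itin Y n x))"
    by (rule ent_mono[where f = fst]) (auto intro!: simple_function_Pair simple_itin X Y)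
  ultimately show ?thesis by simp
qed

section \<open>Agreement with the entropy defined by partitions\<close>

lemma pullback_partition_fibres:
  "pullback_partition M (T ^^ i) (fibres M X) = fibres M (\<lambda>x. X ((T ^^ i) x))"
proof (rule partition_on_subset_eq)
  show sub: "pullback_partition M (T ^^ i) (fibres M X) \<subseteq> fibres M (\<lambda>x. X ((T ^^ i) x))"
  proof
    fix B assume "B \<in> pullback_partition M (T ^^ i) (fibres M X)"
    then obtain v where v: "B = (T ^^ i) -` (X -` {v} \<inter> space M) \<inter> space M" and "B \<noteq> {}"
      by (auto simp: pullback_partition_def fibres_def)
    then obtain x where "x \<in> B" by auto
    then have x: "x \<in> space M" "X ((T ^^ i) x) = v" using v by auto
    have "B = (\<lambda>x. X ((T ^^ i) x)) -` {X ((T ^^ i) x)} \<inter> space M"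
      using v x funpow_in_space by auto
    then show "B \<in> fibres M (\<lambda>x. X ((T ^^ i) x))"
      unfolding fibres_def using x by blast
  qed
  show "partition_on (space M) (pullback_partition M (T ^^ i) (fibres M X))"
  proof (rule partition_onI)
    show "\<Union> (pullback_partition M (T ^^ i) (fibres M X)) = space M"
    proof
      show "\<Union> (pullback_partition M (T ^^ i) (fibres M X)) \<subseteq> space M"
        by (auto simp: pullback_partition_def)
      show "space M \<subseteq> \<Union> (pullback_partition M (T ^^ i) (fibres M X))"
      proof
        fix x assume x: "x \<in> space M"
        let ?p = "X -` {X ((T ^^ i) x)} \<inter> space M"
        have "?p \<in> fibres M X" using funpow_in_space[OF x] by (auto simp: fibres_def)
        moreover have "x \<in> (T ^^ i) -` ?p \<inter> space M" using x funpow_in_space[OF x] by simp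
        ultimately show "x \<in> \<Union> (pullback_partition M (T ^^ i) (fibres M X))"
          unfolding pullback_partition_def by blast
      qed
    qed
    fix p q assume "p \<in> pullback_partition M (T ^^ i) (fibres M X)"
      "q \<in> pullback_partition M (T ^^ i) (fibres M X)" "p \<noteq> q"
    with sub have "p \<in> fibres M (\<lambda>x. X ((T ^^ i) x))" "q \<in> fibres M (\<lambda>x. X ((T ^^ i) x))" by auto
    with \<open>p \<noteq> q\<close> show "disjnt p q"
      using partition_on_fibres[of M "\<lambda>x. X ((T ^^ i) x)"]
      by (simp add: partition_on_def disjoint_def disjnt_def)
  qed (auto simp: pullback_partition_def)
qed (rule partition_on_fibres)

text \<open>A nonempty intersection of fibres, one for each time, is the fibre of the itinerary
  through any of its points. For \<open>n = 0\<close> the empty intersection would be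
  \<open>UNIV\<close> instead of \<open>space M\<close>.\<close>

lemma iterated_join_fibres:
  assumes "n \<ge> 1"
  shows "iterated_join M T (fibres M X) n = fibres M (itin X n)"
proof (rule partition_on_subset_eq)
  let ?F = "\<lambda>i. fibres M (\<lambda>x. X ((T ^^ i) x))"
  have join: "iterated_join M T (fibres M X) n = common_refinement (?F ` {..<n})"
    by (simp add: iterated_join_def pullback_partition_fibres)
  show "partition_on (space M) (iterated_join M T (fibres M X) n)"
    unfolding join using assms by (intro partition_on_common_refinement) (auto simp: partition_on_fibres lessThan_empty_iff)
  show "iterated_join M T (fibres M X) n \<subseteq> fibres M (itin X n)"
  proof
    fix B assume "B \<in> iterated_join M T (fibres M X) n"
    \<comment> \<open>\<open>common_refinement\<close> chooses one cell per partition, not per time.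
      Times with equal partitions share a cell, which does no harm because each cell is identified
      through the point \<open>x\<close>.\<close>
    then obtain f where f: "\<And>i. i < n \<Longrightarrow> f (?F i) \<in> ?F i" "B = \<Inter> (f ` ?F ` {..<n})" and "B \<noteq> {}"
      by (auto simp: join common_refinement Pi_iff)
    then obtain x where x: "x \<in> B" by auto
    have eq: "f (?F i) = {y \<in> space M. X ((T ^^ i) y) = X ((T ^^ i) x)}" if "i < n" for i
    proof -
      have "x \<in> f (?F i)" using x that unfolding f(2) by auto
      then show ?thesis using f(1)[OF that] by (auto simp: fibres_def)
    qed
    have "x \<in> f (?F 0)" using x assms unfolding f(2) by (meson INT_D imageI lessThan_iff less_le_trans zero_less_one InterD)
    then have "x \<in> space M" using eq[of 0] assms by auto
    have itin_eq: "itin X n y = itin X n x \<longleftrightarrow> (\<forall>i<n. X ((T ^^ i) y) = X ((T ^^ i) x))" for y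
    proof
      assume eq: "itin X n y = itin X n x"
      show "\<forall>i<n. X ((T ^^ i) y) = X ((T ^^ i) x)"
      proof (intro allI impI)
        fix i assume "i < n"
        then show "X ((T ^^ i) y) = X ((T ^^ i) x)" using fun_cong[OF eq, of i] by (simp add: itin_def)
      qed
    qed (auto simp: itin_def)
    have "B = (\<Inter>i\<in>{..<n}. {y \<in> space M. X ((T ^^ i) y) = X ((T ^^ i) x)})"
      unfolding f(2) image_image using eq by auto
    also have "\<dots> = {y \<in> space M. \<forall>i<n. X ((T ^^ i) y) = X ((T ^^ i) x)}"
    proof (rule set_eqI)
      fix y
      have "y \<in> space M" if "\<forall>i<n. y \<in> space M"
        using that assms by (meson less_le_trans zero_less_one)
      then show "y \<in> (\<Inter>i\<in>{..<n}. {y \<in> space M. X ((T ^^ i) y) = X ((T ^^ i) x)}) \<longleftrightarrow>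
          y \<in> {y \<in> space M. \<forall>i<n. X ((T ^^ i) y) = X ((T ^^ i) x)}" by simp blast
    qed
    also have "\<dots> = itin X n -` {itin X n x} \<inter> space M"
      using itin_eq by auto
    finally show "B \<in> fibres M (itin X n)"
      unfolding fibres_def using \<open>x \<in> space M\<close> by blast
  qed
qed (rule partition_on_fibres)

lemma entropy_wrt_fibres: "entropy_wrt_partition M T (fibres M X) = entropy_rate X"
proof -
  have "(\<lambda>n. partition_entropy M (iterated_join M T (fibres M X) n) / real n) = (\<lambda>n. ent M (itin X n) / n)"
  proof
    fix n
    \<comment> \<open>For \<open>n = 0\<close> both sides are 0, since division by 0 gives
      0.\<close>
    show "partition_entropy M (iterated_join M T (fibres M X) n) / real n = ent M (itin X n) / n"
      by (cases "n = 0") (auto simp: iterated_join_fibres partition_entropy_fibres)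
  qed
  then show ?thesis by (simp add: entropy_wrt_partition_def entropy_rate_def)
qed

lemma entropy_rate_le_KS:
  assumes "simple_function M X" shows "ereal (entropy_rate X) \<le> KS_entropy M T"
  unfolding KS_entropy_def
  by (rule SUP_upper2[of "fibres M X"])
     (auto simp: finite_measurable_partition_fibres_iff assms entropy_wrt_fibres)

text \<open>Set-valued functions suffice, since every partition arises from the function that sends
  a point to its cell.\<close>

lemma KS_entropy_le:
  assumes "\<And>X :: 'x \<Rightarrow> 'x set. simple_function M X \<Longrightarrow> ereal (entropy_rate X) \<le> c"
  shows "KS_entropy M T \<le> c"
  unfolding KS_entropy_def
proof (rule SUP_least)
  fix P assume "P \<in> {P. finite_measurable_partition M P}"
  then have P: "finite_measurable_partition M P" by simp
  then have eq: "P = fibres M (\<lambda>x. THE p. p \<in> P \<and> x \<in> p)" (is "P = fibres M ?X")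
    by (intro partition_eq_fibres) (auto simp: finite_measurable_partition_def)
  have sf: "simple_function M ?X" using P eq finite_measurable_partition_fibres_iff by metis
  have "entropy_wrt_partition M T P = entropy_rate ?X"
    using entropy_wrt_fibres[of ?X] by (simp only: eq[symmetric])
  then show "ereal (entropy_wrt_partition M T P) \<le> c"
    using assms[OF sf] by simp
qed

lemma KS_entropy_nonneg: "0 \<le> KS_entropy M T"
proof -
  have "ent M (itin (\<lambda>_. ()) n) = 0" for n
    unfolding itin_def using ent_const[of "\<lambda>i\<in>{..<n}. ()"] by simp
  then have "entropy_rate (\<lambda>_. ()) = 0"
    by (simp add: entropy_rate_def)
  then show ?thesis using entropy_rate_le_KS[of "\<lambda>_. ()"] by (simp add: zero_ereal_def)
qed

end

section \<open>Approximation by an algebra\<close>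

text \<open>Induction over the generation of the sigma-algebra, with the statement for all
  \<open>e\<close> at once so that the union step can ask for smaller errors.\<close>

lemma (in finite_measure) algebra_approximation:
  assumes alg: "algebra (space M) G" and gen: "sets M = sigma_sets (space M) G"
    and B: "B \<in> sets M" and e: "e > 0"
  obtains C where "C \<in> G" "measure M ((B - C) \<union> (C - B)) < e"
proof -
  interpret algebra "space M" G by (rule alg)
  have GM: "C \<in> sets M" if "C \<in> G" for C using that by (auto simp: gen)
  have "B \<in> sigma_sets (space M) G" using B gen by simp
  then have "\<forall>e>0. \<exists>C\<in>G. measure M ((B - C) \<union> (C - B)) < e"
  proof (induction B)
    case (Basic B)
    then show ?case by (intro allI impI bexI[of _ B]) auto
  next
    case Empty
    then show ?case by (intro allI impI bexI[of _ "{}"]) auto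
  next
    case (Compl B)
    have B: "B \<subseteq> space M" using Compl.hyps gen sets.sets_into_space by metis
    show ?case
    proof (intro allI impI)
      fix e :: real assume "e > 0"
      then obtain C where C: "C \<in> G" "measure M ((B - C) \<union> (C - B)) < e" using Compl.IH by blast
      have "((space M - B) - (space M - C)) \<union> ((space M - C) - (space M - B)) = (B - C) \<union> (C - B)"
        using B sets_into_space[OF C(1)] by auto
      then show "\<exists>C\<in>G. measure M (((space M - B) - C) \<union> (C - (space M - B))) < e"
        using C by (intro bexI[of _ "space M - C"]) auto
    qed
  next
    case (Union A)
    have A: "A i \<in> sets M" for i using Union.hyps gen by simp
    show ?case
    proof (intro allI impI)
      fix e :: real assume e: "e > 0"
      have "(\<lambda>n. measure M (\<Union>i<n. A i)) \<longlonglongrightarrow> measure M (\<Union>n. \<Union>i<n. A i)"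
        using A by (intro finite_Lim_measure_incseq) (fastforce simp: incseq_def)+
      moreover have "(\<Union>n. \<Union>i<n. A i) = (\<Union>i. A i)" by auto
      ultimately have "(\<lambda>n. measure M (\<Union>i<n. A i)) \<longlonglongrightarrow> measure M (\<Union>i. A i)" by simp
      \<comment> \<open>Half of the error pays for truncating the union, the other half for
        approximating its first \<open>N\<close> members.\<close>
      then obtain N where N: "\<bar>measure M (\<Union>i<N. A i) - measure M (\<Union>i. A i)\<bar> < e / 2"
        using e by (metis LIMSEQ_D half_gt_zero order_refl real_norm_def)
      \<comment> \<open>\<open>N\<close> errors of size \<open>d\<close> stay below
        \<open>e / 2\<close>; the \<open>+ 1\<close> covers \<open>N = 0\<close>.\<close>
      define d where "d = e / (2 * (real N + 1))"
      have d: "d > 0" using e by (simp add: d_def)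
      have "\<forall>i. \<exists>C\<in>G. measure M ((A i - C) \<union> (C - A i)) < d" using Union.IH d by blast
      then obtain C where C: "\<And>i. C i \<in> G" "\<And>i. measure M ((A i - C i) \<union> (C i - A i)) < d" by metis
      let ?C = "\<Union>i<N. C i"
      have "?C \<in> G" using C by auto
      have m: "(\<Union>i. A i) \<in> sets M" "(\<Union>i<N. A i) \<in> sets M" "\<And>i. (A i - C i) \<union> (C i - A i) \<in> sets M"
        using A GM[OF C(1)] by auto
      have "measure M (((\<Union>i. A i) - ?C) \<union> (?C - (\<Union>i. A i)))
          \<le> measure M (((\<Union>i. A i) - (\<Union>i<N. A i)) \<union> (\<Union>i<N. (A i - C i) \<union> (C i - A i)))"
        using m by (intro finite_measure_mono) auto
      also have "\<dots> \<le> measure M ((\<Union>i. A i) - (\<Union>i<N. A i)) + measure M (\<Union>i<N. (A i - C i) \<union> (C i - A i))"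
        using m by (intro measure_Un_le) auto
      also have "measure M (\<Union>i<N. (A i - C i) \<union> (C i - A i)) \<le> (\<Sum>i<N. measure M ((A i - C i) \<union> (C i - A i)))"
        using m by (intro finite_measure_subadditive_finite) auto
      also have "\<dots> \<le> real N * d"
        using sum_bounded_above[of "{..<N}" "\<lambda>i. measure M ((A i - C i) \<union> (C i - A i))" d] C(2)
        by (simp add: less_imp_le)
      also have "real N * d < e / 2" using e by (simp add: d_def field_simps)
      also have "measure M ((\<Union>i. A i) - (\<Union>i<N. A i)) = measure M (\<Union>i. A i) - measure M (\<Union>i<N. A i)"
        using m by (intro finite_measure_Diff) auto
      finally have "measure M (((\<Union>i. A i) - ?C) \<union> (?C - (\<Union>i. A i))) < e" using N by linarith
      then show "\<exists>C\<in>G. measure M ((\<Union> (range A) - C) \<union> (C - \<Union> (range A))) < e"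
        using \<open>?C \<in> G\<close> by blast
    qed
  qed
  then show ?thesis using that e by blast
qed

section \<open>A Fano-type inequality and the approximation of finite-valued functions\<close>

lemma simple_function_member:
  assumes "B \<in> sets M" shows "simple_function M (\<lambda>x. x \<in> B)"
  unfolding simple_function_def
proof (intro conjI ballI)
  fix v
  have "(\<lambda>x. x \<in> B) -` {v} \<inter> space M = (if v then B else space M - B)"
    using sets.sets_into_space[OF assms] by auto
  then show "(\<lambda>x. x \<in> B) -` {v} \<inter> space M \<in> sets M" using assms by auto
qed auto

text \<open>Serves where no formula for the coarsening map is at hand; a representative is chosen in
  each fibre.\<close>

lemma (in prob_space) ent_mono_inj:
  assumes X: "simple_function M X" and Y: "simple_function M Y"
    and f: "\<And>x y. x \<in> space M \<Longrightarrow> y \<in> space M \<Longrightarrow> X x = X y \<Longrightarrow> Y x = Y y"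
  shows "ent M Y \<le> ent M X"
proof (rule ent_mono[OF X Y])
  fix x assume x: "x \<in> space M"
  let ?y = "SOME y. y \<in> space M \<and> X y = X x"
  have "?y \<in> space M \<and> X ?y = X x" by (rule someI[of _ x]) (simp add: x)
  then show "Y x = (\<lambda>v. Y (SOME y. y \<in> space M \<and> X y = v)) (X x)" using f[OF x, of ?y] by simp
qed

text \<open>A Fano-type inequality. \<open>Y x\<close> is a guess for \<open>X x\<close>, correct
  when it equals \<open>{X x}\<close>; guesses are sets because the approximating sets used later
  may overlap or miss a point. A correct guess costs \<open>- ln (1 - t)\<close>, a wrong one the
  logarithm of the number of values minus \<open>ln t\<close>.\<close>

lemma (in prob_space) conditional_entropy_guess:
  fixes X :: "'a \<Rightarrow> 'b"
  assumes X: "simple_function M X" and Y: "simple_function M Y"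
    and bad: "measure M {x \<in> space M. Y x \<noteq> {X x}} \<le> \<eta>"
    and t: "0 < t" "t < 1"
  shows "ent M (\<lambda>x. (X x, Y x)) - ent M Y \<le> - ln (1 - t) + \<eta> * (ln (card (X ` space M)) - ln t)"
proof -
  let ?V = "X ` space M" and ?W = "\<lambda>x. (X x, Y x)"
  have sf: "simple_function M ?W" using X Y by simp
  have fin: "finite ?V" "finite (Y ` space M)" using X Y by (auto dest: simple_functionD)
  have k: "card ?V > 0" using fin not_empty by (auto simp: card_gt_0_iff)
  \<comment> \<open>Conditional weight of \<open>v\<close> given the guess \<open>U\<close>:
    \<open>1 - t\<close> for the guessed value, and \<open>t\<close> spread evenly so that every
    weight is positive.\<close>
  define r where "r v U = (if U = {v} then 1 - t else t / card ?V)" for v :: 'b and U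
  have r0: "r v U > 0" for v U using t k by (auto simp: r_def)
  have r1: "(\<Sum>v\<in>?V. r v U) \<le> 1" for U
  proof -
    have "(\<Sum>v\<in>?V. r v U) \<le> (\<Sum>v\<in>?V. (if U = {v} then 1 - t else 0) + t / card ?V)"
      using t by (intro sum_mono) (auto simp: r_def)
    also have "\<dots> = (\<Sum>v\<in>?V. if U = {v} then 1 - t else 0) + t"
      using k by (simp add: sum.distrib)
    also have "(\<Sum>v\<in>?V. if U = {v} then 1 - t else 0) \<le> 1 - t"
    proof (cases "\<exists>u. U = {u}")
      case True
      then obtain u where "U = {u}" by auto
      then show ?thesis using fin t by (simp add: sum.delta')
    qed (use t in \<open>auto simp: sum.neutral\<close>)
    finally show ?thesis by simp
  qed
  define q where "q = (\<lambda>(v, U). law M Y U * r v U)"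
  have q0: "0 \<le> q w" for w using r0 by (auto simp: q_def less_imp_le split: prod.split)
  have "(\<Sum>w\<in>?W ` space M. q w) \<le> (\<Sum>w\<in>?V \<times> Y ` space M. q w)"
    using fin q0 by (intro sum_mono2) auto
  also have "\<dots> = (\<Sum>v\<in>?V. \<Sum>U\<in>Y ` space M. law M Y U * r v U)"
    by (simp add: sum.cartesian_product q_def)
  also have "\<dots> = (\<Sum>U\<in>Y ` space M. law M Y U * (\<Sum>v\<in>?V. r v U))"
    by (subst sum.swap) (simp add: sum_distrib_left)
  also have "\<dots> \<le> (\<Sum>U\<in>Y ` space M. law M Y U * 1)"
    by (intro sum_mono mult_left_mono r1) simp
  also have "\<dots> = 1" using sum_law[OF Y] by simp
  finally have q1: "(\<Sum>w\<in>?W ` space M. q w) \<le> 1" .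
  have pos: "0 < law M Y U" if "0 < law M ?W (v, U)" for v U
    using that law_mono[OF Y, of ?W "(v, U)" U] by auto
  have "{x \<in> space M. Y x \<noteq> {X x}} = ?W -` {(v, U). U \<noteq> {v}} \<inter> space M" by auto
  also have "\<dots> \<in> sets M" by (rule simple_functionD(2)[OF sf])
  finally have m: "{x \<in> space M. Y x \<noteq> {X x}} \<in> sets M" .
  have "ent M ?W \<le> expectation (\<lambda>x. - ln (q (?W x)))"
    by (intro gibbs sf q1 q0) (auto simp: q_def pos r0)
  also have "\<dots> = (\<Sum>w\<in>?W ` space M. law M ?W w * - ln (q w))"
    by (rule simple_expectation[OF sf])
  also have "\<dots> = (\<Sum>w\<in>?W ` space M. law M ?W w * (case w of (v, U) \<Rightarrow> - ln (law M Y U) - ln (r v U)))"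
  proof (intro sum.cong refl)
    fix w :: "'b \<times> 'b set"
    obtain v U where w: "w = (v, U)" by (cases w)
    show "law M ?W w * - ln (q w) = law M ?W w * (case w of (v, U) \<Rightarrow> - ln (law M Y U) - ln (r v U))"
    proof (cases "law M ?W w = 0")
      case False
      then have "0 < law M ?W (v, U)" using law_nonneg[of M ?W "(v, U)"] w by (simp add: less_le)
      from pos[OF this] show ?thesis using r0[of v U] by (simp add: w q_def ln_mult)
    qed simp
  qed
  also have "\<dots> = expectation (\<lambda>x. - ln (law M Y (Y x)) - ln (r (X x) (Y x)))"
    by (subst simple_expectation(2)[OF sf, symmetric]) simp
  also have "\<dots> = ent M Y + expectation (\<lambda>x. - ln (r (X x) (Y x)))"
    using simple_expectation(1)[OF Y, of "\<lambda>U. - ln (law M Y U)"]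
      simple_expectation(1)[OF sf, of "\<lambda>(v, U). - ln (r v U)"]
    by (simp add: ent_expectation[OF Y])
  also have "expectation (\<lambda>x. - ln (r (X x) (Y x))) \<le>
      expectation (\<lambda>x. - ln (1 - t) + (ln (card ?V) - ln t) * indicator {x \<in> space M. Y x \<noteq> {X x}} x)"
  proof (rule integral_mono)
    show "integrable M (\<lambda>x. - ln (r (X x) (Y x)))"
      using simple_expectation(1)[OF sf, of "\<lambda>(v, U). - ln (r v U)"] by simp
    show "integrable M (\<lambda>x. - ln (1 - t) + (ln (card ?V) - ln t) * indicator {x \<in> space M. Y x \<noteq> {X x}} x)"
      using m by (intro Bochner_Integration.integrable_add integrable_mult_right integrable_real_indicator)
        (auto simp: emeasure_eq_measure)
    fix x assume "x \<in> space M"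
    then show "- ln (r (X x) (Y x)) \<le> - ln (1 - t) + (ln (card ?V) - ln t) * indicator {x \<in> space M. Y x \<noteq> {X x}} x"
      using t k by (auto simp: r_def ln_div)
  qed
  also have "\<dots> = - ln (1 - t) + (ln (card ?V) - ln t) * measure M {x \<in> space M. Y x \<noteq> {X x}}"
  proof -
    have "integrable M (\<lambda>x. (ln (card ?V) - ln t) * indicator {x \<in> space M. Y x \<noteq> {X x}} x)"
      using m by (intro integrable_mult_right integrable_real_indicator) (auto simp: emeasure_eq_measure)
    then show ?thesis using m by (simp add: prob_space Int_absorb2)
  qed
  also have "\<dots> \<le> - ln (1 - t) + (ln (card ?V) - ln t) * \<eta>"
    using bad t k by (intro add_left_mono mult_left_mono) (auto simp: ln_le_zero_iff intro: order_trans[of _ 0])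
  finally show ?thesis by (simp add: mult.commute)
qed

text \<open>Each fibre of \<open>X\<close> is replaced by a close member \<open>b v\<close> of the
  algebra. The set of labels \<open>v\<close> with \<open>x \<in> b v\<close> is a guess for
  \<open>X x\<close> that is wrong only on the union of the symmetric differences, and
  \<open>ent_itin_conditional\<close> turns the one-step error into a bound for the rates.\<close>

lemma (in measure_preserving_system) entropy_rate_algebra_approximation:
  fixes X :: "'x \<Rightarrow> 'b"
  assumes alg: "algebra (space M) G" and gen: "sets M = sigma_sets (space M) G"
    and X: "simple_function M X" and e: "e > 0"
  obtains V :: "'b set" and b where "finite V" "\<And>v. v \<in> V \<Longrightarrow> b v \<in> G"
    "simple_function M (\<lambda>x. {v\<in>V. x \<in> b v})"
    "entropy_rate X \<le> entropy_rate (\<lambda>x. {v\<in>V. x \<in> b v}) + (e :: real)"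
proof -
  let ?V = "X ` space M"
  have fin: "finite ?V" using X by (auto dest: simple_functionD)
  have k: "card ?V > 0" using fin not_empty by (auto simp: card_gt_0_iff)
  \<comment> \<open>Makes the cost \<open>- ln (1 - t)\<close> of correct guesses equal to
    \<open>e / 2\<close>; \<open>\<delta>\<close> below does the same for the wrong ones.\<close>
  define t where "t = 1 - exp (- e / 2)"
  have t: "0 < t" "t < 1" and lt: "- ln (1 - t) = e / 2" using e by (auto simp: t_def)
  define c where "c = ln (card ?V) - ln t"
  have "c > 0" using t k ln_ge_zero[of "real (card ?V)"] ln_less_zero[of t] unfolding c_def by linarith
  define \<delta> where "\<delta> = e / (2 * c * card ?V)"
  have \<delta>: "\<delta> > 0" using e k \<open>c > 0\<close> by (simp add: \<delta>_def)
  have "\<exists>C\<in>G. measure M (((X -` {v} \<inter> space M) - C) \<union> (C - (X -` {v} \<inter> space M))) < \<delta>" for v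
    using algebra_approximation[OF alg gen simple_functionD(2)[OF X, of "{v}"] \<delta>] by metis
  then obtain b where b: "\<And>v. b v \<in> G"
    "\<And>v. measure M (((X -` {v} \<inter> space M) - b v) \<union> (b v - (X -` {v} \<inter> space M))) < \<delta>" by metis
  interpret alg: algebra "space M" G by (rule alg)
  have bM: "b v \<in> sets M" for v using b(1) by (auto simp: gen)
  let ?Y = "\<lambda>x. {v\<in>?V. x \<in> b v}"
  have Y: "simple_function M ?Y"
  proof -
    have "simple_function M (\<lambda>x. \<lambda>v\<in>?V. x \<in> b v)"
      using fin bM by (intro simple_function_fun simple_function_member) auto
    then have "simple_function M (\<lambda>x. {v\<in>?V. (\<lambda>v\<in>?V. x \<in> b v) v})"
      by (rule simple_function_compose1[where g = "\<lambda>w. {v\<in>?V. w v}"])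
    then show ?thesis by (simp cong: conj_cong)
  qed
  have "{x \<in> space M. ?Y x \<noteq> {X x}} \<subseteq> (\<Union>v\<in>?V. ((X -` {v} \<inter> space M) - b v) \<union> (b v - (X -` {v} \<inter> space M)))"
  proof (rule subsetI, rule ccontr)
    fix x assume x: "x \<in> {x \<in> space M. ?Y x \<noteq> {X x}}"
      and nin: "x \<notin> (\<Union>v\<in>?V. ((X -` {v} \<inter> space M) - b v) \<union> (b v - (X -` {v} \<inter> space M)))"
    have "x \<in> b v \<longleftrightarrow> X x = v" if "v \<in> ?V" for v
    proof -
      have "x \<notin> ((X -` {v} \<inter> space M) - b v) \<union> (b v - (X -` {v} \<inter> space M))" using nin that by blast
      then show ?thesis using x by blast
    qed
    then have "?Y x = {v\<in>?V. X x = v}" by (intro Collect_cong conj_cong) auto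
    also have "\<dots> = {X x}" using x by auto
    finally show False using x by blast
  qed
  then have "measure M {x \<in> space M. ?Y x \<noteq> {X x}} \<le>
      measure M (\<Union>v\<in>?V. ((X -` {v} \<inter> space M) - b v) \<union> (b v - (X -` {v} \<inter> space M)))"
    by (intro finite_measure_mono sets.finite_UN fin sets.Un sets.Diff bM simple_functionD(2)[OF X])
  also have "\<dots> \<le> (\<Sum>v\<in>?V. measure M (((X -` {v} \<inter> space M) - b v) \<union> (b v - (X -` {v} \<inter> space M))))"
    using bM simple_functionD(2)[OF X] by (intro finite_measure_subadditive_finite fin) blast
  also have "\<dots> \<le> card ?V * \<delta>"
    using sum_bounded_above[of ?V "\<lambda>v. measure M (((X -` {v} \<inter> space M) - b v) \<union> (b v - (X -` {v} \<inter> space M)))" \<delta>] b(2)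
    by (simp add: less_imp_le)
  finally have bad: "measure M {x \<in> space M. ?Y x \<noteq> {X x}} \<le> card ?V * \<delta>" .
  have "ent M (\<lambda>x. (X x, ?Y x)) - ent M ?Y \<le> - ln (1 - t) + (card ?V * \<delta>) * c"
    unfolding c_def by (rule conditional_entropy_guess[OF X Y bad t])
  also have "\<dots> = e" using k \<open>c > 0\<close> by (simp add: lt \<delta>_def field_simps)
  finally have le: "ent M (\<lambda>x. (X x, ?Y x)) - ent M ?Y \<le> e" .
  have "entropy_rate X \<le> entropy_rate ?Y + e"
  proof -
    have "ent M (itin X n) \<le> ent M (itin ?Y n) + real n * e + 0" for n
    proof -
      have "n * (ent M (\<lambda>x. (X x, ?Y x)) - ent M ?Y) \<le> n * e" using le by (intro mult_left_mono) auto
      then show ?thesis using ent_itin_conditional[OF X Y, of n] by linarith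
    qed
    then show ?thesis by (rule entropy_rate_mono[OF X Y])
  qed
  then show ?thesis using that[of ?V b] fin b(1) Y by blast
qed

text \<open>A single \<open>E n\<close> need not be invariant. As all have the same measure, so does
  their intersection, and that set is invariant, hence of measure 0 or 1.\<close>

lemma ergodic_limsup_set:
  assumes erg: "ergodic M T" and E: "\<And>n. E n \<in> sets M" "decseq E"
    and const: "\<And>n. measure M (E n) = measure M (E 0)" and pos: "measure M (E 0) > 0"
    and inv: "T -` (\<Inter>n. E n) \<inter> space M = (\<Inter>n. E n)"
  shows "measure M (E 0) = 1"
proof -
  interpret prob_space M using erg by (simp add: ergodic_def)
  have "(\<lambda>n. measure M (E n)) \<longlonglongrightarrow> measure M (\<Inter>n. E n)"
    by (rule finite_Lim_measure_decseq) (use E in auto)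
  then have "measure M (\<Inter>n. E n) = measure M (E 0)"
    using const LIMSEQ_unique tendsto_const by (metis (no_types, lifting) LIMSEQ_const_iff ext)
  moreover have "(\<Inter>n. E n) \<in> sets M" using E by auto
  ultimately show ?thesis using erg inv pos unfolding ergodic_def by fastforce
qed

section \<open>The topology and Borel sets of a Markov shift\<close>

lemma left_shift_funpow: "(left_shift ^^ n) x = (\<lambda>i. x (i + int n))"
  by (induction n arbitrary: x) (auto simp: left_shift_def add_ac funpow_Suc_right simp del: funpow.simps)

lemma left_shift_in_shift_space: "x \<in> shift_space A S \<Longrightarrow> left_shift x \<in> shift_space A S"
  unfolding shift_space_def left_shift_def mem_Collect_eq by blast

text \<open>Merging the symbols outside \<open>F\<close> makes the partition finite for finite
  \<open>F\<close>, even over an infinite alphabet.\<close>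

definition symbol_code :: "'a set \<Rightarrow> 'a \<Rightarrow> 'a option" where
  "symbol_code F s = (if s \<in> F then Some s else None)"

lemma symbol_code_mono: "F \<subseteq> F' \<Longrightarrow> symbol_code F' s = symbol_code F' t \<Longrightarrow> symbol_code F s = symbol_code F t"
  by (auto simp: symbol_code_def split: if_splits)

text \<open>Sets decided by the coded symbols in a window around time 0. With \<open>id\<close> as
  code they provide the clopen sets on which weak-star convergence is tested; with
  \<open>symbol_code F\<close> for finite \<open>F\<close>, the sets that a finite code can
  see.\<close>

definition window_sets :: "'a set \<Rightarrow> ('a \<Rightarrow> 'a \<Rightarrow> nat) \<Rightarrow> ('a \<Rightarrow> 'b) \<Rightarrow> (int \<Rightarrow> 'a) set set" where
  "window_sets A S f = {B. B \<subseteq> shift_space A S \<and>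
     (\<exists>k. \<forall>x\<in>B. \<forall>y\<in>shift_space A S. (\<forall>i. \<bar>i\<bar> \<le> k \<longrightarrow> f (x i) = f (y i)) \<longrightarrow> y \<in> B)}"

lemma window_setsI:
  assumes "B \<subseteq> shift_space A S"
    "\<And>x y. x \<in> B \<Longrightarrow> y \<in> shift_space A S \<Longrightarrow> (\<And>i. \<bar>i\<bar> \<le> k \<Longrightarrow> f (x i) = f (y i)) \<Longrightarrow> y \<in> B"
  shows "B \<in> window_sets A S f"
  using assms unfolding window_sets_def by blast

lemma window_sets_Diff:
  assumes "B \<in> window_sets A S f" shows "shift_space A S - B \<in> window_sets A S f"
proof -
  obtain k where k: "\<forall>x\<in>B. \<forall>y\<in>shift_space A S. (\<forall>i. \<bar>i\<bar> \<le> k \<longrightarrow> f (x i) = f (y i)) \<longrightarrow> y \<in> B"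
    using assms by (auto simp: window_sets_def)
  show ?thesis
  proof (rule window_setsI[where k = k])
    fix x y assume "x \<in> shift_space A S - B" "y \<in> shift_space A S" "\<And>i. \<bar>i\<bar> \<le> k \<Longrightarrow> f (x i) = f (y i)"
    then show "y \<in> shift_space A S - B" using k by fastforce
  qed auto
qed

lemma window_sets_Un:
  assumes "B \<in> window_sets A S f" "C \<in> window_sets A S f" shows "B \<union> C \<in> window_sets A S f"
proof -
  obtain k l where k: "\<forall>x\<in>B. \<forall>y\<in>shift_space A S. (\<forall>i. \<bar>i\<bar> \<le> k \<longrightarrow> f (x i) = f (y i)) \<longrightarrow> y \<in> B"
    and l: "\<forall>x\<in>C. \<forall>y\<in>shift_space A S. (\<forall>i. \<bar>i\<bar> \<le> l \<longrightarrow> f (x i) = f (y i)) \<longrightarrow> y \<in> C"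
    using assms by (auto simp: window_sets_def)
  show ?thesis
  proof (rule window_setsI[where k = "max k l"])
    fix x y assume "x \<in> B \<union> C" "y \<in> shift_space A S" "\<And>i. \<bar>i\<bar> \<le> max k l \<Longrightarrow> f (x i) = f (y i)"
    then show "y \<in> B \<union> C" using k l by (metis Un_iff max.coboundedI1 max.coboundedI2)
  qed (use assms in \<open>auto simp: window_sets_def\<close>)
qed

lemma window_sets_coarser:
  assumes "\<And>s t. g s = g t \<Longrightarrow> f s = f t" shows "window_sets A S f \<subseteq> window_sets A S g"
proof
  fix B assume "B \<in> window_sets A S f"
  then obtain k where k: "\<forall>x\<in>B. \<forall>y\<in>shift_space A S. (\<forall>i. \<bar>i\<bar> \<le> k \<longrightarrow> f (x i) = f (y i)) \<longrightarrow> y \<in> B"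
    and B: "B \<subseteq> shift_space A S"
    by (auto simp: window_sets_def)
  show "B \<in> window_sets A S g"
  proof (rule window_setsI[OF B, where k = k])
    fix x y assume "x \<in> B" "y \<in> shift_space A S" "\<And>i. \<bar>i\<bar> \<le> k \<Longrightarrow> g (x i) = g (y i)"
    then show "y \<in> B" using k assms by metis
  qed
qed

lemma window_sets_symbol_code_mono:
  assumes "F \<subseteq> F'" shows "window_sets A S (symbol_code F) \<subseteq> window_sets A S (symbol_code F')"
  by (rule window_sets_coarser) (rule symbol_code_mono[OF assms])

definition ball_window :: "'a set \<Rightarrow> ('a \<Rightarrow> 'a \<Rightarrow> nat) \<Rightarrow> (int \<Rightarrow> 'a) \<Rightarrow> int \<Rightarrow> (int \<Rightarrow> 'a) set" where
  "ball_window A S x k = {y \<in> shift_space A S. \<forall>i. \<bar>i\<bar> \<le> k \<longrightarrow> y i = x i}"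

lemma ball_window_eq_cylinder:
  assumes "0 \<le> k"
  shows "ball_window A S x k = cylinder A S (map x [- k..k]) (- k)"
proof -
  have "(\<forall>i. \<bar>i\<bar> \<le> k \<longrightarrow> y i = x i) \<longleftrightarrow> (\<forall>j<nat (2 * k + 1). y (- k + int j) = x (- k + int j))" for y :: "int \<Rightarrow> 'a"
  proof
    assume *: "\<forall>j<nat (2 * k + 1). y (- k + int j) = x (- k + int j)"
    show "\<forall>i. \<bar>i\<bar> \<le> k \<longrightarrow> y i = x i"
    proof (intro allI impI)
      fix i :: int assume "\<bar>i\<bar> \<le> k"
      then have "- k + int (nat (i + k)) = i" "nat (i + k) < nat (2 * k + 1)" by linarith+
      then show "y i = x i" using * by metis
    qed
  qed auto
  then show ?thesis
    using assms by (auto simp: ball_window_def cylinder_def)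
qed

lemma openin_cylinder:
  "r \<noteq> [] \<Longrightarrow> set r \<subseteq> A \<Longrightarrow> openin (shift_topology A S) (cylinder A S r l)"
  unfolding shift_topology_def openin_topology_generated_by_iff
  by (intro generate_topology_on.Basis) blast

lemma openin_ball_window:
  assumes "0 \<le> k" "x \<in> shift_space A S" shows "openin (shift_topology A S) (ball_window A S x k)"
  unfolding ball_window_eq_cylinder[OF assms(1)]
  by (rule openin_cylinder) (use assms in \<open>auto simp: shift_space_def\<close>)

text \<open>Balls around a point are nested, so they absorb the finite intersections that generate
  the topology.\<close>

lemma openin_shift_topology_ball:
  assumes "openin (shift_topology A S) U" "x \<in> U"
  shows "\<exists>k\<ge>0. ball_window A S x k \<subseteq> U"
proof -
  have "generate_topology_on {cylinder A S r l |r l. r \<noteq> [] \<and> set r \<subseteq> A} U"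
    using assms(1) by (simp add: shift_topology_def openin_topology_generated_by_iff)
  then show ?thesis using assms(2)
  proof (induction U)
    case (Int a b)
    then obtain k l where "k \<ge> 0" "l \<ge> 0" "ball_window A S x k \<subseteq> a" "ball_window A S x l \<subseteq> b" by auto
    moreover have "ball_window A S x (max k l) \<subseteq> ball_window A S x k \<inter> ball_window A S x l"
      by (auto simp: ball_window_def)
    ultimately show ?case by (intro exI[of _ "max k l"]) auto
  next
    case (UN K)
    then show ?case by blast
  next
    case (Basis s)
    then obtain r l where s: "s = cylinder A S r l" by auto
    have "ball_window A S x (\<bar>l\<bar> + int (length r)) \<subseteq> s"
      using Basis.prems unfolding s by (auto simp: ball_window_def cylinder_def)
    then show ?case by (intro exI[of _ "\<bar>l\<bar> + int (length r)"]) auto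
  qed auto
qed

lemma openin_window_set:
  assumes "B \<in> window_sets A S f" shows "openin (shift_topology A S) B"
proof -
  obtain k where k: "\<forall>x\<in>B. \<forall>y\<in>shift_space A S. (\<forall>i. \<bar>i\<bar> \<le> k \<longrightarrow> f (x i) = f (y i)) \<longrightarrow> y \<in> B"
    and B: "B \<subseteq> shift_space A S"
    using assms by (auto simp: window_sets_def)
  \<comment> \<open>The radius in \<open>window_sets\<close> may be negative; \<open>max k 0\<close>
    makes the ball a cylinder over a nonempty word.\<close>
  have "ball_window A S x (max k 0) \<subseteq> B" if "x \<in> B" for x
  proof
    fix y assume y: "y \<in> ball_window A S x (max k 0)"
    show "y \<in> B"
      using y by (intro k[rule_format, OF that]) (auto simp: ball_window_def)
  qed
  moreover have "x \<in> ball_window A S x (max k 0)" if "x \<in> B" for x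
    using that B by (auto simp: ball_window_def)
  ultimately have "B = (\<Union>x\<in>B. ball_window A S x (max k 0))" by blast
  moreover have "openin (shift_topology A S) (\<Union>x\<in>B. ball_window A S x (max k 0))"
    using B by (intro openin_Union) (auto intro!: openin_ball_window)
  ultimately show ?thesis by simp
qed

lemma sets_borel_of_topology: "sets (borel_of_topology X) = sigma_sets (topspace X) {U. openin X U}"
  unfolding borel_of_topology_def by (rule sets_measure_of) (auto dest: openin_subset)

text \<open>A window set and its complement are both open.\<close>

lemma continuous_map_indicator_window_set:
  assumes "B \<in> window_sets A S f"
  shows "continuous_map (shift_topology A S) euclideanreal (indicator B)"
  unfolding continuous_map_def
proof (intro conjI allI impI)
  fix U :: "real set"
  have B: "B \<subseteq> shift_space A S" using assms by (auto simp: window_sets_def)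
  have "{x \<in> topspace (shift_topology A S). indicator B x \<in> U} =
      (if 1 \<in> U then B else {}) \<union> (if 0 \<in> U then shift_space A S - B else {})"
    using B by (auto simp: indicator_def split: if_splits)
  then show "openin (shift_topology A S) {x \<in> topspace (shift_topology A S). indicator B x \<in> U}"
    using openin_window_set[OF assms] openin_window_set[OF window_sets_Diff[OF assms]]
      openin_topspace[of "shift_topology A S"] B by (auto simp: Un_absorb1)
qed auto

text \<open>All that the proof takes from weak-star convergence: the test functions are indicators
  of clopen sets.\<close>

lemma weak_star_measure_window_set:
  assumes "weak_star_convergent (shift_topology A S) \<mu> \<nu>" "B \<in> window_sets A S f"
    "\<And>n. sets (\<mu> n) = sets (borel_of_topology (shift_topology A S))"
    "sets \<nu> = sets (borel_of_topology (shift_topology A S))"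
  shows "(\<lambda>n. measure (\<mu> n) B) \<longlonglongrightarrow> measure \<nu> B"
proof -
  have "bounded (indicator B ` topspace (shift_topology A S) :: real set)"
    by (rule boundedI[where B = 1]) (auto simp: indicator_def)
  then have lim: "(\<lambda>n. integral\<^sup>L (\<mu> n) (indicator B)) \<longlonglongrightarrow> (integral\<^sup>L \<nu> (indicator B) :: real)"
    using assms(1) continuous_map_indicator_window_set[OF assms(2)]
    unfolding weak_star_convergent_def by blast
  have "B \<in> sets (borel_of_topology (shift_topology A S))"
    unfolding sets_borel_of_topology by (intro sigma_sets.Basic CollectI openin_window_set[OF assms(2)])
  then have "B \<inter> space M = B" if "sets M = sets (borel_of_topology (shift_topology A S))" for M
    using sets.sets_into_space[of B M] that by auto
  with lim assms(3,4) show ?thesis by simp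
qed

section \<open>The generating algebra of finitely coded sets\<close>

definition finite_code_sets :: "'a set \<Rightarrow> ('a \<Rightarrow> 'a \<Rightarrow> nat) \<Rightarrow> (int \<Rightarrow> 'a) set set" where
  "finite_code_sets A S = (\<Union>F\<in>{F. finite F}. window_sets A S (symbol_code F))"

lemma algebra_finite_code_sets: "algebra (shift_space A S) (finite_code_sets A S)"
  unfolding algebra_iff_Un
proof (intro conjI ballI)
  show "finite_code_sets A S \<subseteq> Pow (shift_space A S)"
    by (auto simp: finite_code_sets_def window_sets_def)
  show "{} \<in> finite_code_sets A S"
    by (auto simp: finite_code_sets_def window_sets_def)
  fix B assume B: "B \<in> finite_code_sets A S"
  then show "shift_space A S - B \<in> finite_code_sets A S"
    by (auto simp: finite_code_sets_def intro: window_sets_Diff)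
  fix C assume "C \<in> finite_code_sets A S"
  with B obtain F F' where F: "finite F" "finite F'"
    "B \<in> window_sets A S (symbol_code F)" "C \<in> window_sets A S (symbol_code F')"
    by (auto simp: finite_code_sets_def)
  have "window_sets A S (symbol_code F) \<subseteq> window_sets A S (symbol_code (F \<union> F'))"
    "window_sets A S (symbol_code F') \<subseteq> window_sets A S (symbol_code (F \<union> F'))"
    by (rule window_sets_symbol_code_mono; simp)+
  then have "B \<union> C \<in> window_sets A S (symbol_code (F \<union> F'))"
    using F by (intro window_sets_Un) auto
  then show "B \<union> C \<in> finite_code_sets A S" using F by (auto simp: finite_code_sets_def)
qed

text \<open>Recording only the symbols of the word itself is enough to recognise the word.\<close>

lemma cylinder_finite_code_set: "cylinder A S r l \<in> finite_code_sets A S"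
proof -
  have "cylinder A S r l \<in> window_sets A S (symbol_code (set r))"
  proof (rule window_setsI[where k = "\<bar>l\<bar> + int (length r)"])
    fix x y assume x: "x \<in> cylinder A S r l" and y: "y \<in> shift_space A S" and
      eq: "\<And>i. \<bar>i\<bar> \<le> \<bar>l\<bar> + int (length r) \<Longrightarrow> symbol_code (set r) (x i) = symbol_code (set r) (y i)"
    have "y (l + int j) = r ! j" if "j < length r" for j
    proof -
      have "x (l + int j) = r ! j" using x that by (auto simp: cylinder_def)
      then have "x (l + int j) \<in> set r" using that by auto
      moreover have "\<bar>l + int j\<bar> \<le> \<bar>l\<bar> + int (length r)" using that by linarith
      ultimately show ?thesis using eq[of "l + int j"] \<open>x (l + int j) = r ! j\<close>
        by (auto simp: symbol_code_def split: if_splits)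
    qed
    then show "y \<in> cylinder A S r l" using y by (auto simp: cylinder_def)
  qed (auto simp: cylinder_def)
  then show ?thesis by (auto simp: finite_code_sets_def)
qed

text \<open>Countability of the alphabet makes the cylinders a countable base, so every open set is
  a countable union of them.\<close>

lemma sets_borel_shift_cylinders:
  assumes "countable A"
  shows "sets (borel_of_topology (shift_topology A S))
    = sigma_sets (shift_space A S) {cylinder A S r l |r l. r \<noteq> [] \<and> set r \<subseteq> A}" (is "_ = sigma_sets _ ?C")
proof -
  have "?C = (\<lambda>(r, l). cylinder A S r l) ` ({r. r \<noteq> [] \<and> set r \<subseteq> A} \<times> UNIV)" by auto
  moreover have "countable {r. r \<noteq> [] \<and> set r \<subseteq> A}"
    by (rule countable_subset[OF _ countable_lists[OF assms]]) auto
  ultimately have count: "countable ?C" by simp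
  have "U \<in> sigma_sets (shift_space A S) ?C" if U: "openin (shift_topology A S) U" for U
  proof -
    have sub: "U \<subseteq> shift_space A S" using openin_subset[OF U] by simp
    have "x \<in> \<Union> {C \<in> ?C. C \<subseteq> U}" if x: "x \<in> U" for x
    proof -
      obtain k where k: "k \<ge> 0" "ball_window A S x k \<subseteq> U"
        using openin_shift_topology_ball[OF U x] by auto
      have "x \<in> ball_window A S x k" using x sub by (auto simp: ball_window_def)
      moreover have "ball_window A S x k \<in> ?C"
        unfolding ball_window_eq_cylinder[OF k(1)] using x sub k(1) by (fastforce simp: shift_space_def)
      ultimately show ?thesis using k by blast
    qed
    then have "U = \<Union> {C \<in> ?C. C \<subseteq> U}" by blast
    moreover have "\<Union> {C \<in> ?C. C \<subseteq> U} \<in> sigma_sets (shift_space A S) ?C"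
      by (intro sigma_sets_UNION countable_subset[OF _ count]) (auto intro: sigma_sets.Basic)
    ultimately show ?thesis by simp
  qed
  moreover have "openin (shift_topology A S) C" if "C \<in> ?C" for C
    using that openin_cylinder by blast
  ultimately show ?thesis
    unfolding sets_borel_of_topology topspace_shift_topology
    by (intro equalityI sigma_sets_mono) (blast intro: sigma_sets.Basic openin_cylinder)+
qed

text \<open>Hence Borel sets can be approximated by sets that see finitely many coordinates and
  finitely many symbols, which reduces entropy to finite codes.\<close>

lemma sets_borel_shift_finite_code:
  assumes "countable A"
  shows "sets (borel_of_topology (shift_topology A S)) = sigma_sets (shift_space A S) (finite_code_sets A S)"
proof
  show "sets (borel_of_topology (shift_topology A S)) \<subseteq> sigma_sets (shift_space A S) (finite_code_sets A S)"
    unfolding sets_borel_shift_cylinders[OF assms]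
    by (rule sigma_sets_mono) (auto intro!: sigma_sets.Basic cylinder_finite_code_set)
  show "sigma_sets (shift_space A S) (finite_code_sets A S) \<subseteq> sets (borel_of_topology (shift_topology A S))"
    unfolding sets_borel_of_topology topspace_shift_topology
    by (rule sigma_sets_mono) (auto simp: finite_code_sets_def intro!: sigma_sets.Basic dest: openin_window_set)
qed

lemma space_borel_shift: "space (borel_of_topology (shift_topology A S)) = shift_space A S"
  unfolding borel_of_topology_def by (subst space_measure_of) (auto dest!: openin_subset)

section \<open>Finite codes and recurrence for an ergodic measure\<close>

locale ergodic_shift =
  fixes A :: "'a set" and S :: "'a \<Rightarrow> 'a \<Rightarrow> nat" and M :: "(int \<Rightarrow> 'a) measure"
  assumes countable_alphabet: "countable A" and ergodic_measure: "M \<in> ergodic_measures A S"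
begin

lemma ergodic: "ergodic M left_shift" and sets_M: "sets M = sets (borel_of_topology (shift_topology A S))"
  using ergodic_measure by (auto simp: ergodic_measures_def)

sublocale measure_preserving_system M left_shift
  using ergodic by (simp add: ergodic_def measure_preserving_system_def measure_preserving_system_axioms_def)

lemma space_M: "space M = shift_space A S"
  using sets_eq_imp_space_eq[OF sets_M] by (simp add: space_borel_shift)

lemma window_set_measurable: "B \<in> window_sets A S f \<Longrightarrow> B \<in> sets M"
  unfolding sets_M sets_borel_of_topology by (intro sigma_sets.Basic CollectI openin_window_set)

lemma measurable_pattern [measurable]: "{x \<in> shift_space A S. x i = s} \<in> sets M"
  by (rule window_set_measurable[of _ id], rule window_setsI[where k = "\<bar>i\<bar>"]) auto

lemma simple_coordinate:
  assumes "finite F" shows "simple_function M (\<lambda>x. symbol_code F (x i))"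
  unfolding simple_function_def
proof (intro conjI ballI)
  show "finite ((\<lambda>x. symbol_code F (x i)) ` space M)"
    by (rule finite_subset[of _ "insert None (Some ` F)"]) (use assms in \<open>auto simp: symbol_code_def\<close>)
  fix v
  show "(\<lambda>x. symbol_code F (x i)) -` {v} \<inter> space M \<in> sets M"
    unfolding space_M
    by (rule window_set_measurable[of _ "symbol_code F"], rule window_setsI[where k = "\<bar>i\<bar>"]) auto
qed

lemma entropy_rate_le_finite_code:
  fixes X :: "(int \<Rightarrow> 'a) \<Rightarrow> 'b"
  assumes X: "simple_function M X" and e: "e > 0"
  obtains F where "finite F" "\<And>F'. finite F' \<Longrightarrow> F \<subseteq> F' \<Longrightarrow>
      entropy_rate X \<le> entropy_rate (\<lambda>x. symbol_code F' (x 0)) + e"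
proof -
  have alg: "algebra (space M) (finite_code_sets A S)"
    unfolding space_M by (rule algebra_finite_code_sets)
  have gen: "sets M = sigma_sets (space M) (finite_code_sets A S)"
    unfolding space_M sets_M by (rule sets_borel_shift_finite_code[OF countable_alphabet])
  obtain V :: "'b set" and b where V: "finite V" and b: "\<And>v. v \<in> V \<Longrightarrow> b v \<in> finite_code_sets A S"
    and Y: "simple_function M (\<lambda>x. {v\<in>V. x \<in> b v})"
    and le: "entropy_rate X \<le> entropy_rate (\<lambda>x. {v\<in>V. x \<in> b v}) + e"
    using entropy_rate_algebra_approximation[OF alg gen X e] by blast
  let ?Y = "\<lambda>x. {v\<in>V. x \<in> b v}"
  have "\<exists>F k. finite F \<and> (\<forall>x\<in>b v. \<forall>y\<in>shift_space A S. (\<forall>i. \<bar>i\<bar> \<le> k \<longrightarrow> symbol_code F (x i) = symbol_code F (y i)) \<longrightarrow> y \<in> b v)"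
    if "v \<in> V" for v
    using b[OF that] unfolding finite_code_sets_def window_sets_def by blast
  then obtain F k where F: "\<And>v. v \<in> V \<Longrightarrow> finite (F v)" and k: "\<And>v x y. v \<in> V \<Longrightarrow> x \<in> b v \<Longrightarrow> y \<in> shift_space A S
      \<Longrightarrow> (\<forall>i. \<bar>i\<bar> \<le> k v \<longrightarrow> symbol_code (F v) (x i) = symbol_code (F v) (y i)) \<Longrightarrow> y \<in> b v"
    by metis
  \<comment> \<open>A common radius; the sum serves as an upper bound for the finitely many
    \<open>k v\<close>.\<close>
  define K where "K = nat (\<Sum>v\<in>V. \<bar>k v\<bar>)"
  have K: "k v \<le> int K" if "v \<in> V" for v
  proof -
    have "\<bar>k v\<bar> \<le> (\<Sum>v\<in>V. \<bar>k v\<bar>)" using V that by (intro member_le_sum) auto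
    then show ?thesis by (simp add: K_def)
  qed
  show ?thesis
  proof (rule that[of "\<Union> (F ` V)"])
    show "finite (\<Union> (F ` V))" using V F by auto
    fix F' assume F': "finite F'" "\<Union> (F ` V) \<subseteq> F'"
    let ?X = "\<lambda>x. symbol_code F' (x 0)"
    have sX: "simple_function M ?X" by (rule simple_coordinate[OF F'(1)])
    have det: "?Y x = ?Y y" if "x \<in> space M" "y \<in> space M"
      and eq: "\<And>i. \<bar>i\<bar> \<le> int K \<Longrightarrow> symbol_code F' (x i) = symbol_code F' (y i)" for x y
    proof -
      have "symbol_code (F v) (x i) = symbol_code (F v) (y i)" if "v \<in> V" "\<bar>i\<bar> \<le> k v" for v i
        using eq[of i] K[OF that(1)] that F'(2) by (intro symbol_code_mono[of "F v" F']) auto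
      then have "x \<in> b v \<longleftrightarrow> y \<in> b v" if "v \<in> V" for v
        using k[OF that, of x y] k[OF that, of y x] \<open>x \<in> space M\<close> \<open>y \<in> space M\<close> that space_M by metis
      then show ?thesis by auto
    qed
    have "ent M (itin ?Y n) \<le> ent M (itin ?X n) + real n * 0 + ent M (itin ?X (2 * K))" for n
    proof -
      \<comment> \<open>Moving the base point by \<open>K\<close> brings the windows around the
        first \<open>n\<close> times into the nonnegative times below \<open>n + 2 * K\<close>; the
        extra \<open>2 * K\<close> letters cost a constant.\<close>
      have "ent M (itin ?Y n) = ent M (\<lambda>x. itin ?Y n ((left_shift ^^ K) x))"
        by (rule ent_funpow[symmetric, OF simple_itin[OF Y]])
      also have "\<dots> \<le> ent M (itin ?X (n + 2 * K))"
      proof (rule ent_mono_inj[OF simple_itin[OF sX] simple_funpow[OF simple_itin[OF Y]]])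
        fix x y assume xy: "x \<in> space M" "y \<in> space M" and eq: "itin ?X (n + 2 * K) x = itin ?X (n + 2 * K) y"
        have eq': "symbol_code F' (x (int j)) = symbol_code F' (y (int j))" if "j < n + 2 * K" for j
          using fun_cong[OF eq, of j] that by (simp add: itin_def left_shift_funpow)
        have "?Y ((left_shift ^^ (i + K)) x) = ?Y ((left_shift ^^ (i + K)) y)" if i: "i < n" for i
        proof (rule det)
          fix j :: int assume "\<bar>j\<bar> \<le> int K"
          then have "int (nat (j + int i + int K)) = j + int i + int K" "nat (j + int i + int K) < n + 2 * K"
            using i by linarith+
          then show "symbol_code F' ((left_shift ^^ (i + K)) x j) = symbol_code F' ((left_shift ^^ (i + K)) y j)"
            using eq'[of "nat (j + int i + int K)"] by (simp add: left_shift_funpow add_ac)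
        qed (use xy funpow_in_space in auto)
        then show "itin ?Y n ((left_shift ^^ K) x) = itin ?Y n ((left_shift ^^ K) y)"
          by (auto simp: itin_def funpow_add fun_eq_iff restrict_def)
      qed
      also have "\<dots> \<le> ent M (itin ?X n) + ent M (itin ?X (2 * K))"
        by (rule ent_itin_subadditive[OF sX])
      finally show ?thesis by simp
    qed
    then have "entropy_rate ?Y \<le> entropy_rate ?X + 0" by (rule entropy_rate_mono[OF Y sX])
    then show "entropy_rate X \<le> entropy_rate ?X + e" using le by linarith
  qed
qed

text \<open>By invariance the probability of a visit at or after time \<open>n\<close> does not
  depend on \<open>n\<close>, so it is the probability of visits at arbitrarily late times, an
  invariant event. The past is treated in the same way.\<close>

lemma recurrence:
  assumes pos: "measure M {x \<in> shift_space A S. x 0 = a} > 0"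
  shows "measure M {x \<in> shift_space A S. \<exists>i\<ge>n. x i = a} = 1" (is ?fut)
    and "measure M {x \<in> shift_space A S. \<exists>i\<le>n. x i = a} = 1" (is ?past)
proof -
  let ?U = "\<lambda>n::int. {x \<in> shift_space A S. \<exists>i\<ge>n. x i = a}"
    and ?P = "\<lambda>n::int. {x \<in> shift_space A S. \<exists>i\<le>n. x i = a}"
  have "?U n = (\<Union>i\<in>{n..}. {x \<in> shift_space A S. x i = a})" for n by auto
  then have mU: "?U n \<in> sets M" for n by auto
  have "?P n = (\<Union>i\<in>{..n}. {x \<in> shift_space A S. x i = a})" for n by auto
  then have mP: "?P n \<in> sets M" for n by auto
  have UK: "(left_shift ^^ k) -` ?U n \<inter> space M = ?U (n + int k)" for k n
  proof -
    have "(\<exists>i\<ge>n. x (i + int k) = a) \<longleftrightarrow> (\<exists>i\<ge>n + int k. x i = a)" for x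
      by (metis add_le_cancel_right diff_add_cancel)
    then show ?thesis using funpow_in_space unfolding space_M by (auto simp: left_shift_funpow)
  qed
  have PK: "(left_shift ^^ k) -` ?P n \<inter> space M = ?P (n + int k)" for k n
  proof -
    have "(\<exists>i\<le>n. x (i + int k) = a) \<longleftrightarrow> (\<exists>i\<le>n + int k. x i = a)" for x
      by (metis add_le_cancel_right diff_add_cancel)
    then show ?thesis using funpow_in_space unfolding space_M by (auto simp: left_shift_funpow)
  qed
  have U1: "measure M (?U (n + int k)) = measure M (?U n)" for n k
    using measure_vimage_funpow[OF mU, of k n] UK[of k n] by simp
  have P1: "measure M (?P (n + int k)) = measure M (?P n)" for n k
    using measure_vimage_funpow[OF mP, of k n] PK[of k n] by simp
  \<comment> \<open>\<open>U1\<close> only moves forward, so two times are compared through their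
    minimum.\<close>
  have Ueq: "measure M (?U n) = measure M (?U m)" for n m
    using U1[of "min n m" "nat (n - min n m)"] U1[of "min n m" "nat (m - min n m)"] by simp
  have Peq: "measure M (?P n) = measure M (?P m)" for n m
    using P1[of "min n m" "nat (n - min n m)"] P1[of "min n m" "nat (m - min n m)"] by simp
  have Upos: "measure M (?U 0) > 0"
    by (rule less_le_trans[OF pos finite_measure_mono]) (use mU in auto)
  have Ppos: "measure M (?P 0) > 0"
    by (rule less_le_trans[OF pos finite_measure_mono]) (use mP in auto)
  have Vinv: "left_shift -` (\<Inter>n. ?U (int n)) \<inter> space M = (\<Inter>n. ?U (int n))"
  proof -
    have "left_shift -` (\<Inter>n. ?U (int n)) \<inter> space M = (\<Inter>n. (left_shift ^^ 1) -` ?U (int n) \<inter> space M)" by auto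
    also have "\<dots> = (\<Inter>n. ?U (int n + 1))" using UK[of 1] by simp
    also have "\<dots> = (\<Inter>n. ?U (int n))"
    proof
      show "(\<Inter>n. ?U (int n + 1)) \<subseteq> (\<Inter>n. ?U (int n))"
      proof (intro INT_greatest subsetI)
        fix n x assume "x \<in> (\<Inter>n. ?U (int n + 1))"
        then have "x \<in> ?U (int n + 1)" by blast
        then obtain i where "x \<in> shift_space A S" "i \<ge> int n + 1" "x i = a" by auto
        then show "x \<in> ?U (int n)" by (intro CollectI conjI exI[of _ i]) auto
      qed
      show "(\<Inter>n. ?U (int n)) \<subseteq> (\<Inter>n. ?U (int n + 1))"
      proof (intro INT_greatest subsetI)
        fix n x assume "x \<in> (\<Inter>n. ?U (int n))"
        then have "x \<in> ?U (int (Suc n))" by blast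
        then show "x \<in> ?U (int n + 1)" by (simp add: add.commute)
      qed
    qed
    finally show ?thesis .
  qed
  have Pinv: "left_shift -` (\<Inter>n. ?P (- int n)) \<inter> space M = (\<Inter>n. ?P (- int n))"
  proof -
    have "left_shift -` (\<Inter>n. ?P (- int n)) \<inter> space M = (\<Inter>n. (left_shift ^^ 1) -` ?P (- int n) \<inter> space M)" by auto
    also have "\<dots> = (\<Inter>n. ?P (- int n + 1))" using PK[of 1] by simp
    also have "\<dots> = (\<Inter>n. ?P (- int n))"
    proof
      show "(\<Inter>n. ?P (- int n)) \<subseteq> (\<Inter>n. ?P (- int n + 1))"
      proof (intro INT_greatest subsetI)
        fix n x assume "x \<in> (\<Inter>n. ?P (- int n))"
        then have "x \<in> ?P (- int n)" by blast
        then obtain i where "x \<in> shift_space A S" "i \<le> - int n" "x i = a" by auto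
        then show "x \<in> ?P (- int n + 1)" by (intro CollectI conjI exI[of _ i]) auto
      qed
      show "(\<Inter>n. ?P (- int n + 1)) \<subseteq> (\<Inter>n. ?P (- int n))"
      proof (intro INT_greatest subsetI)
        fix n x assume "x \<in> (\<Inter>n. ?P (- int n + 1))"
        then have "x \<in> ?P (- int (Suc n) + 1)" by blast
        then show "x \<in> ?P (- int n)" by simp
      qed
    qed
    finally show ?thesis .
  qed
  have "decseq (\<lambda>n. ?U (int n))"
    unfolding decseq_def
  proof (intro allI impI subsetI)
    fix m n :: nat and x assume "m \<le> n" "x \<in> ?U (int n)"
    then obtain i where "x \<in> shift_space A S" "i \<ge> int n" "x i = a" by auto
    then show "x \<in> ?U (int m)" using \<open>m \<le> n\<close> by (intro CollectI conjI exI[of _ i]) auto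
  qed
  then have "measure M (?U (int 0)) = 1"
    by (rule ergodic_limsup_set[OF ergodic mU _ Ueq _ Vinv])
      (use Upos in \<open>auto simp: decseq_def intro: order_trans\<close>)
  then show ?fut using Ueq[of n 0] by simp
  have "decseq (\<lambda>n. ?P (- int n))"
    unfolding decseq_def
  proof (intro allI impI subsetI)
    fix m n :: nat and x assume "m \<le> n" "x \<in> ?P (- int n)"
    then obtain i where "x \<in> shift_space A S" "i \<le> - int n" "x i = a" by auto
    then show "x \<in> ?P (- int m)" using \<open>m \<le> n\<close> by (intro CollectI conjI exI[of _ i]) auto
  qed
  then have "measure M (?P (- int 0)) = 1"
    by (rule ergodic_limsup_set[OF ergodic mP _ Peq _ Pinv]) (use Ppos in simp)
  then show ?past using Peq[of n 0] by simp
qed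

end

section \<open>Bernoulli shifts\<close>

lemma bernoulli_measure_preserving:
  assumes "prob_space K"
  shows "measure_preserving (PiM UNIV (\<lambda>_::int. K)) left_shift"
proof -
  have eq: "(\<lambda>\<omega>. \<lambda>n\<in>UNIV. \<omega> (n + 1)) = (left_shift :: (int \<Rightarrow> 'a) \<Rightarrow> _)"
    by (simp add: left_shift_def fun_eq_iff)
  have "distr (PiM UNIV (\<lambda>_::int. K)) (PiM UNIV (\<lambda>_::int. K)) (\<lambda>\<omega>. \<lambda>n\<in>UNIV. \<omega> (n + 1)) = PiM UNIV (\<lambda>_. K)"
    by (rule distr_PiM_reindex) (auto simp: assms inj_def)
  moreover have "left_shift \<in> PiM UNIV (\<lambda>_::int. K) \<rightarrow>\<^sub>M PiM UNIV (\<lambda>_. K)"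
    unfolding eq[symmetric] by (intro measurable_restrict measurable_component_singleton) simp
  ultimately show ?thesis by (simp only: measure_preserving_def eq simp_thms)
qed

text \<open>Symmetric windows are nested, so two such events share a window and the events form an
  algebra; events over disjoint sets of coordinates are independent.\<close>

definition coordinate_window :: "'b measure \<Rightarrow> int \<Rightarrow> (int \<Rightarrow> 'b) set \<Rightarrow> (int \<Rightarrow> 'b) set" where
  "coordinate_window K k X = (\<lambda>\<omega>. restrict \<omega> {- k..k}) -` X \<inter> space (PiM UNIV (\<lambda>_. K))"

definition coordinate_sets :: "'b measure \<Rightarrow> (int \<Rightarrow> 'b) set set" where
  "coordinate_sets K = {coordinate_window K k X | k X. X \<in> sets (PiM {- k..k} (\<lambda>_. K))}"

lemma measurable_restrict_coordinates: "(\<lambda>\<omega>. restrict \<omega> J) \<in> PiM UNIV (\<lambda>_. K) \<rightarrow>\<^sub>M PiM J (\<lambda>_. K)"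
  by (rule measurable_restrict_subset) simp

lemma coordinate_window_larger:
  assumes "X \<in> sets (PiM {- k..k} (\<lambda>_. K))" "k \<le> l"
  obtains Y where "Y \<in> sets (PiM {- l..l} (\<lambda>_. K))" "coordinate_window K k X = coordinate_window K l Y"
proof
  let ?Y = "(\<lambda>\<omega>. restrict \<omega> {- k..k}) -` X \<inter> space (PiM {- l..l} (\<lambda>_. K))"
  show "?Y \<in> sets (PiM {- l..l} (\<lambda>_. K))"
    by (rule measurable_sets[OF measurable_restrict_subset assms(1)]) (use assms(2) in auto)
  have "restrict (restrict \<omega> {- l..l}) {- k..k} = restrict \<omega> {- k..k}" for \<omega> :: "int \<Rightarrow> 'a"
    using assms(2) by (auto simp: restrict_def fun_eq_iff)
  then show "coordinate_window K k X = coordinate_window K l ?Y"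
    by (auto simp: coordinate_window_def space_PiM PiE_def)
qed

lemma algebra_coordinate_sets:
  "algebra (space (PiM UNIV (\<lambda>_. K))) (coordinate_sets K)"
  unfolding algebra_iff_Un
proof (intro conjI ballI)
  let ?\<Omega> = "space (PiM UNIV (\<lambda>_::int. K))"
  show "coordinate_sets K \<subseteq> Pow ?\<Omega>"
    by (auto simp: coordinate_sets_def coordinate_window_def)
  have "coordinate_window K 0 {} = {}" by (simp add: coordinate_window_def)
  then show "{} \<in> coordinate_sets K" unfolding coordinate_sets_def by blast
  fix B assume "B \<in> coordinate_sets K"
  then obtain k X where X: "X \<in> sets (PiM {- k..k} (\<lambda>_. K))" "B = coordinate_window K k X"
    by (auto simp: coordinate_sets_def)
  have "?\<Omega> - B = coordinate_window K k (space (PiM {- k..k} (\<lambda>_. K)) - X)"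
    using measurable_space[OF measurable_restrict_coordinates] unfolding X(2) coordinate_window_def by blast
  then show "?\<Omega> - B \<in> coordinate_sets K" using X(1) by (auto simp: coordinate_sets_def)
  fix C assume "C \<in> coordinate_sets K"
  then obtain l Y where Y: "Y \<in> sets (PiM {- l..l} (\<lambda>_. K))" "C = coordinate_window K l Y"
    by (auto simp: coordinate_sets_def)
  obtain X' where X': "X' \<in> sets (PiM {- max k l..max k l} (\<lambda>_. K))" "B = coordinate_window K (max k l) X'"
    using coordinate_window_larger[OF X(1), of "max k l"] X(2) by auto
  obtain Y' where Y': "Y' \<in> sets (PiM {- max k l..max k l} (\<lambda>_. K))" "C = coordinate_window K (max k l) Y'"
    using coordinate_window_larger[OF Y(1), of "max k l"] Y(2) by auto
  have "B \<union> C = coordinate_window K (max k l) (X' \<union> Y')"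
    unfolding X'(2) Y'(2) by (auto simp: coordinate_window_def)
  then show "B \<union> C \<in> coordinate_sets K" using X'(1) Y'(1) unfolding coordinate_sets_def by blast
qed

lemma sets_PiM_coordinate_sets:
  "sets (PiM UNIV (\<lambda>_::int. K)) = sigma_sets (space (PiM UNIV (\<lambda>_::int. K))) (coordinate_sets K)"
proof
  show "sigma_sets (space (PiM UNIV (\<lambda>_. K))) (coordinate_sets K) \<subseteq> sets (PiM UNIV (\<lambda>_. K))"
    by (rule sets.sigma_sets_subset)
       (auto simp: coordinate_sets_def coordinate_window_def intro: measurable_sets[OF measurable_restrict_coordinates])
  show "sets (PiM UNIV (\<lambda>_::int. K)) \<subseteq> sigma_sets (space (PiM UNIV (\<lambda>_. K))) (coordinate_sets K)"
    unfolding sets_PiM_single space_PiM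
  proof (rule sigma_sets_mono, safe)
    fix i :: int and X assume X: "X \<in> sets K"
    let ?J = "{- \<bar>i\<bar>..\<bar>i\<bar>}"
    let ?Y = "{f \<in> space (PiM ?J (\<lambda>_. K)). f i \<in> X}"
    have "?Y = (\<lambda>f. f i) -` X \<inter> space (PiM ?J (\<lambda>_. K))" by auto
    also have "\<dots> \<in> sets (PiM ?J (\<lambda>_. K))"
      by (rule measurable_sets[OF _ X], rule measurable_component_singleton) auto
    finally have "?Y \<in> sets (PiM ?J (\<lambda>_. K))" .
    moreover have "{f \<in> UNIV \<rightarrow>\<^sub>E space K. f i \<in> X} = coordinate_window K \<bar>i\<bar> ?Y"
      by (auto simp: coordinate_window_def space_PiM PiE_def)
    ultimately have "{f \<in> UNIV \<rightarrow>\<^sub>E space K. f i \<in> X} \<in> coordinate_sets K"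
      unfolding coordinate_sets_def by blast
    then show "{f \<in> UNIV \<rightarrow>\<^sub>E space K. f i \<in> X} \<in> sigma_sets (UNIV \<rightarrow>\<^sub>E space K) (coordinate_sets K)"
      by (rule sigma_sets.Basic)
  qed
qed

text \<open>An invariant set is approximated by a set depending on a finite window, which is independent of
  its translates by more than the length of the window; hence the invariant set is independent of itself.\<close>

lemma bernoulli_ergodic:
  assumes K: "prob_space K"
  shows "ergodic (PiM UNIV (\<lambda>_::int. K)) left_shift"
proof -
  let ?P = "PiM UNIV (\<lambda>_::int. K)"
  interpret K: prob_space K by (rule K)
  interpret P: measure_preserving_system ?P left_shift
    by (intro measure_preserving_system.intro measure_preserving_system_axioms.intro
        prob_space_PiM K bernoulli_measure_preserving)
  interpret PP: product_prob_space "\<lambda>_::int. K" UNIV by unfold_locales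
  have indep: "P.indep_vars (\<lambda>_. K) (\<lambda>i \<omega>. \<omega> i) UNIV"
  proof (subst P.indep_vars_iff_distr_eq_PiM)
    show "distr ?P ?P (\<lambda>x. \<lambda>i\<in>UNIV. x i) = (\<Pi>\<^sub>M i\<in>UNIV. distr ?P K (\<lambda>\<omega>. \<omega> i))"
      by (simp add: PP.PiM_component distr_id2 restrict_UNIV)
  qed auto
  have "measure ?P D = 0 \<or> measure ?P D = 1" if D: "D \<in> sets ?P" "left_shift -` D \<inter> space ?P = D" for D
  proof -
    have invn: "(left_shift ^^ n) -` D \<inter> space ?P = D" for n
    proof (induction n)
      case 0 then show ?case using sets.sets_into_space[OF D(1)] by auto
    next
      case (Suc n)
      have "(left_shift ^^ Suc n) -` D \<inter> space ?P = (left_shift ^^ n) -` (left_shift -` D \<inter> space ?P) \<inter> space ?P"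
        using P.funpow_in_space by auto
      then show ?case by (simp only: Suc.IH D(2))
    qed
    \<comment> \<open>Two of the four \<open>e\<close> come from replacing \<open>D\<close> by
      \<open>C\<close> and \<open>D\<close>, as its own preimage, by \<open>?C'\<close>; the other
      two from comparing the squares of their measures.\<close>
    have "\<bar>measure ?P D - measure ?P D * measure ?P D\<bar> \<le> 4 * e" if e: "e > 0" for e
    proof -
      obtain C where C: "C \<in> coordinate_sets K" "measure ?P ((D - C) \<union> (C - D)) < e"
        using P.algebra_approximation[OF algebra_coordinate_sets sets_PiM_coordinate_sets D(1) e] .
      then obtain k X where X: "X \<in> sets (PiM {- k..k} (\<lambda>_. K))" "C = coordinate_window K k X"
        by (auto simp: coordinate_sets_def)
      have CM: "C \<in> sets ?P"
        unfolding X(2) coordinate_window_def by (rule measurable_sets[OF measurable_restrict_coordinates X(1)])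
      \<comment> \<open>The least shift that makes the window \<open>{- k..k}\<close> disjoint from
        its translate.\<close>
      define n where "n = nat (2 * k + 1)"
      let ?J = "{- k..k}" and ?J' = "{- k + int n..k + int n}"
      let ?C' = "(left_shift ^^ n) -` C \<inter> space ?P"
      let ?t = "\<lambda>f. \<lambda>i\<in>?J. f (i + int n)"
      \<comment> \<open>The event \<open>X\<close> read on the translated window; it describes
        \<open>?C'\<close>.\<close>
      let ?X' = "?t -` X \<inter> space (PiM ?J' (\<lambda>_. K))"
      have "?t \<in> PiM ?J' (\<lambda>_. K) \<rightarrow>\<^sub>M PiM ?J (\<lambda>_. K)"
        by (intro measurable_restrict measurable_component_singleton) auto
      then have X': "?X' \<in> sets (PiM ?J' (\<lambda>_. K))" using X(1) by (rule measurable_sets)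
      have "?J \<inter> ?J' = {}" by (auto simp: n_def)
      from P.indep_varD[OF P.indep_var_restrict[OF indep this] X(1) X']
      have ind: "measure ?P ((\<lambda>\<omega>. (restrict \<omega> ?J, restrict \<omega> ?J')) -` (X \<times> ?X') \<inter> space ?P) =
        measure ?P ((\<lambda>\<omega>. restrict \<omega> ?J) -` X \<inter> space ?P) * measure ?P ((\<lambda>\<omega>. restrict \<omega> ?J') -` ?X' \<inter> space ?P)"
        by simp
      have t: "?t (restrict \<omega> ?J') = restrict ((left_shift ^^ n) \<omega>) ?J" for \<omega> :: "int \<Rightarrow> 'a"
        by (auto simp: left_shift_funpow restrict_def fun_eq_iff)
      have C': "(\<lambda>\<omega>. restrict \<omega> ?J') -` ?X' \<inter> space ?P = ?C'"
      proof (rule set_eqI)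
        fix \<omega>
        show "\<omega> \<in> (\<lambda>\<omega>. restrict \<omega> ?J') -` ?X' \<inter> space ?P \<longleftrightarrow> \<omega> \<in> ?C'"
          using t[of \<omega>] P.funpow_in_space[of \<omega> n] measurable_space[OF measurable_restrict_coordinates, of \<omega> K ?J']
          unfolding X(2) coordinate_window_def by auto
      qed
      have CC: "(\<lambda>\<omega>. (restrict \<omega> ?J, restrict \<omega> ?J')) -` (X \<times> ?X') \<inter> space ?P = C \<inter> ?C'"
        unfolding C'[symmetric] by (auto simp: X(2) coordinate_window_def)
      have C'M: "?C' \<in> sets ?P" by (rule measurable_sets[OF P.measurable_funpow CM])
      have mC': "measure ?P ?C' = measure ?P C" by (rule P.measure_vimage_funpow[OF CM])
      have prod: "measure ?P (C \<inter> ?C') = measure ?P C * measure ?P C"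
        using ind unfolding CC C' mC' by (simp add: X(2) coordinate_window_def)
      have sd: "\<bar>measure ?P U - measure ?P V\<bar> \<le> measure ?P ((U - V) \<union> (V - U))"
        if "U \<in> sets ?P" "V \<in> sets ?P" for U V
      proof -
        have "measure ?P U \<le> measure ?P (V \<union> ((U - V) \<union> (V - U)))" "measure ?P V \<le> measure ?P (U \<union> ((U - V) \<union> (V - U)))"
          using that by (auto intro!: P.finite_measure_mono)
        moreover have "measure ?P (V \<union> ((U - V) \<union> (V - U))) \<le> measure ?P V + measure ?P ((U - V) \<union> (V - U))"
          "measure ?P (U \<union> ((U - V) \<union> (V - U))) \<le> measure ?P U + measure ?P ((U - V) \<union> (V - U))"
          using that by (auto intro!: measure_Un_le)
        ultimately show ?thesis by linarith
      qed
      have 1: "\<bar>measure ?P D - measure ?P C\<bar> < e" using sd[OF D(1) CM] C(2) by linarith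
      have "\<bar>measure ?P D - measure ?P (C \<inter> ?C')\<bar> \<le> measure ?P ((D - C \<inter> ?C') \<union> (C \<inter> ?C' - D))"
        using CM C'M by (intro sd D(1)) auto
      also have "\<dots> \<le> measure ?P (((D - C) \<union> (C - D)) \<union> ((left_shift ^^ n) -` ((D - C) \<union> (C - D)) \<inter> space ?P))"
      proof (rule P.finite_measure_mono)
        have "x \<in> (left_shift ^^ n) -` D \<inter> space ?P" if "x \<in> D" for x using invn[of n] that by blast
        then show "(D - C \<inter> ?C') \<union> (C \<inter> ?C' - D) \<subseteq> ((D - C) \<union> (C - D)) \<union> ((left_shift ^^ n) -` ((D - C) \<union> (C - D)) \<inter> space ?P)"
          by blast
        show "((D - C) \<union> (C - D)) \<union> ((left_shift ^^ n) -` ((D - C) \<union> (C - D)) \<inter> space ?P) \<in> sets ?P"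
          by (intro sets.Un measurable_sets[OF P.measurable_funpow] sets.Diff D(1) CM)
      qed
      also have "\<dots> \<le> measure ?P ((D - C) \<union> (C - D)) + measure ?P ((left_shift ^^ n) -` ((D - C) \<union> (C - D)) \<inter> space ?P)"
        by (intro measure_Un_le sets.Un measurable_sets[OF P.measurable_funpow] sets.Diff D(1) CM)
      also have "\<dots> \<le> 2 * e"
        using C(2) P.measure_vimage_funpow[of "(D - C) \<union> (C - D)" n] D(1) CM by auto
      finally have 2: "\<bar>measure ?P D - measure ?P C * measure ?P C\<bar> \<le> 2 * e" unfolding prod .
      let ?c = "measure ?P C" and ?d = "measure ?P D"
      have "\<bar>?c * ?c - ?d * ?d\<bar> = \<bar>?c - ?d\<bar> * \<bar>?c + ?d\<bar>"
        by (simp only: abs_mult[symmetric]) (simp add: algebra_simps)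
      also have "\<dots> \<le> e * 2"
      proof (rule mult_mono)
        show "\<bar>?c - ?d\<bar> \<le> e" using 1 by linarith
        show "\<bar>?c + ?d\<bar> \<le> 2"
          using P.prob_le_1[of C] P.prob_le_1[of D] measure_nonneg[of ?P C] measure_nonneg[of ?P D] by linarith
      qed (use e in auto)
      finally show ?thesis using 2 by linarith
    qed
    then have "\<bar>measure ?P D - measure ?P D * measure ?P D\<bar> \<le> 0 + e" if "e > 0" for e
      using that[THEN half_gt_zero, THEN half_gt_zero] by fastforce
    then have "\<bar>measure ?P D - measure ?P D * measure ?P D\<bar> \<le> 0" by (rule field_le_epsilon)
    then have "measure ?P D * (1 - measure ?P D) = 0" by (simp add: algebra_simps)
    then show ?thesis by auto
  qed
  then show ?thesis
    using bernoulli_measure_preserving[OF K] P.prob_space_axioms by (auto simp: ergodic_def)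
qed

lemma (in prob_space) ent_lower_bound:
  assumes X: "simple_function M X" and c: "0 < c" "\<And>v. v \<in> X ` space M \<Longrightarrow> law M X v \<le> c"
  shows "- ln c \<le> ent M X"
proof -
  have "- ln c = (\<Sum>v\<in>X ` space M. law M X v * - ln c)"
    using sum_law[OF X] by (simp add: sum_negf sum_distrib_right[symmetric])
  also have "\<dots> \<le> ent M X"
    unfolding ent_def
  proof (rule sum_mono)
    fix v assume "v \<in> X ` space M"
    then have le: "law M X v \<le> c" using c by auto
    show "law M X v * - ln c \<le> - law M X v * ln (law M X v)"
    proof (cases "law M X v = 0")
      case False
      then have "0 < law M X v" using law_nonneg[of M X v] by linarith
      then show ?thesis using le c(1) by simp
    qed simp
  qed
  finally show ?thesis .
qed

section \<open>Counting loops\<close>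

text \<open>Words of length \<open>m\<close> that close up to admissible loops at \<open>a\<close>; the empty word is the only loop of length 0.\<close>

definition loops :: "'a set \<Rightarrow> ('a \<Rightarrow> 'a \<Rightarrow> nat) \<Rightarrow> 'a \<Rightarrow> nat \<Rightarrow> 'a list set" where
  "loops A S a m = {w. length w = m \<and> set w \<subseteq> A \<and> (w @ [a]) ! 0 = a \<and>
     (\<forall>i<m. S (w ! i) ((w @ [a]) ! Suc i) = 1)}"

section \<open>The ergodic measure generated by finitely many loops\<close>

locale loop_tower =
  fixes A :: "'a set" and S :: "'a \<Rightarrow> 'a \<Rightarrow> nat" and a :: 'a and m :: nat and W :: "'a list set"
  assumes countable_alphabet: "countable A" and m_pos: "m > 0"
    and W_loops: "W \<subseteq> loops A S a m" and finite_W: "finite W" and W_nonempty: "W \<noteq> {}"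
begin

abbreviation "P \<equiv> PiM UNIV (\<lambda>_::int. uniform_count_measure W)"
abbreviation "B \<equiv> borel_of_topology (shift_topology A S)"

text \<open>Block \<open>k\<close> of the concatenation starts at time \<open>k * m\<close>, and the
  whole path is then moved by the phase \<open>i\<close>. Integer \<open>div\<close> and
  \<open>mod\<close> round downwards, as negative times require.\<close>

definition concat_path :: "(int \<Rightarrow> 'a list) \<Rightarrow> nat \<Rightarrow> int \<Rightarrow> 'a" where
  "concat_path \<omega> i = (\<lambda>j. \<omega> ((j + int i) div int m) ! nat ((j + int i) mod int m))"

text \<open>One step of the shift changes only the phase; \<open>m\<close> steps move the sequence
  of words by one. Averaging over a uniform phase gives the tower of height \<open>m\<close> over
  the Bernoulli shift, whose image is invariant under single steps.\<close>

definition tower_measure :: "(int \<Rightarrow> 'a) measure" where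
  "tower_measure = distr (P \<Otimes>\<^sub>M uniform_count_measure {..<m}) B (\<lambda>(\<omega>, i). concat_path \<omega> i)"

lemma prob_space_W: "prob_space (uniform_count_measure W)"
  by (rule prob_space_uniform_count_measure[OF finite_W W_nonempty])

lemma prob_space_phase: "prob_space (uniform_count_measure {..<m})"
  by (rule prob_space_uniform_count_measure) (use m_pos in auto)

sublocale P: measure_preserving_system P left_shift
  by (intro measure_preserving_system.intro measure_preserving_system_axioms.intro
      prob_space_PiM prob_space_W bernoulli_measure_preserving)

sublocale pair: pair_prob_space P "uniform_count_measure {..<m}"
  using P.prob_space_axioms prob_space_phase
  by (simp add: pair_prob_space_def pair_sigma_finite_def prob_space_imp_sigma_finite)

lemma space_P_D: "\<omega> \<in> space P \<Longrightarrow> \<omega> k \<in> W"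
  by (auto simp: space_PiM space_uniform_count_measure)

lemma concat_path_in_shift_space:
  assumes "\<omega> \<in> space P" shows "concat_path \<omega> i \<in> shift_space A S"
  unfolding shift_space_def
proof (intro CollectI conjI allI)
  fix j :: int
  let ?t = "j + int i"
  let ?r = "nat (?t mod int m)"
  have r: "?r < m" using m_pos by (simp add: nat_less_iff)
  have w: "\<omega> k \<in> loops A S a m" for k using space_P_D[OF assms] W_loops by auto
  then have len: "length (\<omega> k) = m" for k by (simp add: loops_def)
  show "concat_path \<omega> i j \<in> A"
    using w[of "?t div int m"] r unfolding concat_path_def loops_def by (auto simp: subset_iff)
  have step: "S (\<omega> (?t div int m) ! ?r) ((\<omega> (?t div int m) @ [a]) ! Suc ?r) = 1"
    using w[of "?t div int m"] r by (auto simp: loops_def)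
  show "S (concat_path \<omega> i j) (concat_path \<omega> i (j + 1)) = 1"
  proof (cases "Suc ?r < m")
    case True
    then have lt: "?t mod int m + 1 < int m" by linarith
    have ge: "0 \<le> ?t mod int m" using m_pos by simp
    have eq: "?t + 1 = int m * (?t div int m) + (?t mod int m + 1)" by simp
    have "(?t + 1) div int m = ?t div int m"
      by (rule int_div_pos_eq[OF eq]) (use ge lt in linarith)+
    moreover have "(?t + 1) mod int m = ?t mod int m + 1"
      by (rule int_mod_pos_eq[OF eq]) (use ge lt in linarith)+
    moreover have "nat (?t mod int m + 1) = Suc ?r" using ge by linarith
    ultimately show ?thesis
      using step True len by (simp add: concat_path_def nth_append add_ac)
  next
    \<comment> \<open>At the end of a block the loop condition gives the transition to the closing
      symbol \<open>a\<close>, which is also the first symbol of the next word.\<close>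
    case False
    then have last: "Suc ?r = m" using r by linarith
    moreover have "0 \<le> ?t mod int m" using m_pos by simp
    ultimately have "?t mod int m + 1 = int m" by linarith
    then have t1: "?t + 1 = (?t div int m + 1) * int m" by (simp add: algebra_simps minus_div_mult_eq_mod[symmetric])
    have "(?t + 1) div int m = ?t div int m + 1" "(?t + 1) mod int m = 0"
      unfolding t1 using m_pos by auto
    moreover have "\<omega> (?t div int m + 1) ! 0 = a"
      using w[of "?t div int m + 1"] m_pos by (auto simp: loops_def nth_append split: if_splits)
    ultimately show ?thesis
      using step last len by (simp add: concat_path_def nth_append add_ac)
  qed
qed

lemma left_shift_concat_path: "left_shift (concat_path \<omega> i) = concat_path \<omega> (Suc i)"
  by (simp add: left_shift_def concat_path_def add_ac)

lemma concat_path_period: "concat_path \<omega> m = concat_path (left_shift \<omega>) 0"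
  using m_pos by (simp add: concat_path_def left_shift_def fun_eq_iff)

lemma sets_B: "sets B = sigma_sets (shift_space A S) {cylinder A S r l |r l. r \<noteq> [] \<and> set r \<subseteq> A}"
  by (rule sets_borel_shift_cylinders[OF countable_alphabet])

lemma measurable_into_B:
  assumes "f \<in> space N \<rightarrow> shift_space A S" "\<And>j s. {x \<in> space N. f x j = s} \<in> sets N"
  shows "f \<in> N \<rightarrow>\<^sub>M B"
proof (rule measurable_sigma_sets[OF sets_B])
  fix C assume "C \<in> {cylinder A S r l |r l. r \<noteq> [] \<and> set r \<subseteq> A}"
  then obtain r l where C: "C = cylinder A S r l" by auto
  have "f -` C \<inter> space N = {x \<in> space N. \<forall>k\<in>{..<length r}. f x (l + int k) = r ! k}"
    using assms(1) by (auto simp: C cylinder_def)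
  also have "\<dots> \<in> sets N" by (intro sets.sets_Collect_finite_All assms(2)) auto
  finally show "f -` C \<inter> space N \<in> sets N" .
qed (use assms in \<open>auto simp: cylinder_def\<close>)

lemma measurable_concat_path: "(\<lambda>\<omega>. concat_path \<omega> i) \<in> P \<rightarrow>\<^sub>M B"
proof (rule measurable_into_B)
  fix j s
  have "{\<omega> \<in> space P. concat_path \<omega> i j = s} =
      (\<lambda>\<omega>. \<omega> ((j + int i) div int m)) -` {w \<in> W. w ! nat ((j + int i) mod int m) = s} \<inter> space P"
    using space_P_D by (auto simp: concat_path_def)
  also have "\<dots> \<in> sets P"
    by (rule measurable_sets[of _ _ "uniform_count_measure W"], rule measurable_component_singleton)
      (auto simp: sets_uniform_count_measure)
  finally show "{\<omega> \<in> space P. concat_path \<omega> i j = s} \<in> sets P" .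
qed (auto intro: concat_path_in_shift_space)

lemma measurable_tower: "(\<lambda>(\<omega>, i). concat_path \<omega> i) \<in> P \<Otimes>\<^sub>M uniform_count_measure {..<m} \<rightarrow>\<^sub>M B"
proof (rule measurable_into_B)
  let ?Q = "P \<Otimes>\<^sub>M uniform_count_measure {..<m}"
  have sp: "space ?Q = space P \<times> {..<m}" by (simp add: space_pair_measure space_uniform_count_measure)
  show "(\<lambda>(\<omega>, i). concat_path \<omega> i) \<in> space ?Q \<rightarrow> shift_space A S"
    unfolding sp using concat_path_in_shift_space by auto
  fix j s
  have "{z \<in> space ?Q. (case z of (\<omega>, i) \<Rightarrow> concat_path \<omega> i) j = s} = (\<Union>i\<in>{..<m}. {\<omega> \<in> space P. concat_path \<omega> i j = s} \<times> {i})"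
    unfolding sp by auto
  also have "\<dots> \<in> sets ?Q"
  proof (intro sets.finite_UN pair_measureI)
    fix i
    show "{i} \<in> sets (uniform_count_measure {..<m})" if "i \<in> {..<m}"
      using that by (auto simp: sets_uniform_count_measure)
    have "{x \<in> shift_space A S. x j = s} \<in> sets B"
      unfolding sets_borel_of_topology
      by (intro sigma_sets.Basic CollectI openin_window_set[of _ _ _ id] window_setsI[where k = "\<bar>j\<bar>"]) auto
    from measurable_sets[OF measurable_concat_path this]
    show "{\<omega> \<in> space P. concat_path \<omega> i j = s} \<in> sets P"
      using concat_path_in_shift_space by (auto simp: vimage_def Int_def conj_commute cong: conj_cong)
  qed auto
  finally show "{z \<in> space ?Q. (case z of (\<omega>, i) \<Rightarrow> concat_path \<omega> i) j = s} \<in> sets ?Q" .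
qed

lemma sets_tower: "sets tower_measure = sets B" and space_tower: "space tower_measure = shift_space A S"
  by (simp_all add: tower_measure_def space_borel_shift)

lemma prob_space_tower: "prob_space tower_measure"
  unfolding tower_measure_def by (rule pair.prob_space_distr[OF measurable_tower])

lemma measure_tower:
  assumes D: "D \<in> sets B"
  shows "measure tower_measure D = (\<Sum>i<m. measure P {\<omega> \<in> space P. concat_path \<omega> i \<in> D}) / m"
proof -
  let ?Q = "P \<Otimes>\<^sub>M uniform_count_measure {..<m}"
  let ?N = "(\<lambda>(\<omega>, i). concat_path \<omega> i) -` D \<inter> space ?Q"
  have sp: "space ?Q = space P \<times> {..<m}" by (simp add: space_pair_measure space_uniform_count_measure)
  have N: "?N \<in> sets ?Q" by (rule measurable_sets[OF measurable_tower D])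
  have "emeasure ?Q ?N = (\<integral>\<^sup>+i. emeasure P ((\<lambda>\<omega>. (\<omega>, i)) -` ?N) \<partial>uniform_count_measure {..<m})"
    by (rule pair.emeasure_pair_measure_alt2[OF N])
  also have "\<dots> = (\<Sum>i<m. ennreal (1 / real m) * emeasure P ((\<lambda>\<omega>. (\<omega>, i)) -` ?N))"
    by (simp add: uniform_count_measure_def nn_integral_point_measure_finite)
  also have "\<dots> = (\<Sum>i<m. ennreal (1 / real m * measure P {\<omega> \<in> space P. concat_path \<omega> i \<in> D}))"
  proof (intro sum.cong refl)
    fix i assume "i \<in> {..<m}"
    then have "(\<lambda>\<omega>. (\<omega>, i)) -` ?N = {\<omega> \<in> space P. concat_path \<omega> i \<in> D}" unfolding sp by auto
    then show "ennreal (1 / real m) * emeasure P ((\<lambda>\<omega>. (\<omega>, i)) -` ?N) =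
        ennreal (1 / real m * measure P {\<omega> \<in> space P. concat_path \<omega> i \<in> D})"
      by (simp only: P.emeasure_eq_measure) (subst ennreal_mult, auto)
  qed
  also have "\<dots> = ennreal (\<Sum>i<m. 1 / real m * measure P {\<omega> \<in> space P. concat_path \<omega> i \<in> D})"
    by (rule sum_ennreal) simp
  finally have "measure ?Q ?N = (\<Sum>i<m. 1 / real m * measure P {\<omega> \<in> space P. concat_path \<omega> i \<in> D})"
    by (simp add: measure_def sum_nonneg)
  then show ?thesis
    by (simp add: tower_measure_def measure_distr[OF measurable_tower D] sum_divide_distrib)
qed

lemma measurable_left_shift_B: "left_shift \<in> B \<rightarrow>\<^sub>M B"
proof (rule measurable_into_B)
  fix j s
  show "{x \<in> space B. left_shift x j = s} \<in> sets B"
    unfolding sets_borel_of_topology space_borel_shift left_shift_def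
    by (intro sigma_sets.Basic CollectI openin_window_set[of _ _ _ id] window_setsI[where k = "\<bar>j + 1\<bar>"]) auto
qed (auto simp: space_borel_shift left_shift_in_shift_space)

lemma measure_concat_path_period:
  assumes D: "D \<in> sets B"
  shows "measure P {\<omega> \<in> space P. concat_path \<omega> m \<in> D} = measure P {\<omega> \<in> space P. concat_path \<omega> 0 \<in> D}"
proof -
  have "{\<omega> \<in> space P. concat_path \<omega> i \<in> D} = (\<lambda>\<omega>. concat_path \<omega> i) -` D \<inter> space P" for i by auto
  then have M: "{\<omega> \<in> space P. concat_path \<omega> i \<in> D} \<in> sets P" for i
    using measurable_sets[OF measurable_concat_path D] by simp
  have "{\<omega> \<in> space P. concat_path \<omega> m \<in> D} = (left_shift ^^ 1) -` {\<omega> \<in> space P. concat_path \<omega> 0 \<in> D} \<inter> space P"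
    using P.funpow_in_space[of _ 1] by (auto simp: concat_path_period)
  then show ?thesis using P.measure_vimage_funpow[OF M, of 1] by simp
qed

text \<open>Invariance: shifting raises the phase by one, and phase \<open>m\<close> has the
  distribution of phase 0. Ergodicity: an invariant set has the same preimage in \<open>P\<close> at
  every phase, and this preimage is invariant under the Bernoulli shift.\<close>

lemma tower_ergodic_measure: "tower_measure \<in> ergodic_measures A S"
proof -
  interpret T: prob_space tower_measure by (rule prob_space_tower)
  have meas: "left_shift \<in> tower_measure \<rightarrow>\<^sub>M tower_measure"
    using measurable_left_shift_B by (simp add: measurable_cong_sets[OF sets_tower sets_tower])
  let ?g = "\<lambda>D i. measure P {\<omega> \<in> space P. concat_path \<omega> i \<in> D}"
  have pre: "?g (left_shift -` D \<inter> space tower_measure) i = ?g D (Suc i)" for D i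
  proof -
    have "{\<omega> \<in> space P. concat_path \<omega> i \<in> left_shift -` D \<inter> space tower_measure} = {\<omega> \<in> space P. concat_path \<omega> (Suc i) \<in> D}"
      using concat_path_in_shift_space by (auto simp: space_tower left_shift_concat_path)
    then show ?thesis by simp
  qed
  have "distr tower_measure tower_measure left_shift = tower_measure"
  proof (rule measure_eqI)
    fix D assume "D \<in> sets (distr tower_measure tower_measure left_shift)"
    then have D: "D \<in> sets B" "D \<in> sets tower_measure" by (auto simp: sets_tower)
    let ?E = "left_shift -` D \<inter> space tower_measure"
    have E: "?E \<in> sets B" using measurable_sets[OF meas D(2)] by (simp add: sets_tower)
    have "measure tower_measure ?E = (\<Sum>i<m. ?g D (Suc i)) / m"
      by (simp only: measure_tower[OF E] pre)
    also have "(\<Sum>i<m. ?g D (Suc i)) = (\<Sum>i<m. ?g D i) + ?g D m - ?g D 0"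
      using sum.lessThan_Suc_shift[of "?g D" m] by simp
    also have "\<dots> = (\<Sum>i<m. ?g D i)" using measure_concat_path_period[OF D(1)] by simp
    also have "\<dots> / m = measure tower_measure D" by (rule measure_tower[OF D(1), symmetric])
    finally have "measure tower_measure ?E = measure tower_measure D" .
    then show "emeasure (distr tower_measure tower_measure left_shift) D = emeasure tower_measure D"
      using D(2) by (simp add: emeasure_distr[OF meas] T.emeasure_eq_measure)
  qed simp
  then have mp: "measure_preserving tower_measure left_shift" using meas by (simp add: measure_preserving_def)
  have "measure tower_measure D = 0 \<or> measure tower_measure D = 1"
    if D: "D \<in> sets tower_measure" "left_shift -` D \<inter> space tower_measure = D" for D
  proof -
    have DB: "D \<in> sets B" using D by (simp add: sets_tower)
    have eq: "?g D i = ?g D 0" for i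
    proof (induction i)
      case (Suc i)
      have "?g D (Suc i) = ?g D i" by (simp only: pre[symmetric] D(2))
      then show ?case using Suc by simp
    qed simp
    have 1: "measure tower_measure D = ?g D 0"
      unfolding measure_tower[OF DB] using m_pos by (subst eq) simp
    let ?D = "{\<omega> \<in> space P. concat_path \<omega> 0 \<in> D}"
    have "?D = (\<lambda>\<omega>. concat_path \<omega> 0) -` D \<inter> space P" by auto
    then have DM: "?D \<in> sets P" using measurable_sets[OF measurable_concat_path DB] by simp
    have step: "concat_path \<omega> (Suc i) \<in> D \<longleftrightarrow> concat_path \<omega> i \<in> D" if "\<omega> \<in> space P" for \<omega> i
    proof -
      have "concat_path \<omega> i \<in> left_shift -` D \<inter> space tower_measure \<longleftrightarrow> concat_path \<omega> i \<in> D" by (simp only: D(2))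
      then show ?thesis using concat_path_in_shift_space[OF that] by (simp add: left_shift_concat_path space_tower)
    qed
    have per: "concat_path \<omega> i \<in> D \<longleftrightarrow> concat_path \<omega> 0 \<in> D" if "\<omega> \<in> space P" for \<omega> i
      by (induction i) (use step[OF that] in auto)
    have "left_shift -` ?D \<inter> space P = ?D"
      using per[of _ m] P.funpow_in_space[of _ 1] by (auto simp: concat_path_period)
    then show ?thesis
      using bernoulli_ergodic[OF prob_space_W] DM 1 unfolding ergodic_def by auto
  qed
  then show ?thesis
    using mp T.prob_space_axioms by (auto simp: ergodic_measures_def ergodic_def sets_tower)
qed

sublocale tower: ergodic_shift A S tower_measure
  using countable_alphabet tower_ergodic_measure by unfold_locales

text \<open>\<open>E\<close> is contained in the product event that prescribes the words 1 to n - 1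
  of one of its points.\<close>

lemma measure_agree_on_window:
  fixes n :: nat
  assumes E: "E \<in> sets P" and agree: "\<And>\<omega> \<omega>' k. \<omega> \<in> E \<Longrightarrow> \<omega>' \<in> E \<Longrightarrow> k \<in> {1..<int n} \<Longrightarrow> \<omega> k = \<omega>' k"
  shows "measure P E \<le> (1 / card W) ^ (n - 1)"
proof (cases "E = {}")
  case False
  then obtain \<omega>0 where \<omega>0: "\<omega>0 \<in> E" by auto
  interpret W: prob_space "uniform_count_measure W" by (rule prob_space_W)
  interpret PP: product_prob_space "\<lambda>_::int. uniform_count_measure W" UNIV by unfold_locales
  let ?J = "{1..<int n}"
  have \<omega>0W: "\<omega>0 k \<in> W" for k using \<omega>0 sets.sets_into_space[OF E] space_P_D by auto
  have "E \<subseteq> {\<omega> \<in> space P. \<forall>k\<in>?J. \<omega> k \<in> {\<omega>0 k}}"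
    using agree[OF _ \<omega>0] sets.sets_into_space[OF E] by auto
  moreover have "{\<omega> \<in> space P. \<forall>k\<in>?J. \<omega> k \<in> {\<omega>0 k}} \<in> sets P"
  proof (rule sets.sets_Collect_finite_All)
      fix k
      have "{\<omega> \<in> space P. \<omega> k \<in> {\<omega>0 k}} = (\<lambda>\<omega>. \<omega> k) -` {\<omega>0 k} \<inter> space P" by auto
      also have "\<dots> \<in> sets P"
        by (rule measurable_sets[of _ _ "uniform_count_measure W"], rule measurable_component_singleton)
          (use \<omega>0W in \<open>auto simp: sets_uniform_count_measure\<close>)
      finally show "{\<omega> \<in> space P. \<omega> k \<in> {\<omega>0 k}} \<in> sets P" .
  qed simp
  ultimately have "emeasure P E \<le> emeasure P {\<omega> \<in> space P. \<forall>k\<in>?J. \<omega> k \<in> {\<omega>0 k}}"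
    by (rule emeasure_mono)
  also have "\<dots> = (\<Prod>k\<in>?J. emeasure (uniform_count_measure W) {\<omega>0 k})"
    by (rule PP.emeasure_PiM_Collect) (use \<omega>0W in \<open>auto simp: sets_uniform_count_measure\<close>)
  also have "\<dots> = (\<Prod>k\<in>?J. ennreal (1 / card W))"
    using \<omega>0W by (intro prod.cong refl) (simp add: emeasure_uniform_count_measure[OF finite_W])
  also have "\<dots> = ennreal ((1 / card W) ^ (n - 1))"
    by (simp add: ennreal_power nat_diff_distrib')
  finally show ?thesis by (simp add: P.emeasure_eq_measure)
qed simp

text \<open>The code records every symbol of the words, and at each phase an itinerary of length
  \<open>n * m\<close> shows the blocks 1 to n - 1 in full. So every itinerary has probability at
  most \<open>(1 / card W) ^ (n - 1)\<close>.\<close>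

lemma KS_entropy_tower: "ereal (ln (card W) / m) \<le> KS_entropy tower_measure left_shift"
proof -
  define F where "F = (\<Union>w\<in>W. set w)"
  have finF: "finite F" using finite_W by (auto simp: F_def)
  let ?X = "\<lambda>x::int \<Rightarrow> 'a. symbol_code F (x 0)"
  have X: "simple_function tower_measure ?X" by (rule tower.simple_coordinate[OF finF])
  have cW: "card W > 0" using finite_W W_nonempty by (simp add: card_gt_0_iff)
  have len: "length (\<omega> k) = m" if "\<omega> \<in> space P" for \<omega> k
    using space_P_D[OF that, of k] W_loops by (auto simp: loops_def)
  have inF: "concat_path \<omega> i j \<in> F" if "\<omega> \<in> space P" for \<omega> i j
  proof -
    have "nat ((j + int i) mod int m) < length (\<omega> ((j + int i) div int m))"
      using m_pos len[OF that] by (simp add: nat_less_iff)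
    then show ?thesis unfolding F_def concat_path_def by (intro UN_I[OF space_P_D[OF that, of "(j + int i) div int m"]] nth_mem)
  qed
  have lower: "(real n - 1) * ln (card W) \<le> ent tower_measure (tower.itin ?X (n * m))" if n: "n \<ge> 1" for n
  proof -
    let ?I = "tower.itin ?X (n * m)"
    have sI: "simple_function tower_measure ?I" by (rule tower.simple_itin[OF X])
    have "law tower_measure ?I v \<le> (1 / card W) ^ (n - 1)" for v
    proof -
      let ?D = "?I -` {v} \<inter> space tower_measure"
      have D: "?D \<in> sets B" using simple_functionD(2)[OF sI] by (simp add: sets_tower)
      have "measure P {\<omega> \<in> space P. concat_path \<omega> i \<in> ?D} \<le> (1 / card W) ^ (n - 1)" if i: "i < m" for i
      proof (rule measure_agree_on_window)
        have "{\<omega> \<in> space P. concat_path \<omega> i \<in> ?D} = (\<lambda>\<omega>. concat_path \<omega> i) -` ?D \<inter> space P" by auto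
        then show "{\<omega> \<in> space P. concat_path \<omega> i \<in> ?D} \<in> sets P"
          using measurable_sets[OF measurable_concat_path D] by simp
        fix \<omega> \<omega>' k assume \<omega>: "\<omega> \<in> {\<omega> \<in> space P. concat_path \<omega> i \<in> ?D}" "\<omega>' \<in> {\<omega> \<in> space P. concat_path \<omega> i \<in> ?D}"
          and k: "k \<in> {1..<int n}"
        have same: "concat_path \<omega> i (int j) = concat_path \<omega>' i (int j)" if "j < n * m" for j
        proof -
          have "?I (concat_path \<omega> i) j = ?I (concat_path \<omega>' i) j" using \<omega> by simp
          then show ?thesis
            using that inF[of \<omega> i "int j"] inF[of \<omega>' i "int j"] \<omega>
            by (simp add: tower.itin_def left_shift_funpow symbol_code_def)
        qed
        show "\<omega> k = \<omega>' k"
        proof (rule nth_equalityI)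
          show "length (\<omega> k) = length (\<omega>' k)" using \<omega> len by auto
          fix r assume "r < length (\<omega> k)"
          then have r: "r < m" using \<omega> len by auto
          \<comment> \<open>The time at which letter \<open>r\<close> of block \<open>k\<close> is
            read at phase \<open>i\<close>; it is nonnegative because \<open>k \<ge> 1\<close> and
            \<open>i < m\<close>, and below \<open>n * m\<close> because
            \<open>k < n\<close>.\<close>
          let ?j = "nat (k * int m + int r - int i)"
          have "1 * int m \<le> k * int m" using k by (intro mult_right_mono) auto
          then have j: "int ?j + int i = k * int m + int r" using i by linarith
          have "k * int m \<le> (int n - 1) * int m" using k by (intro mult_right_mono) auto
          then have "int ?j < int n * int m" using j r i by (simp add: algebra_simps)
          then have "int ?j < int (n * m)" by (simp only: of_nat_mult)
          then have "?j < n * m" by (simp only: of_nat_less_iff)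
          moreover have "(int ?j + int i) div int m = k" "(int ?j + int i) mod int m = int r"
            unfolding j using r by auto
          ultimately show "\<omega> k ! r = \<omega>' k ! r"
            using same[of ?j] by (simp only: concat_path_def nat_int)
        qed
      qed
      then have "(\<Sum>i<m. measure P {\<omega> \<in> space P. concat_path \<omega> i \<in> ?D}) \<le> (\<Sum>i<m. (1 / card W) ^ (n - 1))"
        by (intro sum_mono) auto
      then show ?thesis
        unfolding law_def measure_tower[OF D] using m_pos by (simp add: field_simps)
    qed
    then have "- ln ((1 / card W) ^ (n - 1)) \<le> ent tower_measure ?I"
      using cW by (intro tower.ent_lower_bound sI) auto
    then show ?thesis using cW n by (simp add: ln_realpow ln_div of_nat_diff)
  qed
  have "ln (card W) / m \<le> tower.entropy_rate ?X"
  proof (rule LIMSEQ_le)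
    have "(\<lambda>n. ln (card W) / m - ln (card W) / m * (1 / real n)) \<longlonglongrightarrow> ln (card W) / m - ln (card W) / m * 0"
      by (intro tendsto_intros lim_1_over_n)
    then show "(\<lambda>n. ln (card W) / m - ln (card W) / m * (1 / real n)) \<longlonglongrightarrow> ln (card W) / m" by simp
    have "strict_mono (\<lambda>n. n * m)" using m_pos by (simp add: strict_mono_def)
    from LIMSEQ_subseq_LIMSEQ[OF tower.entropy_rate_limit[OF X] this]
    show "(\<lambda>n. ent tower_measure (tower.itin ?X (n * m)) / real (n * m)) \<longlonglongrightarrow> tower.entropy_rate ?X"
      by (simp add: o_def)
    show "\<exists>N. \<forall>n\<ge>N. ln (card W) / m - ln (card W) / m * (1 / real n) \<le> ent tower_measure (tower.itin ?X (n * m)) / real (n * m)"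
    proof (intro exI allI impI)
      fix n :: nat assume n: "n \<ge> 1"
      have "ln (card W) / m - ln (card W) / m * (1 / real n) = (real n - 1) * ln (card W) / real (n * m)"
        using n m_pos by (simp add: field_simps)
      also have "\<dots> \<le> ent tower_measure (tower.itin ?X (n * m)) / real (n * m)"
        by (intro divide_right_mono lower n) simp
      finally show "ln (card W) / m - ln (card W) / m * (1 / real n) \<le> ent tower_measure (tower.itin ?X (n * m)) / real (n * m)" .
    qed
  qed
  then show ?thesis using tower.entropy_rate_le_KS[OF X] by (meson ereal_less_eq(3) order_trans)
qed

end

text \<open>The tower bounds each finite nonempty set of loops, and an infinite set of loops would
  contain finite ones of any size; so finiteness comes with the bound. Length 0 is separate because
  a tower needs \<open>m > 0\<close>.\<close>

lemma loops_bound: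
  assumes "countable A" and h: "top_entropy A S \<le> ereal h"
  shows "finite (loops A S a m) \<and> real (card (loops A S a m)) \<le> exp (h * m)"
proof (cases "m = 0")
  case True
  then have "loops A S a m = {[]}" by (auto simp: loops_def)
  then show ?thesis using True by simp
next
  case False
  have bound: "real (card W) \<le> exp (h * m)" if W: "W \<subseteq> loops A S a m" "finite W" "W \<noteq> {}" for W
  proof -
    interpret loop_tower A S a m W using W False assms(1) by unfold_locales auto
    have "KS_entropy tower_measure left_shift \<le> top_entropy A S"
      unfolding top_entropy_def by (rule SUP_upper[OF tower_ergodic_measure])
    then have "ereal (ln (card W) / m) \<le> ereal h" using KS_entropy_tower h by (meson order_trans)
    then have "ln (card W) \<le> h * m" using False by (simp add: field_simps)
    then show ?thesis
      using W by (metis card_gt_0_iff exp_le_cancel_iff exp_ln of_nat_0_less_iff)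
  qed
  have fin: "finite (loops A S a m)"
  proof (rule ccontr)
    assume "infinite (loops A S a m)"
    then obtain W where W: "W \<subseteq> loops A S a m" "finite W" "card W = Suc (nat \<lceil>exp (h * m)\<rceil>)"
      using infinite_arbitrarily_large by blast
    then have "W \<noteq> {}" by auto
    from bound[OF W(1,2) this] W(3) show False by linarith
  qed
  then show ?thesis using bound[OF subset_refl fin] by (cases "loops A S a m = {}") auto
qed

section \<open>Excursions from a symbol\<close>

text \<open>\<open>Z\<close> is the set of times in \<open>{..<n}\<close> at which a path visits a given symbol.\<close>

definition boundary_times :: "nat \<Rightarrow> nat set \<Rightarrow> nat set" where
  "boundary_times n Z = {i\<in>{..<n}. \<not> ((\<exists>p\<in>Z. p \<le> i) \<and> (\<exists>q\<in>Z. i < q))}"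

text \<open>If some pair of visits around \<open>i\<close> is within distance \<open>L\<close>, then
  so are the neighbouring visits around \<open>i\<close>. Hence these are the times inside complete
  excursions longer than \<open>L\<close>.\<close>

definition long_times :: "nat \<Rightarrow> nat \<Rightarrow> nat set \<Rightarrow> nat set" where
  "long_times L n Z = {i\<in>{..<n}. (\<exists>p\<in>Z. p \<le> i) \<and> (\<exists>q\<in>Z. i < q) \<and> \<not> (\<exists>p\<in>Z. \<exists>q\<in>Z. p \<le> i \<and> i < q \<and> q \<le> p + L)}"

lemma finite_times [simp]: "finite (boundary_times n Z)" "finite (long_times L n Z)"
  by (auto simp: boundary_times_def long_times_def)

text \<open>Between consecutive visits the times are all long or all short, so the long times can be
  left only at a visit; the entry lemma below is the mirror image.\<close>

lemma long_times_exit: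
  assumes Z: "Z \<subseteq> {..<n}" and i: "i \<in> long_times L n Z" and exit: "Suc i \<notin> long_times L n Z"
  shows "Suc i \<in> Z"
proof (rule ccontr)
  assume nin: "Suc i \<notin> Z"
  obtain p q where pq: "p \<in> Z" "p \<le> i" "q \<in> Z" "i < q" using i by (auto simp: long_times_def)
  then have "Suc i < q" using nin by (metis Suc_lessI)
  then have "Suc i < n" using Z pq by auto
  then obtain p' q' where "p' \<in> Z" "q' \<in> Z" "p' \<le> Suc i" "Suc i < q'" "q' \<le> p' + L"
    using exit pq \<open>Suc i < q\<close> by (auto simp: long_times_def intro: le_SucI)
  moreover from this have "p' \<le> i" using nin by (metis le_SucE)
  ultimately show False using i by (auto simp: long_times_def dest: Suc_lessD)
qed

lemma long_times_entry:
  assumes i: "i \<in> long_times L n Z" and nin: "i \<notin> Z"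
  obtains j where "i = Suc j" "j \<in> long_times L n Z"
proof -
  obtain p q where pq: "p \<in> Z" "p \<le> i" "q \<in> Z" "i < q" using i by (auto simp: long_times_def)
  then have "p < i" using nin by (metis le_neq_implies_less)
  then obtain j where j: "i = Suc j" by (metis less_imp_Suc_add)
  have "p \<le> j" "j < q" using \<open>p < i\<close> pq j by auto
  moreover have "False" if "p' \<in> Z" "q' \<in> Z" "p' \<le> j" "j < q'" "q' \<le> p' + L" for p' q'
  proof -
    have "q' \<noteq> i" using that nin by auto
    then have "p' \<le> i" "i < q'" using that j by auto
    then show False using that i by (auto simp: long_times_def)
  qed
  moreover have "j < n" using i j by (simp add: long_times_def)
  ultimately have "j \<in> long_times L n Z" using pq(1,3) unfolding long_times_def by blast
  then show ?thesis using that j by auto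
qed

text \<open>Deleting from a path everything outside the long excursions from \<open>a\<close> leaves a loop at \<open>a\<close>, since
  each excursion starts and ends at \<open>a\<close>.\<close>

lemma long_times_loop:
  fixes x :: "nat \<Rightarrow> 'a"
  assumes A: "\<And>i. x i \<in> A" and S: "\<And>i. S (x i) (x (Suc i)) = 1"
    and Z: "Z = {i\<in>{..<n}. x i = a}"
  shows "map x (sorted_list_of_set (long_times L n Z)) \<in> loops A S a (card (long_times L n Z))"
proof -
  let ?l = "long_times L n Z"
  define js where "js = sorted_list_of_set ?l"
  have set: "set js = ?l" and len: "length js = card ?l" and sorted: "sorted_wrt (<) js"
    by (auto simp: js_def)
  have Zn: "Z \<subseteq> {..<n}" using Z by auto
  have less: "js ! i < js ! j" if "i < j" "j < length js" for i j
    using sorted that by (simp add: sorted_wrt_iff_nth_less)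
  have mono_iff: "js ! i < js ! j \<longleftrightarrow> i < j" if "i < length js" "j < length js" for i j
    using less[of i j] less[of j i] that by (metis linorder_neqE_nat order_less_asym)
  have between: "False" if b: "Suc i < length js" "js ! i < j" "j < js ! Suc i" "j \<in> ?l" for i j
  proof -
    obtain k where k: "k < length js" "j = js ! k" using b(4) set by (metis in_set_conv_nth)
    then have "i < k" "k < Suc i" using mono_iff[of i k] mono_iff[of k "Suc i"] b by auto
    then show False by simp
  qed
  have mem: "js ! i \<in> ?l" if "i < length js" for i using nth_mem[OF that] unfolding set .
  have start: "x (js ! 0) = a" if ne: "js \<noteq> []"
  proof (rule ccontr)
    assume "x (js ! 0) \<noteq> a"
    then have "js ! 0 \<notin> Z" using Z by auto
    then obtain j where j: "js ! 0 = Suc j" "j \<in> ?l" using long_times_entry[OF mem[of 0]] ne by auto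
    then obtain k where k: "k < length js" "j = js ! k" using set by (metis in_set_conv_nth)
    then show False using j mono_iff[of k 0] ne by auto
  qed
  have step: "S (x (js ! i)) ((map x js @ [a]) ! Suc i) = 1" if i: "i < length js" for i
  proof (cases "Suc i < length js")
    case True
    have lt: "js ! i < js ! Suc i" using less[of i "Suc i"] True by simp
    \<comment> \<open>Either the next long time follows at once, or a gap is skipped. A gap begins
      and ends at a visit, so the symbol after \<open>js ! i\<close> and the symbol at
      \<open>js ! Suc i\<close> are both \<open>a\<close>, and the deletion preserves the
      transition.\<close>
    have "x (js ! Suc i) = x (Suc (js ! i))"
    proof (cases "Suc (js ! i) \<in> ?l")
      case True
      then have "js ! Suc i = Suc (js ! i)"
        using between[of i "Suc (js ! i)"] \<open>Suc i < length js\<close> lt by (metis Suc_lessI lessI)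
      then show ?thesis by simp
    next
      case False
      then have 1: "Suc (js ! i) \<in> Z" using long_times_exit[OF Zn mem[OF i]] by auto
      have "js ! Suc i \<in> Z"
      proof (rule ccontr)
        assume "js ! Suc i \<notin> Z"
        then obtain j where j: "js ! Suc i = Suc j" "j \<in> ?l" using long_times_entry[OF mem[OF True]] by auto
        then have "j \<noteq> js ! i" using False mem[OF True] by metis
        then show False using between[OF True, of j] j lt by auto
      qed
      then show ?thesis using 1 Z by auto
    qed
    then show ?thesis using True S[of "js ! i"] by (simp add: nth_append)
  next
    case False
    have "Suc (js ! i) \<notin> ?l"
    proof
      assume "Suc (js ! i) \<in> ?l"
      then obtain k where k: "k < length js" "Suc (js ! i) = js ! k" using set by (metis in_set_conv_nth)
      then have "i < k" using mono_iff[OF i k(1)] by auto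
      then show False using False k by auto
    qed
    then have "x (Suc (js ! i)) = a" using long_times_exit[OF Zn mem[OF i]] Z by auto
    then show ?thesis using False i S[of "js ! i"] by (simp add: nth_append)
  qed
  have "(map x js @ [a]) ! 0 = a" using start by (cases js) auto
  then show ?thesis
    using step A len unfolding js_def[symmetric] loops_def by auto
qed

definition short_excursion_set :: "'a set \<Rightarrow> ('a \<Rightarrow> 'a \<Rightarrow> nat) \<Rightarrow> 'a \<Rightarrow> nat \<Rightarrow> (int \<Rightarrow> 'a) set" where
  "short_excursion_set A S a L = {x \<in> shift_space A S.
     \<exists>p q. p \<le> 0 \<and> 0 < q \<and> q \<le> p + int L \<and> x p = a \<and> x q = a}"

text \<open>The visits \<open>p\<close> and \<open>q\<close> are within distance \<open>L\<close> of
  time 0, so the set is clopen and its measure passes to the limit.\<close>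

lemma short_excursion_window_set: "short_excursion_set A S a L \<in> window_sets A S id"
proof (rule window_setsI[where k = "int L"])
  fix x y assume x: "x \<in> short_excursion_set A S a L" and y: "y \<in> shift_space A S"
    and eq: "\<And>i. \<bar>i\<bar> \<le> int L \<Longrightarrow> id (x i) = id (y i)"
  obtain p q where pq: "p \<le> 0" "0 < q" "q \<le> p + int L" "x p = a" "x q = a"
    using x by (auto simp: short_excursion_set_def)
  then have "y p = a" "y q = a" using eq[of p] eq[of q] by auto
  then show "y \<in> short_excursion_set A S a L" using pq y by (auto simp: short_excursion_set_def)
qed (auto simp: short_excursion_set_def)

section \<open>Entropy missed by the finite code\<close>

lemma sum_le_linear_if_tendsto_0:
  fixes c :: "nat \<Rightarrow> real" and e :: real
  assumes "c \<longlonglongrightarrow> 0" "\<And>k. c k \<le> 1" "e > 0"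
  obtains C where "\<And>n. (\<Sum>k<n. c k) \<le> n * e + C"
proof -
  have "eventually (\<lambda>k. c k < e) sequentially" using order_tendstoD(2)[OF assms(1,3)] .
  then obtain K where K: "\<And>k. k \<ge> K \<Longrightarrow> c k < e" by (auto simp: eventually_sequentially)
  have "(\<Sum>k<n. c k) \<le> n * e + K" for n
  proof -
    have "(\<Sum>k<n. c k) \<le> (\<Sum>k<n. e + (if k < K then 1 else 0))"
      using K assms(2,3) by (intro sum_mono) (auto simp: not_less less_imp_le intro: order_trans[of _ 1])
    also have "\<dots> = n * e + card {k. k < n \<and> k < K}"
      by (simp add: sum.distrib sum.If_cases Int_def)
    also have "card {k. k < n \<and> k < K} \<le> card {..<K}" by (intro card_mono) auto
    finally show ?thesis by simp
  qed
  then show ?thesis using that by blast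
qed

text \<open>\<open>M\<close> will be a member of the approximating sequence, while \<open>L\<close>
  is fixed beforehand from the limit measure and \<open>C\<close> from the loops; hence these data
  enter as parameters.\<close>

locale excursion_code = ergodic_shift +
  fixes a :: 'a and C :: "'a set" and L :: nat and h :: real
  assumes a_pos: "measure M {x \<in> shift_space A S. x 0 = a} > 0"
    and finite_C: "finite C" and a_C: "a \<in> C"
    and short_loops: "\<And>m w. m \<le> L \<Longrightarrow> w \<in> loops A S a m \<Longrightarrow> set w \<subseteq> C"
    and finite_loops: "\<And>m. finite (loops A S a m)"
    and card_loops: "\<And>m. real (card (loops A S a m)) \<le> exp (h * m)"
    and h_nonneg: "0 \<le> h"
begin

abbreviation "code F \<equiv> (\<lambda>x :: int \<Rightarrow> 'a. symbol_code F (x 0))"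

text \<open>Computed from the coarse itinerary instead of the point, so that boundary and long times
  are functions of the coarse code alone.\<close>

definition visits :: "nat \<Rightarrow> (nat \<Rightarrow> 'a option) \<Rightarrow> nat set" where
  "visits n w = {i\<in>{..<n}. w i = Some a}"

lemma itin_code: "i < n \<Longrightarrow> itin (code F) n x i = symbol_code F (x (int i))"
  by (simp add: itin_def left_shift_funpow)

lemma visits_itin: "visits n (itin (code C) n x) = {i\<in>{..<n}. x (int i) = a}"
  unfolding visits_def using a_C
  by (intro Collect_cong conj_cong refl) (subst itin_code, auto simp: symbol_code_def)

text \<open>The word from \<open>p\<close> up to \<open>q - 1\<close> is a loop of length at most
  \<open>L\<close>, so \<open>short_loops\<close> applies.\<close>

lemma short_excursion_in_C:
  assumes x: "x \<in> shift_space A S" and pq: "p \<le> i" "i < q" "q \<le> p + L" "x (int p) = a" "x (int q) = a"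
  shows "x (int i) \<in> C"
proof -
  let ?w = "map (\<lambda>j. x (int j)) [p..<q]"
  have "?w \<in> loops A S a (q - p)"
    unfolding loops_def
  proof (intro CollectI conjI allI impI)
    show "set ?w \<subseteq> A" using x by (auto simp: shift_space_def)
    show "(?w @ [a]) ! 0 = a" using pq by (simp add: nth_append)
    fix j assume j: "j < q - p"
    have "S (x (int (p + j))) (x (int (p + j) + 1)) = 1" using x by (auto simp: shift_space_def)
    moreover have "(?w @ [a]) ! Suc j = x (int (p + j) + 1)"
    proof (cases "Suc j < q - p")
      case False
      then have "q = p + j + 1" using j by simp
      then show ?thesis using pq(5) by (simp add: nth_append add_ac)
    qed (simp add: nth_append add_ac)
    ultimately show "S (?w ! j) ((?w @ [a]) ! Suc j) = 1" using j by simp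
  qed simp
  moreover have "q - p \<le> L" using pq by simp
  ultimately have "set ?w \<subseteq> C" using short_loops by blast
  then show ?thesis using pq by auto
qed

text \<open>The coarse itinerary \<open>w\<close> determines the boundary, long and short times. A
  boundary time leaves at most \<open>Suc (card F)\<close> choices, the long times together spell
  one loop, and at a short time the symbol lies in \<open>C\<close> and is already recorded in
  \<open>w\<close>.\<close>

lemma card_refinements:
  assumes F: "finite F" "C \<subseteq> F"
  shows "real (card {u \<in> itin (code F) n ` space M. \<exists>x\<in>space M. itin (code F) n x = u \<and> itin (code C) n x = w})
    \<le> real (Suc (card F)) ^ card (boundary_times n (visits n w)) * exp (h * card (long_times L n (visits n w)))"
proof -
  let ?U = "{u \<in> itin (code F) n ` space M. \<exists>x\<in>space M. itin (code F) n x = u \<and> itin (code C) n x = w}"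
  let ?b = "boundary_times n (visits n w)" and ?l = "long_times L n (visits n w)"
  let ?js = "sorted_list_of_set ?l"
  \<comment> \<open>Itineraries merge the symbols outside \<open>F\<close>, but a loop consists of
    actual symbols; so a point is chosen for each itinerary.\<close>
  define pt where "pt u = (SOME x. x \<in> space M \<and> itin (code F) n x = u \<and> itin (code C) n x = w)" for u
  have pt: "pt u \<in> space M" "itin (code F) n (pt u) = u" "itin (code C) n (pt u) = w" if "u \<in> ?U" for u
  proof -
    have "\<exists>x. x \<in> space M \<and> itin (code F) n x = u \<and> itin (code C) n x = w" using that by auto
    from someI_ex[OF this] show "pt u \<in> space M" "itin (code F) n (pt u) = u" "itin (code C) n (pt u) = w"
      unfolding pt_def by auto
  qed
  define \<phi> where "\<phi> u = (restrict u ?b, map (\<lambda>i. pt u (int i)) ?js)" for u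
  let ?V = "insert None (Some ` F)"
  let ?T = "(PiE ?b (\<lambda>_. ?V)) \<times> loops A S a (card ?l)"
  have Zeq: "visits n w = {i\<in>{..<n}. pt u (int i) = a}" if "u \<in> ?U" for u
    using visits_itin[of n "pt u"] pt(3)[OF that] by simp
  have bn: "?b \<subseteq> {..<n}" by (auto simp: boundary_times_def)
  have "\<phi> ` ?U \<subseteq> ?T"
  proof (rule image_subsetI)
    fix u assume u: "u \<in> ?U"
    have "u i \<in> ?V" if "i \<in> ?b" for i
    proof -
      have "i < n" using that bn by auto
      then show ?thesis using itin_code[of i n F "pt u"] pt(2)[OF u] by (auto simp: symbol_code_def)
    qed
    then have 1: "restrict u ?b \<in> PiE ?b (\<lambda>_. ?V)" by auto
    have sp: "pt u \<in> shift_space A S" using pt(1)[OF u] by (simp add: space_M)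
    have "map (\<lambda>i. pt u (int i)) ?js \<in> loops A S a (card ?l)"
    proof (rule long_times_loop[OF _ _ Zeq[OF u]])
      fix i show "pt u (int i) \<in> A" using sp by (auto simp: shift_space_def)
      have "S (pt u (int i)) (pt u (int i + 1)) = 1" using sp by (auto simp: shift_space_def)
      then show "S (pt u (int i)) (pt u (int (Suc i))) = 1" by (simp add: add_ac)
    qed
    with 1 show "\<phi> u \<in> ?T" by (simp add: \<phi>_def)
  qed
  moreover have "inj_on \<phi> ?U"
  proof (rule inj_onI)
    fix u u' assume u: "u \<in> ?U" "u' \<in> ?U" and eq: "\<phi> u = \<phi> u'"
    have "u i = u' i" for i
    proof -
      consider "i \<in> ?b" | "i \<in> ?l" | "i < n" "i \<notin> ?b" "i \<notin> ?l" | "\<not> i < n" by blast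
      then show ?thesis
      proof cases
        case 1
        then show ?thesis using fun_cong[OF arg_cong[OF eq, of fst], of i] by (simp add: \<phi>_def)
      next
        case 2
        then have "pt u (int i) = pt u' (int i)" using arg_cong[OF eq, of snd] by (simp add: \<phi>_def)
        moreover have "i < n" using 2 by (simp add: long_times_def)
        ultimately show ?thesis
          using itin_code[of i n F "pt u"] itin_code[of i n F "pt u'"] pt(2)[OF u(1)] pt(2)[OF u(2)] by simp
      next
        case 3
        then obtain p q where pq: "p \<in> visits n w" "q \<in> visits n w" "p \<le> i" "i < q" "q \<le> p + L"
          by (auto simp: boundary_times_def long_times_def)
        have inC: "pt v (int i) \<in> C" if v: "v \<in> ?U" for v
          by (rule short_excursion_in_C[of _ p _ q]) (use pq Zeq[OF v] pt(1)[OF v] space_M in auto)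
        have "symbol_code C (pt u (int i)) = symbol_code C (pt u' (int i))"
          using itin_code[OF 3(1), of C "pt u"] itin_code[OF 3(1), of C "pt u'"] pt(3)[OF u(1)] pt(3)[OF u(2)] by simp
        then have "pt u (int i) = pt u' (int i)" using inC[OF u(1)] inC[OF u(2)] by (simp add: symbol_code_def)
        then show ?thesis
          using itin_code[OF 3(1), of F "pt u"] itin_code[OF 3(1), of F "pt u'"] pt(2)[OF u(1)] pt(2)[OF u(2)] by simp
      next
        case 4
        have "itin (code F) n x i = undefined" for x using 4 by (simp add: itin_def)
        then show ?thesis using pt(2)[OF u(1)] pt(2)[OF u(2)] by metis
      qed
    qed
    then show "u = u'" by auto
  qed
  moreover have "finite ?T" using F(1) finite_loops by (intro finite_cartesian_product finite_PiE) auto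
  ultimately have "card ?U \<le> card ?T" by (intro card_inj_on_le)
  also have "card ?T = card ?V ^ card ?b * card (loops A S a (card ?l))"
    by (simp add: card_cartesian_product card_PiE)
  also have "card ?V = Suc (card F)" using F(1) by (simp add: card_image)
  finally have "real (card ?U) \<le> real (Suc (card F)) ^ card ?b * real (card (loops A S a (card ?l)))"
    by (simp flip: of_nat_mult of_nat_power add: of_nat_le_iff del: of_nat_Suc)
  also have "\<dots> \<le> real (Suc (card F)) ^ card ?b * exp (h * card ?l)"
    by (intro mult_left_mono card_loops) simp
  finally show ?thesis .
qed

text \<open>Gibbs inequality with the weight of a fine itinerary equal to the law of its coarse one
  divided by the bound \<open>c\<close> on the number of refinements; \<open>ln c\<close> is linear
  in the two counts.\<close>

lemma ent_refinement:
  assumes F: "finite F" "C \<subseteq> F"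
  shows "ent M (itin (code F) n) \<le> ent M (itin (code C) n)
    + expectation (\<lambda>x. real (card (boundary_times n {i\<in>{..<n}. x (int i) = a}))) * ln (Suc (card F))
    + expectation (\<lambda>x. real (card (long_times L n {i\<in>{..<n}. x (int i) = a}))) * h"
proof -
  let ?X = "itin (code F) n" and ?Y = "itin (code C) n"
  note sX = simple_itin[OF simple_coordinate[OF F(1), of 0], of n]
  note sY = simple_itin[OF simple_coordinate[OF finite_C, of 0], of n]
  let ?b = "\<lambda>w. card (boundary_times n (visits n w))" and ?l = "\<lambda>w. card (long_times L n (visits n w))"
  let ?K = "real (Suc (card F))"
  define coarse where "coarse u = (\<lambda>i\<in>{..<n}. case u i of None \<Rightarrow> None | Some s \<Rightarrow> symbol_code C s)" for u :: "nat \<Rightarrow> 'a option"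
  have coarse: "coarse (?X x) = ?Y x" for x
    using F(2) by (auto simp: coarse_def itin_def fun_eq_iff symbol_code_def)
  define c where "c w = ?K ^ ?b w * exp (h * ?l w)" for w
  have c: "c w > 0" for w by (simp add: c_def)
  define q where "q u = law M ?Y (coarse u) / c (coarse u)" for u
  have pos: "0 < law M ?Y (coarse u)" if "0 < law M ?X u" for u
  proof -
    have "law M ?X u \<le> law M ?Y (coarse u)" using coarse by (intro law_mono sY) auto
    then show ?thesis using that by simp
  qed
  have fin: "finite (?X ` space M)" "finite (?Y ` space M)" using sX sY by (auto dest: simple_functionD)
  have "(\<Sum>u\<in>?X ` space M. q u) = (\<Sum>w\<in>?Y ` space M. \<Sum>u\<in>{u\<in>?X ` space M. coarse u = w}. q u)"
    by (rule sum.group[symmetric]) (use fin coarse in auto)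
  also have "\<dots> \<le> (\<Sum>w\<in>?Y ` space M. law M ?Y w)"
  proof (rule sum_mono)
    fix w assume "w \<in> ?Y ` space M"
    have "{u\<in>?X ` space M. coarse u = w} = {u\<in>?X ` space M. \<exists>x\<in>space M. ?X x = u \<and> ?Y x = w}"
    proof (intro Collect_cong conj_cong refl iffI)
      fix u assume "u \<in> ?X ` space M"
      then obtain y where y: "y \<in> space M" "u = ?X y" by auto
      show "\<exists>x\<in>space M. ?X x = u \<and> ?Y x = w" if "coarse u = w"
        using y that coarse[of y] by auto
      show "coarse u = w" if "\<exists>x\<in>space M. ?X x = u \<and> ?Y x = w"
        using that coarse by blast
    qed
    then have "real (card {u\<in>?X ` space M. coarse u = w}) \<le> c w"
      unfolding c_def using card_refinements[OF F, of n w] by simp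
    then have "real (card {u\<in>?X ` space M. coarse u = w}) * (law M ?Y w / c w) \<le> c w * (law M ?Y w / c w)"
      using c[of w] by (intro mult_right_mono divide_nonneg_pos law_nonneg)
    moreover have "(\<Sum>u\<in>{u\<in>?X ` space M. coarse u = w}. q u) = (\<Sum>u\<in>{u\<in>?X ` space M. coarse u = w}. law M ?Y w / c w)"
      by (rule sum.cong) (auto simp: q_def)
    ultimately show "(\<Sum>u\<in>{u\<in>?X ` space M. coarse u = w}. q u) \<le> law M ?Y w" using c[of w] by simp
  qed
  also have "\<dots> = 1" by (rule sum_law[OF sY])
  finally have "ent M ?X \<le> expectation (\<lambda>x. - ln (q (?X x)))"
    by (intro gibbs sX) (auto simp: q_def c less_imp_le pos)
  also have "\<dots> = (\<Sum>u\<in>?X ` space M. law M ?X u * - ln (q u))" by (rule simple_expectation[OF sX])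
  also have "\<dots> = (\<Sum>u\<in>?X ` space M. law M ?X u * (- ln (law M ?Y (coarse u)) + ln (c (coarse u))))"
  proof (intro sum.cong refl)
    fix u
    show "law M ?X u * - ln (q u) = law M ?X u * (- ln (law M ?Y (coarse u)) + ln (c (coarse u)))"
    proof (cases "law M ?X u = 0")
      case False
      then have "0 < law M ?X u" by (simp add: less_le)
      from pos[OF this] c[of "coarse u"] show ?thesis by (simp add: q_def ln_div)
    qed simp
  qed
  also have "\<dots> = expectation (\<lambda>x. - ln (law M ?Y (?Y x)) + ln (c (?Y x)))"
    by (subst simple_expectation(2)[OF sX, symmetric]) (simp add: coarse)
  also have "\<dots> = expectation (\<lambda>x. - ln (law M ?Y (?Y x)) + (real (?b (?Y x)) * ln ?K + real (?l (?Y x)) * h))"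
    by (intro Bochner_Integration.integral_cong refl) (simp add: c_def ln_mult ln_realpow)
  also have "\<dots> = ent M ?Y + (expectation (\<lambda>x. real (?b (?Y x))) * ln ?K + expectation (\<lambda>x. real (?l (?Y x))) * h)"
  proof -
    note int = simple_expectation(1)[OF sY, of "\<lambda>w. - ln (law M ?Y w)"] simple_expectation(1)[OF sY, of "\<lambda>w. real (?b w)"]
      simple_expectation(1)[OF sY, of "\<lambda>w. real (?l w)"]
    show ?thesis
      unfolding ent_expectation[OF sY] using int
      by (subst Bochner_Integration.integral_add | simp)+
  qed
  finally show ?thesis by (simp add: visits_itin)
qed

lemma expectation_card_le:
  fixes n :: nat
  assumes X: "simple_function M X" and sub: "\<And>x. x \<in> space M \<Longrightarrow> g (X x) \<subseteq> {i\<in>{..<n}. x \<in> E i}"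
    and E: "\<And>i. i < n \<Longrightarrow> E i \<in> sets M"
  shows "expectation (\<lambda>x. real (card (g (X x)))) \<le> (\<Sum>i<n. measure M (E i))"
proof -
  have "expectation (\<lambda>x. real (card (g (X x)))) \<le> expectation (\<lambda>x. \<Sum>i<n. indicator (E i) x)"
  proof (rule integral_mono)
    show "integrable M (\<lambda>x. real (card (g (X x))))" by (rule simple_expectation(1)[OF X])
    show "integrable M (\<lambda>x. \<Sum>i<n. indicator (E i) x :: real)"
      using E by (intro Bochner_Integration.integrable_sum integrable_real_indicator) (auto simp: emeasure_eq_measure)
    fix x assume x: "x \<in> space M"
    have "card (g (X x)) \<le> card {i\<in>{..<n}. x \<in> E i}"
      by (rule card_mono[OF _ sub[OF x]], rule finite_subset[OF _ finite_lessThan[of n]]) auto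
    also have "real \<dots> = (\<Sum>i<n. indicator (E i) x)"
      by (simp add: indicator_def sum.If_cases Int_def)
    finally show "real (card (g (X x))) \<le> (\<Sum>i<n. indicator (E i) x)" by simp
  qed
  also have "\<dots> = (\<Sum>i<n. measure M (E i))"
    using E by (subst Bochner_Integration.integral_sum) (auto intro!: integrable_real_indicator simp: emeasure_eq_measure)
  finally show ?thesis .
qed

definition avoiding :: "nat \<Rightarrow> (int \<Rightarrow> 'a) set" where
  "avoiding k = {x \<in> shift_space A S. \<forall>j<k. x (int j) \<noteq> a}"

lemma avoiding_measurable: "avoiding k \<in> sets M"
  unfolding avoiding_def by (rule window_set_measurable[of _ id], rule window_setsI[where k = "int k"]) auto

text \<open>The intersection consists of the points without a visit at a nonnegative time, a null
  set by recurrence.\<close>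

lemma measure_avoiding_tendsto_0: "(\<lambda>k. measure M (avoiding k)) \<longlonglongrightarrow> 0"
proof -
  have "(\<lambda>k. measure M (avoiding k)) \<longlonglongrightarrow> measure M (\<Inter>k. avoiding k)"
  proof (rule finite_Lim_measure_decseq)
    show "range avoiding \<subseteq> sets M" using avoiding_measurable by blast
    show "decseq avoiding"
      unfolding decseq_def
    proof (intro allI impI subsetI)
      fix m n :: nat and x assume "m \<le> n" "x \<in> avoiding n"
      then have "x \<in> shift_space A S" "x (int j) \<noteq> a" if "j < m" for j
        using less_le_trans[OF that] by (auto simp: avoiding_def)
      with \<open>x \<in> avoiding n\<close> show "x \<in> avoiding m" by (simp add: avoiding_def)
    qed
  qed
  moreover have "(\<Inter>k. avoiding k) = space M - {x \<in> shift_space A S. \<exists>i\<ge>0. x i = a}"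
  proof -
    have "(\<exists>i\<ge>0. x i = a) \<longleftrightarrow> (\<exists>k. \<exists>j<k. x (int j) = a)" for x :: "int \<Rightarrow> 'a"
    proof
      assume "\<exists>i\<ge>0. x i = a"
      then obtain i where "i \<ge> 0" "x i = a" by auto
      then have "x (int (nat i)) = a" by simp
      then show "\<exists>k. \<exists>j<k. x (int j) = a" by blast
    qed (use of_nat_0_le_iff in blast)
    then show ?thesis by (auto simp: avoiding_def space_M)
  qed
  \<comment> \<open>A non-measurable set would have measure 0, so the value 1 given by recurrence
    already yields measurability.\<close>
  moreover have "{x \<in> shift_space A S. \<exists>i\<ge>0. x i = a} \<in> sets M"
    using recurrence(1)[OF a_pos, of 0] measure_notin_sets by fastforce
  ultimately show ?thesis using prob_compl recurrence(1)[OF a_pos, of 0] by simp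
qed

text \<open>By stationarity the expected number of long times is at most \<open>n\<close> times the
  measure of the clopen set. The expected number of boundary times is o(n) by recurrence, so
  \<open>ln (Suc (card F))\<close> leaves no trace in the rate and the bound is uniform in
  \<open>F\<close>.\<close>

lemma entropy_rate_refinement:
  assumes F: "finite F" "C \<subseteq> F"
  shows "entropy_rate (code F) \<le> entropy_rate (code C) + h * measure M (shift_space A S - short_excursion_set A S a L)"
proof -
  let ?G = "shift_space A S - short_excursion_set A S a L"
  have G: "?G \<in> sets M" by (rule window_set_measurable[OF window_sets_Diff[OF short_excursion_window_set]])
  note sC = simple_coordinate[OF finite_C, of 0] and sF = simple_coordinate[OF F(1), of 0]
  have long: "expectation (\<lambda>x. real (card (long_times L n {i\<in>{..<n}. x (int i) = a}))) \<le> n * measure M ?G" for n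
  proof -
    have "expectation (\<lambda>x. real (card (long_times L n (visits n (itin (code C) n x)))))
      \<le> (\<Sum>i<n. measure M ((left_shift ^^ i) -` ?G \<inter> space M))"
    proof (rule expectation_card_le[OF simple_itin[OF sC]])
      fix x assume x: "x \<in> space M"
      show "long_times L n (visits n (itin (code C) n x)) \<subseteq> {i\<in>{..<n}. x \<in> (left_shift ^^ i) -` ?G \<inter> space M}"
      proof
        fix i assume i: "i \<in> long_times L n (visits n (itin (code C) n x))"
        let ?Z = "{i\<in>{..<n}. x (int i) = a}"
        obtain p0 q0 where pq0: "p0 \<in> ?Z" "p0 \<le> i" "q0 \<in> ?Z" "i < q0"
          and no: "\<And>p q. p \<in> ?Z \<Longrightarrow> q \<in> ?Z \<Longrightarrow> p \<le> i \<Longrightarrow> i < q \<Longrightarrow> \<not> q \<le> p + L" and "i < n"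
          using i unfolding visits_itin long_times_def by blast
        have "(left_shift ^^ i) x \<notin> short_excursion_set A S a L"
        proof
          assume "(left_shift ^^ i) x \<in> short_excursion_set A S a L"
          then obtain p q where pq: "p \<le> 0" "0 < q" "q \<le> p + int L" "x (p + int i) = a" "x (q + int i) = a"
            by (auto simp: short_excursion_set_def left_shift_funpow)
          \<comment> \<open>The visits around time \<open>i\<close> may lie outside the segment.
            Taking \<open>p0\<close> or \<open>q0\<close> instead when these are closer keeps both
            visits inside and does not increase their distance.\<close>
          define p' where "p' = nat (max (p + int i) (int p0))"
          define q' where "q' = nat (min (q + int i) (int q0))"
          have p': "int p' = max (p + int i) (int p0)" and q': "int q' = min (q + int i) (int q0)"
            using pq by (auto simp: p'_def q'_def)
          have "x (int p') = a" unfolding p' using pq pq0 by (auto simp: max_def)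
          moreover have "x (int q') = a" unfolding q' using pq pq0 by (auto simp: min_def)
          moreover have "p' \<le> i" "i < q'" "q' \<le> p' + L" "q' < n"
            using p' q' pq pq0 by auto
          ultimately show False using no[of p' q'] by auto
        qed
        then show "i \<in> {i\<in>{..<n}. x \<in> (left_shift ^^ i) -` ?G \<inter> space M}"
          using \<open>i < n\<close> x funpow_in_space[OF x, of i] by (simp add: space_M)
      qed
    qed (rule measurable_sets[OF measurable_funpow G])
    also have "\<dots> = n * measure M ?G" by (simp add: measure_vimage_funpow[OF G])
    finally show ?thesis by (simp add: visits_itin)
  qed
  have boundary: "expectation (\<lambda>x. real (card (boundary_times n {i\<in>{..<n}. x (int i) = a})))
    \<le> 2 * (\<Sum>k<n. measure M (avoiding k))" for n
  proof -
    \<comment> \<open>A boundary time \<open>i\<close> has no visit before it, or none from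
      \<open>Suc i\<close> to the end of the segment.\<close>
    let ?E = "\<lambda>i. avoiding i \<union> ((left_shift ^^ Suc i) -` avoiding (n - Suc i) \<inter> space M)"
    note m = measurable_sets[OF measurable_funpow avoiding_measurable]
    have "expectation (\<lambda>x. real (card (boundary_times n (visits n (itin (code C) n x))))) \<le> (\<Sum>i<n. measure M (?E i))"
    proof (rule expectation_card_le[OF simple_itin[OF sC]])
      fix x assume x: "x \<in> space M"
      show "boundary_times n (visits n (itin (code C) n x)) \<subseteq> {i\<in>{..<n}. x \<in> ?E i}"
      proof
        fix i assume i: "i \<in> boundary_times n (visits n (itin (code C) n x))"
        then have "i < n" by (simp add: boundary_times_def)
        consider "\<forall>p<n. x (int p) = a \<longrightarrow> \<not> p \<le> i" | "\<forall>q<n. x (int q) = a \<longrightarrow> \<not> i < q"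
          using i unfolding visits_itin boundary_times_def by blast
        then have "x \<in> ?E i"
        proof cases
          case 1
          have "x (int j) \<noteq> a" if "j < i" for j
            using 1[rule_format, of j] that \<open>i < n\<close> by linarith
          then have "x \<in> avoiding i" using x by (simp add: avoiding_def space_M)
          then show ?thesis by simp
        next
          case 2
          have "x (int j + int (Suc i)) \<noteq> a" if "j < n - Suc i" for j
          proof -
            have "x (int (j + Suc i)) \<noteq> a" using 2[rule_format, of "j + Suc i"] that by linarith
            then show ?thesis by (simp only: of_nat_add not_False_eq_True)
          qed
          then have "(left_shift ^^ Suc i) x \<in> avoiding (n - Suc i)"
            using funpow_in_space[OF x, of "Suc i"] unfolding avoiding_def space_M
            by (simp only: left_shift_funpow mem_Collect_eq) simp
          then show ?thesis using x by simp
        qed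
        then show "i \<in> {i\<in>{..<n}. x \<in> ?E i}" using \<open>i < n\<close> by simp
      qed
    qed (intro sets.Un avoiding_measurable m)
    also have "\<dots> \<le> (\<Sum>i<n. measure M (avoiding i) + measure M (avoiding (n - Suc i)))"
    proof (rule sum_mono)
      fix i
      have "measure M (?E i) \<le> measure M (avoiding i) + measure M ((left_shift ^^ Suc i) -` avoiding (n - Suc i) \<inter> space M)"
        by (intro measure_Un_le avoiding_measurable m)
      then show "measure M (?E i) \<le> measure M (avoiding i) + measure M (avoiding (n - Suc i))"
        by (simp only: measure_vimage_funpow[OF avoiding_measurable])
    qed
    \<comment> \<open>The second summand runs through the same numbers in reverse order.\<close>
    also have "\<dots> = 2 * (\<Sum>k<n. measure M (avoiding k))"
      by (simp add: sum.distrib sum.nat_diff_reindex[of "\<lambda>k. measure M (avoiding k)"])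
    finally show ?thesis by (simp add: visits_itin)
  qed
  have lnK: "0 \<le> ln (real (Suc (card F)))" by simp
  have approx: "entropy_rate (code F) \<le> entropy_rate (code C) + (h * measure M ?G + 2 * e * ln (Suc (card F)))" if e: "e > 0" for e
  proof -
    obtain c where c: "\<And>n. (\<Sum>k<n. measure M (avoiding k)) \<le> n * e + c"
      using sum_le_linear_if_tendsto_0[OF measure_avoiding_tendsto_0 _ e] prob_le_1 by blast
    show ?thesis
    proof (rule entropy_rate_mono[OF sF sC])
      fix n
      have "expectation (\<lambda>x. real (card (boundary_times n {i\<in>{..<n}. x (int i) = a}))) * ln (Suc (card F))
          \<le> 2 * (n * e + c) * ln (Suc (card F))"
        using boundary[of n] c[of n] by (intro mult_right_mono lnK) auto
      moreover have "expectation (\<lambda>x. real (card (long_times L n {i\<in>{..<n}. x (int i) = a}))) * h \<le> n * measure M ?G * h"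
        by (intro mult_right_mono long h_nonneg)
      ultimately show "ent M (itin (code F) n) \<le> ent M (itin (code C) n) +
          n * (h * measure M ?G + 2 * e * ln (Suc (card F))) + 2 * c * ln (Suc (card F))"
        using ent_refinement[OF F, of n] by (simp add: algebra_simps)
    qed
  qed
  show ?thesis
  proof (rule field_le_epsilon)
    fix e :: real assume e: "e > 0"
    define d where "d = e / (2 * (ln (Suc (card F)) + 1))"
    have K: "0 < 2 * (ln (Suc (card F)) + 1)" by (intro mult_pos_pos add_nonneg_pos lnK) simp_all
    then have d: "d > 0" using e unfolding d_def by (rule divide_pos_pos[rotated])
    have "2 * d * ln (Suc (card F)) \<le> 2 * d * (ln (Suc (card F)) + 1)" using d by simp
    also have "\<dots> = d * (2 * (ln (Suc (card F)) + 1))" by (simp only: mult_ac)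
    also have "\<dots> = e" using K unfolding d_def by (metis less_irrefl nonzero_eq_divide_eq)
    finally show "entropy_rate (code F) \<le> entropy_rate (code C) + h * measure M ?G + e" using approx[OF d] by linarith
  qed
qed

text \<open>The preceding bound does not depend on \<open>F\<close>, so it passes to the supremum
  over all finite partitions.\<close>

lemma KS_entropy_le_code:
  "KS_entropy M left_shift \<le>
    ereal (entropy_rate (code C) + h * measure M (shift_space A S - short_excursion_set A S a L))"
proof (rule KS_entropy_le)
  fix X :: "(int \<Rightarrow> 'a) \<Rightarrow> (int \<Rightarrow> 'a) set" assume X: "simple_function M X"
  let ?r = "entropy_rate (code C) + h * measure M (shift_space A S - short_excursion_set A S a L)"
  have "entropy_rate X \<le> ?r + e" if "e > 0" for e
  proof -
    obtain F where F: "finite F" "\<And>F'. finite F' \<Longrightarrow> F \<subseteq> F' \<Longrightarrow> entropy_rate X \<le> entropy_rate (code F') + e"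
      using entropy_rate_le_finite_code[OF X \<open>e > 0\<close>] by blast
    have "entropy_rate X \<le> entropy_rate (code (F \<union> C)) + e" using F finite_C by auto
    also have "entropy_rate (code (F \<union> C)) \<le> ?r" using F(1) finite_C by (intro entropy_rate_refinement) auto
    finally show ?thesis by simp
  qed
  then show "ereal (entropy_rate X) \<le> ereal ?r" by (simp add: field_le_epsilon)
qed

end

section \<open>Upper semi-continuity\<close>

text \<open>Away from 0 this is continuity of \<open>ln\<close>. At 0 it rests on \<bar>t ln t\<bar>
  \<le> 2 sqrt t on the unit interval, obtained from \<open>ln (1 / s) \<le> 1 / s - 1\<close> with
  s = sqrt t.\<close>

lemma tendsto_x_ln_x:
  fixes p :: "'b \<Rightarrow> real"
  assumes lim: "(p \<longlongrightarrow> l) F" and p: "\<And>n. 0 \<le> p n" "\<And>n. p n \<le> 1" and l: "0 \<le> l"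
  shows "((\<lambda>n. p n * ln (p n)) \<longlongrightarrow> l * ln l) F"
proof (cases "l = 0")
  case False
  then show ?thesis by (intro tendsto_intros lim)
next
  case True
  have "((\<lambda>n. p n * ln (p n)) \<longlongrightarrow> 0) F"
  proof (rule Lim_null_comparison)
    show "((\<lambda>n. 2 * sqrt (p n)) \<longlongrightarrow> 0) F"
      using tendsto_mult_left[OF tendsto_real_sqrt[OF lim], of 2] True by simp
    have "norm (p n * ln (p n)) \<le> 2 * sqrt (p n)" for n
    proof (cases "p n = 0")
      case False
      then have pos: "p n > 0" using p(1)[of n] by linarith
      define s where "s = sqrt (p n)"
      have s: "s > 0" "p n = s * s" using pos by (auto simp: s_def)
      have "ln (1 / s) \<le> 1 / s - 1" using s by (intro ln_le_minus_one) auto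
      then have "- ln s \<le> 1 / s" using s by (simp add: ln_div)
      then have "2 * s * s * - ln s \<le> 2 * s * s * (1 / s)" using s by (intro mult_left_mono) auto
      then have "- (p n * ln (p n)) \<le> 2 * s" using s by (simp add: ln_mult)
      moreover have "p n * ln (p n) \<le> 0" using pos p(2)[of n] by (intro mult_nonneg_nonpos) auto
      ultimately show ?thesis by (simp add: s_def)
    qed simp
    then show "eventually (\<lambda>n. norm (p n * ln (p n)) \<le> 2 * sqrt (p n)) F" by simp
  qed
  then show ?thesis using True by simp
qed

text \<open>Otherwise the space would be a countable union of null sets.\<close>

lemma (in ergodic_shift) charged_symbol:
  obtains a where "a \<in> A" "measure M {x \<in> shift_space A S. x 0 = a} > 0"
proof (rule ccontr)
  assume "\<not> thesis"
  then have no: "\<not> 0 < measure M {x \<in> shift_space A S. x 0 = s}" if "s \<in> A" for s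
    using \<open>\<And>a. a \<in> A \<Longrightarrow> 0 < measure M {x \<in> shift_space A S. x 0 = a} \<Longrightarrow> thesis\<close> that by blast
  have "{x \<in> shift_space A S. x 0 = s} \<in> null_sets M" if "s \<in> A" for s
  proof -
    have "measure M {x \<in> shift_space A S. x 0 = s} = 0"
      using no[OF that] measure_nonneg[of M "{x \<in> shift_space A S. x 0 = s}"] by linarith
    then show ?thesis using measurable_pattern by (auto simp: null_sets_def emeasure_eq_measure)
  qed
  then have "(\<Union>s\<in>A. {x \<in> shift_space A S. x 0 = s}) \<in> null_sets M"
    by (rule null_sets_UN'[OF countable_alphabet])
  moreover have "(\<Union>s\<in>A. {x \<in> shift_space A S. x 0 = s}) = space M"
    unfolding space_M by (auto simp: shift_space_def)
  ultimately show False using prob_space by (simp add: null_sets_def emeasure_eq_measure)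
qed

text \<open>A point with a visit up to time 0 and another after time 0 is in the short-excursion set
  as soon as \<open>L\<close> reaches their distance; by recurrence almost every point has both
  visits.\<close>

lemma (in ergodic_shift) measure_not_short_excursion_tendsto_0:
  assumes a: "measure M {x \<in> shift_space A S. x 0 = a} > 0"
  shows "(\<lambda>L. measure M (shift_space A S - short_excursion_set A S a L)) \<longlonglongrightarrow> 0"
proof -
  let ?D = "\<lambda>L. shift_space A S - short_excursion_set A S a L"
  have D: "?D L \<in> sets M" for L
    by (rule window_set_measurable[OF window_sets_Diff[OF short_excursion_window_set]])
  have "(\<lambda>L. measure M (?D L)) \<longlonglongrightarrow> measure M (\<Inter>L. ?D L)"
  proof (rule finite_Lim_measure_decseq)
    show "range ?D \<subseteq> sets M" using D by blast
    show "decseq ?D"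
      unfolding decseq_def
    proof (intro allI impI subsetI)
      fix m n x assume "m \<le> n" and x: "x \<in> ?D n"
      have "x \<notin> short_excursion_set A S a m"
      proof
        assume "x \<in> short_excursion_set A S a m"
        then obtain p q where "p \<le> 0" "0 < q" "q \<le> p + int m" "x p = a" "x q = a"
          by (auto simp: short_excursion_set_def)
        moreover from this have "q \<le> p + int n" using \<open>m \<le> n\<close> by linarith
        ultimately have "x \<in> short_excursion_set A S a n" using x by (auto simp: short_excursion_set_def)
        then show False using x by simp
      qed
      then show "x \<in> ?D m" using x by simp
    qed
  qed
  moreover have "measure M (\<Inter>L. ?D L) = 0"
  proof -
    let ?U = "{x \<in> shift_space A S. \<exists>i\<ge>1. x i = a}" and ?P = "{x \<in> shift_space A S. \<exists>i\<le>0. x i = a}"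
    note r = recurrence(1)[OF a, of 1] recurrence(2)[OF a, of 0]
    have m: "?U \<in> sets M" "?P \<in> sets M" using r measure_notin_sets by fastforce+
    have "(\<Inter>L. ?D L) \<subseteq> (space M - ?U) \<union> (space M - ?P)"
    proof
      fix x assume x: "x \<in> (\<Inter>L. ?D L)"
      then have xs: "x \<in> shift_space A S" by auto
      show "x \<in> (space M - ?U) \<union> (space M - ?P)"
      proof (rule ccontr)
        assume "x \<notin> (space M - ?U) \<union> (space M - ?P)"
        then obtain p q where "p \<le> 0" "1 \<le> q" "x p = a" "x q = a" using xs by (auto simp: space_M)
        then have "x \<in> short_excursion_set A S a (nat (q - p))"
          using xs unfolding short_excursion_set_def by (intro CollectI conjI exI[of _ p] exI[of _ q]) auto
        then show False using x by blast
      qed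
    qed
    then have "measure M (\<Inter>L. ?D L) \<le> measure M ((space M - ?U) \<union> (space M - ?P))"
      using m by (intro finite_measure_mono) auto
    also have "\<dots> \<le> measure M (space M - ?U) + measure M (space M - ?P)"
      using m by (intro measure_Un_le) auto
    also have "\<dots> = 0" using prob_compl[OF m(1)] prob_compl[OF m(2)] r by simp
    finally show ?thesis using measure_nonneg[of M "\<Inter>L. ?D L"] by linarith
  qed
  ultimately show ?thesis by simp
qed

theorem theorem1p1:
  fixes A :: "'a set" and S :: "'a \<Rightarrow> 'a \<Rightarrow> nat"
    and \<mu> :: "nat \<Rightarrow> (int \<Rightarrow> 'a) measure" and \<nu> :: "(int \<Rightarrow> 'a) measure"
  assumes "countable A"
    and "zero_one_matrix A S"
    and "top_entropy A S < \<infinity>"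
    and "\<And>n. \<mu> n \<in> ergodic_measures A S"
    and "\<nu> \<in> ergodic_measures A S"
    and "weak_star_convergent (shift_topology A S) \<mu> \<nu>"
  shows "limsup (\<lambda>n. KS_entropy (\<mu> n) left_shift) \<le> KS_entropy \<nu> left_shift"
proof -
  interpret N: ergodic_shift A S \<nu> using assms(1,5) by unfold_locales
  have E: "ergodic_shift A S (\<mu> n)" for n using assms(1) assms(4)[of n] by unfold_locales
  note sets = ergodic_shift.sets_M[OF E] N.sets_M
  \<comment> \<open>The limit measure itself excludes the value of an empty supremum, so
    \<open>h\<close> is a nonnegative real.\<close>
  have "0 \<le> top_entropy A S"
    unfolding top_entropy_def using N.KS_entropy_nonneg SUP_upper[OF assms(5)] by (rule order_trans)
  then obtain h where h: "top_entropy A S = ereal h" "0 \<le> h"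
    using assms(3) by (cases "top_entropy A S") auto
  have loops: "finite (loops A S s m)" "real (card (loops A S s m)) \<le> exp (h * m)" for s m
    using loops_bound[OF assms(1), of S h s m] h(1) by auto
  obtain a where a: "a \<in> A" "measure \<nu> {x \<in> shift_space A S. x 0 = a} > 0" by (rule N.charged_symbol)
  have "{x \<in> shift_space A S. x 0 = a} \<in> window_sets A S id" by (rule window_setsI[where k = 0]) auto
  from weak_star_measure_window_set[OF assms(6) this sets]
  \<comment> \<open>The symbol \<open>a\<close> is chosen for the limit measure; along the sequence
    it is charged eventually, which is enough for a limsup.\<close>
  have ev_a: "\<forall>\<^sub>F n in sequentially. measure (\<mu> n) {x \<in> shift_space A S. x 0 = a} > 0"
    using order_tendstoD(1) a(2) by blast
  show ?thesis
  proof (rule ereal_le_epsilon2)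
    fix e :: real assume "0 < e"
    \<comment> \<open>Two errors of size \<open>\<delta>\<close> occur, one from the long excursions
      and one from the finite window.\<close>
    define \<delta> where "\<delta> = e / 3"
    have \<delta>: "\<delta> > 0" using \<open>0 < e\<close> by (simp add: \<delta>_def)
    let ?D = "\<lambda>L. shift_space A S - short_excursion_set A S a L"
    have "(\<lambda>L. h * measure \<nu> (?D L)) \<longlonglongrightarrow> h * 0"
      by (intro tendsto_intros N.measure_not_short_excursion_tendsto_0[OF a(2)])
    then have "\<forall>\<^sub>F L in sequentially. h * measure \<nu> (?D L) < \<delta>" using order_tendstoD(2) \<delta> by fastforce
    \<comment> \<open>\<open>L\<close> is chosen for the limit measure; as the set is clopen, the
      same \<open>L\<close> works eventually along the sequence.\<close>
    then obtain L where L: "h * measure \<nu> (?D L) < \<delta>" by (auto simp: eventually_sequentially)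
    have "?D L \<in> window_sets A S id" by (rule window_sets_Diff[OF short_excursion_window_set])
    from tendsto_mult_left[OF weak_star_measure_window_set[OF assms(6) this sets], of h]
    have ev_D: "\<forall>\<^sub>F n in sequentially. h * measure (\<mu> n) (?D L) < \<delta>"
      using order_tendstoD(2) L by blast
    \<comment> \<open>Independent of \<open>n\<close>, and finite by the loop bound;
      \<open>a\<close> is inserted so that the code shows the visits even if there are no short
      loops.\<close>
    define C where "C = insert a (\<Union>m\<in>{..L}. \<Union>w\<in>loops A S a m. set w)"
    have finC: "finite C" using loops(1) by (auto simp: C_def)
    let ?X = "\<lambda>x::int \<Rightarrow> 'a. symbol_code C (x 0)"
    let ?I = "N.itin ?X"
    have X: "simple_function \<nu> ?X" by (rule N.simple_coordinate[OF finC])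
    have "\<forall>\<^sub>F k in sequentially. ent \<nu> (?I k) / k < N.entropy_rate ?X + \<delta>"
      using order_tendstoD(2)[OF N.entropy_rate_limit[OF X]] \<delta> by simp
    then have "\<forall>\<^sub>F k in sequentially. ent \<nu> (?I k) / k < N.entropy_rate ?X + \<delta> \<and> k \<ge> 1"
      using eventually_ge_at_top by (rule eventually_conj)
    then obtain k where k: "ent \<nu> (?I k) / k < N.entropy_rate ?X + \<delta>" "k \<ge> 1"
      by (auto simp: eventually_sequentially)
    \<comment> \<open>A value set independent of \<open>n\<close>, so that all the entropies are
      sums over the same finite index set.\<close>
    let ?V = "PiE {..<k} (\<lambda>_. insert None (Some ` C))"
    have finV: "finite ?V" using finC by (intro finite_PiE) auto
    have IV: "?I k ` Y \<subseteq> ?V" for Y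
      unfolding N.itin_def by (rule image_subsetI, rule restrict_PiE_iff[THEN iffD2]) (auto simp: symbol_code_def)
    have law: "(\<lambda>n. law (\<mu> n) (?I k) v) \<longlonglongrightarrow> law \<nu> (?I k) v" for v
    proof -
      have "?I k -` {v} \<inter> shift_space A S \<in> window_sets A S id"
      proof (rule window_setsI[where k = "int k"])
        fix x y assume x: "x \<in> ?I k -` {v} \<inter> shift_space A S" and y: "y \<in> shift_space A S"
          and eq: "\<And>i. \<bar>i\<bar> \<le> int k \<Longrightarrow> id (x i) = id (y i)"
        have "?I k y = ?I k x" using eq by (auto simp: N.itin_def left_shift_funpow fun_eq_iff restrict_def)
        then show "y \<in> ?I k -` {v} \<inter> shift_space A S" using x y by simp
      qed simp
      from weak_star_measure_window_set[OF assms(6) this sets]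
      show ?thesis by (simp add: law_def ergodic_shift.space_M[OF E] N.space_M)
    qed
    have "(\<lambda>n. \<Sum>v\<in>?V. - (law (\<mu> n) (?I k) v * ln (law (\<mu> n) (?I k) v))) \<longlonglongrightarrow> (\<Sum>v\<in>?V. - (law \<nu> (?I k) v * ln (law \<nu> (?I k) v)))"
    proof (intro tendsto_sum tendsto_minus tendsto_x_ln_x law law_nonneg N.law_le_1)
      fix v n
      interpret ergodic_shift A S "\<mu> n" by (rule E)
      show "law (\<mu> n) (?I k) v \<le> 1" by (rule law_le_1)
    qed
    then have "(\<lambda>n. ent (\<mu> n) (?I k)) \<longlonglongrightarrow> ent \<nu> (?I k)"
      by (simp add: ent_eq_sum[OF finV IV])
    then have "(\<lambda>n. ent (\<mu> n) (?I k) / k) \<longlonglongrightarrow> ent \<nu> (?I k) / k" using k(2) by (intro tendsto_divide) auto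
    then have "\<forall>\<^sub>F n in sequentially. ent (\<mu> n) (?I k) / k < N.entropy_rate ?X + \<delta>"
      using order_tendstoD(2) k(1) by blast
    with ev_a ev_D have "\<forall>\<^sub>F n in sequentially. KS_entropy (\<mu> n) left_shift \<le> KS_entropy \<nu> left_shift + ereal e"
    proof eventually_elim
      case (elim n)
      interpret ergodic_shift A S "\<mu> n" by (rule E)
      interpret excursion_code A S "\<mu> n" a C L h
        by unfold_locales (use elim(1) finC loops h(2) in \<open>auto simp: C_def\<close>)
      have "KS_entropy (\<mu> n) left_shift \<le> ereal (entropy_rate ?X + h * measure (\<mu> n) (?D L))"
        by (rule KS_entropy_le_code)
      also have "\<dots> \<le> ereal (N.entropy_rate ?X + e)"
      proof -
        \<comment> \<open>\<open>?I\<close> was formed for the limit measure, but itineraries do not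
          depend on the measure; and the rate is an infimum, so the \<open>k\<close> chosen for the
          limit bounds the rate of \<open>\<mu> n\<close> as well.\<close>
        have "entropy_rate ?X \<le> ent (\<mu> n) (?I k) / k"
          by (rule entropy_rate_le[OF simple_coordinate[OF finC] k(2)])
        then have "entropy_rate ?X + h * measure (\<mu> n) (?D L) \<le> N.entropy_rate ?X + e"
          using elim(2,3) \<open>0 < e\<close> unfolding \<delta>_def by linarith
        then show ?thesis by simp
      qed
      also have "\<dots> = ereal (N.entropy_rate ?X) + ereal e" by simp
      also have "\<dots> \<le> KS_entropy \<nu> left_shift + ereal e"
        by (intro add_right_mono N.entropy_rate_le_KS X)
      finally show ?case .
    qed
    then show "limsup (\<lambda>n. KS_entropy (\<mu> n) left_shift) \<le> KS_entropy \<nu> left_shift + ereal e"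
      by (rule Limsup_bounded)
  qed
qed

end
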